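(* The assignment $\tilde s_i\mapsto s_i$, $\tilde E_i\mapsto E_i$ ($1\le i\le n-1$) defines a surjective morphism of algebras $$\mathrm{TB}_n\to\Bbbk[\mathcal{FB}_{d,n}]^{\mathfrak{S}_d},$$ which is an isomorphism if and only if $d\geq n$.
   Context: $d\ge1$, $n\geq1$, and $\Bbbk$ is a field in which $d$ is invertible and which contains a primitive $d$-th root of unity $\zeta$. The framed braid group $\mathcal{FB}_{d,n}$ has generators $s_1,\dots,s_{n-1},t_1,\dots,t_n$ and relations $s_is_j=s_js_i$ if $|i-j|>1$, $s_is_js_i=s_js_is_j$ if $|i-j|=1$, $t_i^d=1$, $t_it_j=t_jt_i$, $s_it_j=t_{s_i(j)}s_i$, where $s_i$ acts on indices as the transposition $(i,i+1)$. In its group algebra, $E_i=\frac1d\sum_{a=1}^dt_i^at_{i+1}^{-a}$. $\mathcal{P}_d(n)$ is the set of $d$-tuples $I=(I_1,\dots,I_d)$ of pairwise disjoint (possibly empty) subsets of $\{1,\dots,n\}$ with union $\{1,\dots,n\}$; $\mathrm{pos}_j(I)$ is the unique $a$ with $j\in I_a$; and $E_I=\prod_{i=1}^n\bigl(\frac1d\sum_{l=1}^d\zeta^{-l(\mathrm{pos}_i(I)-1)}t_i^l\bigr)$. The elements $E_I\sigma$, with $I\in\mathcal{P}_d(n)$ and $\sigma\in\mathcal{B}_n$ (the braid group generated by $s_1,\dots,s_{n-1}$), form a basis of $\Bbbk[\mathcal{FB}_{d,n}]$. The symmetric group $\mathfrak{S}_d$ acts on $\Bbbk[\mathcal{FB}_{d,n}]$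 by algebra automorphisms via $w\cdot(E_I\sigma)=E_{w\cdot I}\sigma$, where $w\cdot(I_1,\dots,I_d)=(I_{w^{-1}(1)},\dots,I_{w^{-1}(d)})$; $\Bbbk[\mathcal{FB}_{d,n}]^{\mathfrak{S}_d}$ is the fixed-point subalgebra. The tied braid algebra $\mathrm{TB}_n$ is the $\Bbbk$-algebra with invertible generators $\tilde s_1,\dots,\tilde s_{n-1}$ satisfying the braid relations, and generators $\tilde E_1,\dots,\tilde E_{n-1}$ with relations: $\tilde E_i\tilde E_j=\tilde E_j\tilde E_i$; $\tilde E_i^2=\tilde E_i$; $\tilde s_i\tilde E_i=\tilde E_i\tilde s_i$; $\tilde s_i\tilde E_j=\tilde E_j\tilde s_i$ for $|i-j|>1$; and, for $|i-j|=1$: $\tilde E_i\tilde s_j\tilde s_i=\tilde s_j\tilde s_i\tilde E_j$, $\tilde E_i\tilde s_j\tilde s_i^{-1}=\tilde s_j\tilde s_i^{-1}\tilde E_j$, $\tilde E_i\tilde E_j\tilde s_i=\tilde E_j\tilde s_i\tilde E_j=\tilde s_i\tilde E_j\tilde E_i$. *)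

theory Defs
  imports "HOL-Algebra.QuotRing" "HOL-Algebra.Module" "HOL-Algebra.Generated_Groups" "HOL-Combinatorics.Permutations"
begin

section \<open>Presented groups\<close>

text \<open>A letter \<open>(x, True)\<close> stands for the generator \<open>x\<close>, and \<open>(x, False)\<close> for its inverse.\<close>

type_synonym 'g gword = "('g \<times> bool) list"

inductive_set word_cong :: "'g set \<Rightarrow> ('g gword \<times> 'g gword) set \<Rightarrow> ('g gword \<times> 'g gword) set"
  for Gs :: "'g set" and R :: "('g gword \<times> 'g gword) set" where
  refl: "w \<in> lists (Gs \<times> UNIV) \<Longrightarrow> (w, w) \<in> word_cong Gs R"
| sym: "(u, v) \<in> word_cong Gs R \<Longrightarrow> (v, u) \<in> word_cong Gs R"
| trans: "(u, v) \<in> word_cong Gs R \<Longrightarrow> (v, w) \<in> word_cong Gs R \<Longrightarrow> (u, w) \<in> word_cong Gs R"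
| append: "(u, v) \<in> word_cong Gs R \<Longrightarrow> (u', v') \<in> word_cong Gs R \<Longrightarrow>
    (u @ u', v @ v') \<in> word_cong Gs R"
| cancel: "x \<in> Gs \<Longrightarrow> ([(x, b), (x, \<not> b)], []) \<in> word_cong Gs R"
| relation: "(u, v) \<in> R \<Longrightarrow> (u, v) \<in> word_cong Gs R"

text \<open>The group with generating set \<open>Gs\<close> and relations \<open>u = v\<close> for \<open>(u, v) \<in> R\<close>
  (the words in \<open>R\<close> are meant to use letters from \<open>Gs\<close> only).\<close>

definition presented_group ::
    "'g set \<Rightarrow> ('g gword \<times> 'g gword) set \<Rightarrow> 'g gword set monoid" where
  "presented_group Gs R =
    \<lparr>carrier = lists (Gs \<times> UNIV) // word_cong Gs R,
     monoid.mult = (\<lambda>A B. \<Union>a\<in>A. \<Union>b\<in>B. word_cong Gs R `` {a @ b}),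
     one = word_cong Gs R `` {[]}\<rparr>"

definition group_gen :: "'g set \<Rightarrow> ('g gword \<times> 'g gword) set \<Rightarrow> 'g \<Rightarrow> 'g gword set" where
  "group_gen Gs R x = word_cong Gs R `` {[(x, True)]}"


section \<open>Algebras over a field given as a type\<close>

text \<open>Associative unital algebras over \<open>'k\<close> are represented by module records. The locale
  \<^locale>\<open>algebra\<close> of \<^theory>\<open>HOL-Algebra.Module\<close> is not used, as it requires commutativity.\<close>

definition linear_maps :: "('k, 'a) module \<Rightarrow> ('k, 'b) module \<Rightarrow> ('a \<Rightarrow> 'b) set" where
  "linear_maps A B = {f \<in> carrier A \<rightarrow> carrier B.
     (\<forall>x\<in>carrier A. \<forall>y\<in>carrier A. f (x \<oplus>\<^bsub>A\<^esub> y) = f x \<oplus>\<^bsub>B\<^esub> f y) \<and>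
     (\<forall>c. \<forall>x\<in>carrier A. f (c \<odot>\<^bsub>A\<^esub> x) = c \<odot>\<^bsub>B\<^esub> f x)}"

definition alg_hom :: "('k, 'a) module \<Rightarrow> ('k, 'b) module \<Rightarrow> ('a \<Rightarrow> 'b) set" where
  "alg_hom A B = ring_hom A B \<inter> linear_maps A B"

definition alg_iso :: "('k, 'a) module \<Rightarrow> ('k, 'b) module \<Rightarrow> ('a \<Rightarrow> 'b) set" where
  "alg_iso A B = {f \<in> alg_hom A B. bij_betw f (carrier A) (carrier B)}"

definition monoid_algebra :: "('m, 'x) monoid_scheme \<Rightarrow> ('k::field, 'm \<Rightarrow> 'k) module" where
  "monoid_algebra M =
    \<lparr>carrier = {f. finite {x. f x \<noteq> 0} \<and> {x. f x \<noteq> 0} \<subseteq> carrier M},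
     monoid.mult = (\<lambda>f g z. \<Sum>(x, y)\<in>{(x, y). f x \<noteq> 0 \<and> g y \<noteq> 0 \<and> x \<otimes>\<^bsub>M\<^esub> y = z}. f x * g y),
     one = (\<lambda>z. if z = \<one>\<^bsub>M\<^esub> then 1 else 0),
     zero = (\<lambda>z. 0),
     add = (\<lambda>f g z. f z + g z),
     module.smult = (\<lambda>c f z. c * f z)\<rparr>"

definition basis_elt :: "'m \<Rightarrow> 'm \<Rightarrow> 'k::field" where
  "basis_elt x = (\<lambda>z. if z = x then 1 else 0)"

definition free_monoid :: "'g set \<Rightarrow> 'g list monoid" where
  "free_monoid Gs = \<lparr>carrier = lists Gs, monoid.mult = (@), one = []\<rparr>"

text \<open>The monoid algebra of the free monoid is the free associative algebra.\<close>

abbreviation free_algebra :: "'g set \<Rightarrow> ('k::field, 'g list \<Rightarrow> 'k) module" where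
  "free_algebra Gs \<equiv> monoid_algebra (free_monoid Gs)"

text \<open>\<^const>\<open>FactRing\<close> together with the induced scalar multiplication.\<close>

definition quotient_algebra :: "('k, 'a) module \<Rightarrow> 'a set \<Rightarrow> ('k, 'a set) module" where
  "quotient_algebra A J =
    ring.extend (A Quot J) (module.fields (\<lambda>c C. \<Union>x\<in>C. J +>\<^bsub>A\<^esub> (c \<odot>\<^bsub>A\<^esub> x)))"

text \<open>The algebra with generating set \<open>Gs\<close> and monomial relations \<open>u = v\<close> for \<open>(u, v) \<in> R\<close>.
  Ideals are two-sided.\<close>

definition relation_ideal ::
    "'g set \<Rightarrow> ('g list \<times> 'g list) set \<Rightarrow> ('g list \<Rightarrow> 'k::field) set" where
  "relation_ideal Gs R =
    Idl\<^bsub>free_algebra Gs\<^esub> {basis_elt u \<ominus>\<^bsub>free_algebra Gs\<^esub> basis_elt v | u v. (u, v) \<in> R}"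

definition presented_algebra ::
    "'g set \<Rightarrow> ('g list \<times> 'g list) set \<Rightarrow> ('k::field, ('g list \<Rightarrow> 'k) set) module" where
  "presented_algebra Gs R = quotient_algebra (free_algebra Gs) (relation_ideal Gs R)"

definition algebra_gen ::
    "'g set \<Rightarrow> ('g list \<times> 'g list) set \<Rightarrow> 'g \<Rightarrow> ('g list \<Rightarrow> 'k::field) set" where
  "algebra_gen Gs R x = relation_ideal Gs R +>\<^bsub>free_algebra Gs\<^esub> basis_elt [x]"


section \<open>The framed braid group\<close>

datatype fb_gen = Sigma_gen nat | T_gen nat

definition fb_gens :: "nat \<Rightarrow> fb_gen set" where
  "fb_gens n = Sigma_gen ` {1..<n} \<union> T_gen ` {1..n}"

abbreviation (input) sw :: "nat \<Rightarrow> fb_gen gword" where "sw i \<equiv> [(Sigma_gen i, True)]"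
abbreviation (input) tw :: "nat \<Rightarrow> fb_gen gword" where "tw i \<equiv> [(T_gen i, True)]"

inductive_set fb_rels :: "nat \<Rightarrow> nat \<Rightarrow> (fb_gen gword \<times> fb_gen gword) set"
  for d n :: nat where
  ss: "\<lbrakk>i \<in> {1..<n}; j \<in> {1..<n}; \<bar>int i - int j\<bar> > 1\<rbrakk> \<Longrightarrow> (sw i @ sw j, sw j @ sw i) \<in> fb_rels d n"
| sss: "\<lbrakk>i \<in> {1..<n}; j \<in> {1..<n}; \<bar>int i - int j\<bar> = 1\<rbrakk> \<Longrightarrow>
    (sw i @ sw j @ sw i, sw j @ sw i @ sw j) \<in> fb_rels d n"
| t_pow: "i \<in> {1..n} \<Longrightarrow> (replicate d (T_gen i, True), []) \<in> fb_rels d n"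
| tt: "\<lbrakk>i \<in> {1..n}; j \<in> {1..n}\<rbrakk> \<Longrightarrow> (tw i @ tw j, tw j @ tw i) \<in> fb_rels d n"
| st: "\<lbrakk>i \<in> {1..<n}; j \<in> {1..n}\<rbrakk> \<Longrightarrow>
    (sw i @ tw j, tw (Transposition.transpose i (i + 1) j) @ sw i) \<in> fb_rels d n"

definition framed_braid_group :: "nat \<Rightarrow> nat \<Rightarrow> fb_gen gword set monoid" where
  "framed_braid_group d n = presented_group (fb_gens n) (fb_rels d n)"

definition fb_s :: "nat \<Rightarrow> nat \<Rightarrow> nat \<Rightarrow> fb_gen gword set" where
  "fb_s d n i = group_gen (fb_gens n) (fb_rels d n) (Sigma_gen i)"

definition fb_t :: "nat \<Rightarrow> nat \<Rightarrow> nat \<Rightarrow> fb_gen gword set" where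
  "fb_t d n i = group_gen (fb_gens n) (fb_rels d n) (T_gen i)"

definition braid_subgroup :: "nat \<Rightarrow> nat \<Rightarrow> fb_gen gword set set" where
  "braid_subgroup d n = generate (framed_braid_group d n) (fb_s d n ` {1..<n})"

definition fb_algebra :: "nat \<Rightarrow> nat \<Rightarrow> ('k::field, fb_gen gword set \<Rightarrow> 'k) module" where
  "fb_algebra d n = monoid_algebra (framed_braid_group d n)"

definition fb_E :: "nat \<Rightarrow> nat \<Rightarrow> nat \<Rightarrow> fb_gen gword set \<Rightarrow> 'k::field" where
  "fb_E d n i = (1 / of_nat d) \<odot>\<^bsub>fb_algebra d n\<^esub>
    (\<Oplus>\<^bsub>fb_algebra d n\<^esub>a\<in>{1..d}.
       basis_elt (fb_t d n i [^]\<^bsub>framed_braid_group d n\<^esub> int a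
         \<otimes>\<^bsub>framed_braid_group d n\<^esub> fb_t d n (i + 1) [^]\<^bsub>framed_braid_group d n\<^esub> (- int a)))"


section \<open>The action of the symmetric group\<close>

definition primitive_root_of_unity :: "nat \<Rightarrow> 'k::field \<Rightarrow> bool" where
  "primitive_root_of_unity d \<zeta> \<longleftrightarrow> \<zeta> ^ d = 1 \<and> (\<forall>k. 0 < k \<and> k < d \<longrightarrow> \<zeta> ^ k \<noteq> 1)"

definition ordered_partitions :: "nat \<Rightarrow> nat \<Rightarrow> (nat \<Rightarrow> nat set) set" where
  "ordered_partitions d n = {I \<in> {1..d} \<rightarrow>\<^sub>E Pow {1..n}.
     disjoint_family_on I {1..d} \<and> (\<Union>a\<in>{1..d}. I a) = {1..n}}"

definition part_pos :: "nat \<Rightarrow> (nat \<Rightarrow> nat set) \<Rightarrow> nat \<Rightarrow> nat" where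
  "part_pos d I j = (THE a. a \<in> {1..d} \<and> j \<in> I a)"

definition idem_factor :: "nat \<Rightarrow> nat \<Rightarrow> 'k::field \<Rightarrow> (nat \<Rightarrow> nat set) \<Rightarrow> nat \<Rightarrow>
    fb_gen gword set \<Rightarrow> 'k" where
  "idem_factor d n \<zeta> I i = (1 / of_nat d) \<odot>\<^bsub>fb_algebra d n\<^esub>
    (\<Oplus>\<^bsub>fb_algebra d n\<^esub>l\<in>{1..d}.
       (\<zeta> powi (- (int l * (int (part_pos d I i) - 1))))
         \<odot>\<^bsub>fb_algebra d n\<^esub> basis_elt (fb_t d n i [^]\<^bsub>framed_braid_group d n\<^esub> l))"

text \<open>The product is taken in the order \<open>1, \<dots>, n\<close>, because \<^const>\<open>finprod\<close> is intended for
  commutative monoids.\<close>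

definition part_idem :: "nat \<Rightarrow> nat \<Rightarrow> 'k::field \<Rightarrow> (nat \<Rightarrow> nat set) \<Rightarrow> fb_gen gword set \<Rightarrow> 'k" where
  "part_idem d n \<zeta> I =
    foldr (\<lambda>i x. idem_factor d n \<zeta> I i \<otimes>\<^bsub>fb_algebra d n\<^esub> x) [1..<Suc n] \<one>\<^bsub>fb_algebra d n\<^esub>"

definition perm_part :: "(nat \<Rightarrow> nat) \<Rightarrow> (nat \<Rightarrow> nat set) \<Rightarrow> nat \<Rightarrow> nat set" where
  "perm_part w I = (\<lambda>a. I (inv_into UNIV w a))"

text \<open>The action of \<open>w\<close> is determined by linearity and its values on the basis of the elements
  \<open>E\<^sub>I \<sigma>\<close>.\<close>

definition perm_action :: "nat \<Rightarrow> nat \<Rightarrow> 'k::field \<Rightarrow> (nat \<Rightarrow> nat) \<Rightarrow>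
    (fb_gen gword set \<Rightarrow> 'k) \<Rightarrow> (fb_gen gword set \<Rightarrow> 'k)" where
  "perm_action d n \<zeta> w = (THE f.
     f \<in> linear_maps (fb_algebra d n) (fb_algebra d n) \<and>
     f \<in> extensional (carrier (fb_algebra d n)) \<and>
     (\<forall>I\<in>ordered_partitions d n. \<forall>\<sigma>\<in>braid_subgroup d n.
        f (part_idem d n \<zeta> I \<otimes>\<^bsub>fb_algebra d n\<^esub> basis_elt \<sigma>) =
          part_idem d n \<zeta> (perm_part w I) \<otimes>\<^bsub>fb_algebra d n\<^esub> basis_elt \<sigma>))"

definition fixed_algebra :: "nat \<Rightarrow> nat \<Rightarrow> 'k::field \<Rightarrow> ('k, fb_gen gword set \<Rightarrow> 'k) module" where
  "fixed_algebra d n \<zeta> = (fb_algebra d n)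
    \<lparr>carrier := {x \<in> carrier (fb_algebra d n).
       \<forall>w. w permutes {1..d} \<longrightarrow> perm_action d n \<zeta> w x = x}\<rparr>"


section \<open>The tied braid algebra\<close>

text \<open>\<open>TSinv i\<close> is the inverse of the invertible generator \<open>TS i\<close>.\<close>

datatype tb_gen = TS nat | TSinv nat | TE nat

definition tb_gens :: "nat \<Rightarrow> tb_gen set" where
  "tb_gens n = TS ` {1..<n} \<union> TSinv ` {1..<n} \<union> TE ` {1..<n}"

inductive_set tb_rels :: "nat \<Rightarrow> (tb_gen list \<times> tb_gen list) set" for n :: nat where
  inv_right: "i \<in> {1..<n} \<Longrightarrow> ([TS i, TSinv i], []) \<in> tb_rels n"
| inv_left: "i \<in> {1..<n} \<Longrightarrow> ([TSinv i, TS i], []) \<in> tb_rels n"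
| ss: "\<lbrakk>i \<in> {1..<n}; j \<in> {1..<n}; \<bar>int i - int j\<bar> > 1\<rbrakk> \<Longrightarrow> ([TS i, TS j], [TS j, TS i]) \<in> tb_rels n"
| sss: "\<lbrakk>i \<in> {1..<n}; j \<in> {1..<n}; \<bar>int i - int j\<bar> = 1\<rbrakk> \<Longrightarrow>
    ([TS i, TS j, TS i], [TS j, TS i, TS j]) \<in> tb_rels n"
| EE: "\<lbrakk>i \<in> {1..<n}; j \<in> {1..<n}\<rbrakk> \<Longrightarrow> ([TE i, TE j], [TE j, TE i]) \<in> tb_rels n"
| E_idem: "i \<in> {1..<n} \<Longrightarrow> ([TE i, TE i], [TE i]) \<in> tb_rels n"
| sE: "i \<in> {1..<n} \<Longrightarrow> ([TS i, TE i], [TE i, TS i]) \<in> tb_rels n"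
| sE_far: "\<lbrakk>i \<in> {1..<n}; j \<in> {1..<n}; \<bar>int i - int j\<bar> > 1\<rbrakk> \<Longrightarrow>
    ([TS i, TE j], [TE j, TS i]) \<in> tb_rels n"
| Ess: "\<lbrakk>i \<in> {1..<n}; j \<in> {1..<n}; \<bar>int i - int j\<bar> = 1\<rbrakk> \<Longrightarrow>
    ([TE i, TS j, TS i], [TS j, TS i, TE j]) \<in> tb_rels n"
| Ess_inv: "\<lbrakk>i \<in> {1..<n}; j \<in> {1..<n}; \<bar>int i - int j\<bar> = 1\<rbrakk> \<Longrightarrow>
    ([TE i, TS j, TSinv i], [TS j, TSinv i, TE j]) \<in> tb_rels n"
| EEs: "\<lbrakk>i \<in> {1..<n}; j \<in> {1..<n}; \<bar>int i - int j\<bar> = 1\<rbrakk> \<Longrightarrow>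
    ([TE i, TE j, TS i], [TE j, TS i, TE j]) \<in> tb_rels n"
| EsE: "\<lbrakk>i \<in> {1..<n}; j \<in> {1..<n}; \<bar>int i - int j\<bar> = 1\<rbrakk> \<Longrightarrow>
    ([TE j, TS i, TE j], [TS i, TE j, TE i]) \<in> tb_rels n"

definition tied_braid_algebra :: "nat \<Rightarrow> ('k::field, (tb_gen list \<Rightarrow> 'k) set) module" where
  "tied_braid_algebra n = presented_algebra (tb_gens n) (tb_rels n)"

definition tb_s :: "nat \<Rightarrow> nat \<Rightarrow> (tb_gen list \<Rightarrow> 'k::field) set" where
  "tb_s n i = algebra_gen (tb_gens n) (tb_rels n) (TS i)"

definition tb_E :: "nat \<Rightarrow> nat \<Rightarrow> (tb_gen list \<Rightarrow> 'k::field) set" where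
  "tb_E n i = algebra_gen (tb_gens n) (tb_rels n) (TE i)"

end

theory Submission
  imports Defs
begin

text \<open>A \<open>colouring\<close> assigns to each of the \<open>n\<close> strands one of the colours \<open>1, \<dots>, d\<close>; colourings are the
same as the tuples \<open>I\<close> in \<open>P\<^sub>d(n)\<close>. The proof compares both algebras through the basis
\<open>E\<^sub>I \<sigma>\<close> of the group algebra, indexed by a colouring and a braid.

Its coordinate functionals are explicit. The framed braid group acts on colourings monomially:
braids permute the strands, and \<open>t\<^sub>i\<close> multiplies by a power of \<open>\<zeta>\<close> given by the colour of strand \<open>i\<close>.
The matrix coefficients of this representation, combined with the projection of the framed braid
group onto the braid group, are dual to the \<open>E\<^sub>I \<sigma>\<close> (\<open>dual_basis\<close>), and they separate the elements of
the group algebra (\<open>character_ext\<close>) by Fourier inversion over the framings. In these coordinates the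
symmetric group permutes the colours (\<open>character_lin_permuted\<close>), so an element is fixed if and only if
its coordinates depend only on the braid and on the kernel of the colouring, that is, on which
strands have equal colours (\<open>fixed_kernel\<close>).

A word \<open>w\<close> in the generators of the tied braid algebra has very simple coordinates
(\<open>character_ev\<close>): it contributes its underlying braid at each colouring that is constant along the
ties of \<open>w\<close>, and nothing elsewhere. This immediately gives the defining relations, hence the
homomorphism, and it shows that the image lies in the fixed-point algebra. Words exist for every
partition of the strands and every braid, so Moebius inversion over sets of ties yields all
coordinates that depend only on kernel and braid: the map is onto (\<open>evaluation_surjective\<close>).

If \<open>d < n\<close>, no colouring is injective. The combination of words that Moebius inversion attaches to
the injective colourings is then mapped to zero. It is not zero in the tied braid algebra, whose
relations hold for the action on colourings with any number of colours
(\<open>evaluation_not_injective\<close>).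

If \<open>d \<ge> n\<close>, every partition is the kernel of a colouring, and the coordinates determine the
coefficient of each pair of a partition and a braid by triangularity
(\<open>evaluation_kernel_pairing\<close>). It remains to see that a word is determined in the tied braid algebra
by its partition and its braid (\<open>mono_determined\<close>). For this, \<open>E\<^sub>i\<close> is conjugated by braids; the
relations imply that the result depends only on the two strands that are tied, so that ties can be
moved to the left of any word (\<open>act_normal_form\<close>), and that ties commute and are transitive. Hence a
product of ties depends only on the equivalence relation that they generate
(\<open>tie_list_determined\<close>).\<close>

section \<open>Monoid algebras as spaces of functionals\<close>

text \<open>An element of a monoid algebra is regarded as a finitely supported measure and tested against
arbitrary functions \<open>h\<close>. Products become iterated pairings, so that ring axioms and homomorphism
properties reduce to an exchange of finite sums.\<close>

definition pairing :: "('m \<Rightarrow> 'k::field) \<Rightarrow> ('m \<Rightarrow> 'k) \<Rightarrow> 'k" where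
  "pairing f h = (\<Sum>x | f x \<noteq> 0. f x * h x)"

abbreviation finite_support :: "('m \<Rightarrow> 'k::zero) \<Rightarrow> bool" where
  "finite_support f \<equiv> finite {x. f x \<noteq> 0}"

lemma pairing_superset:
  assumes "finite A" "{x. f x \<noteq> 0} \<subseteq> A"
  shows "pairing f h = (\<Sum>x\<in>A. f x * h x)"
  unfolding pairing_def using assms by (intro sum.mono_neutral_left) auto

lemma pairing_cong:
  "(\<And>x. f x \<noteq> 0 \<Longrightarrow> h x = h' x) \<Longrightarrow> pairing f h = pairing f h'"
  unfolding pairing_def by (auto intro: sum.cong)

lemma pairing_zero_left [simp]: "pairing (\<lambda>x. 0) h = 0"
  by (simp add: pairing_def)

lemma pairing_zero_right [simp]: "pairing f (\<lambda>x. 0) = 0"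
  by (simp add: pairing_def)

lemma pairing_basis [simp]: "pairing (basis_elt x) h = h x"
proof -
  have "pairing (basis_elt x) h = (\<Sum>y\<in>{x}. basis_elt x y * h y)"
    by (rule pairing_superset) (auto simp: basis_elt_def)
  then show ?thesis by (simp add: basis_elt_def)
qed

lemma pairing_add_left:
  assumes "finite_support f" "finite_support g"
  shows "pairing (\<lambda>z. f z + g z) h = pairing f h + pairing g h"
proof -
  let ?A = "{x. f x \<noteq> 0} \<union> {x. g x \<noteq> 0}"
  have "finite ?A" using assms by simp
  then show ?thesis
    by (subst (1 2 3) pairing_superset[of ?A]) (auto simp: sum.distrib algebra_simps)
qed

lemma pairing_smult_left: "pairing (\<lambda>z. c * f z) h = c * pairing f h"
proof (cases "c = 0")
  case False
  then show ?thesis by (simp add: pairing_def sum_distrib_left mult.assoc)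
qed simp

lemma finite_support_sum:
  fixes F :: "'a \<Rightarrow> 'm \<Rightarrow> 'k::field"
  assumes "finite A" "\<And>a. a \<in> A \<Longrightarrow> finite_support (F a)"
  shows "finite_support (\<lambda>z. \<Sum>a\<in>A. F a z)"
proof (rule finite_subset)
  show "{z. (\<Sum>a\<in>A. F a z) \<noteq> 0} \<subseteq> (\<Union>a\<in>A. {z. F a z \<noteq> 0})"
    using sum.neutral by force
qed (use assms in auto)

lemma pairing_sum_left:
  fixes F :: "'a \<Rightarrow> 'm \<Rightarrow> 'k::field"
  assumes "finite A" "\<And>a. a \<in> A \<Longrightarrow> finite_support (F a)"
  shows "pairing (\<lambda>z. \<Sum>a\<in>A. F a z) h = (\<Sum>a\<in>A. pairing (F a) h)"
  using assms
proof (induction A rule: finite_induct)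
  case (insert a A)
  then show ?case
    by (simp add: pairing_add_left finite_support_sum)
qed simp

lemma pairing_add_right: "pairing f (\<lambda>x. h x + h' x) = pairing f h + pairing f h'"
  by (simp add: pairing_def algebra_simps sum.distrib)

lemma pairing_smult_right: "pairing f (\<lambda>x. c * h x) = c * pairing f h"
  by (simp add: pairing_def algebra_simps sum_distrib_left)

lemma pairing_sum_right:
  "pairing f (\<lambda>x. \<Sum>a\<in>A. H a x) = (\<Sum>a\<in>A. pairing f (H a))"
  by (simp add: pairing_def sum_distrib_left sum.swap[of _ A])

lemma pairing_swap:
  "pairing f (\<lambda>x. pairing g (\<lambda>y. H x y)) = pairing g (\<lambda>y. pairing f (\<lambda>x. H x y))"
  unfolding pairing_def sum_distrib_left
  by (subst sum.swap) (simp add: mult.left_commute)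

lemma pairing_indicator:
  assumes "finite_support f" shows "pairing f (basis_elt z) = f z"
proof -
  have "pairing f (basis_elt z) = (\<Sum>x\<in>insert z {x. f x \<noteq> 0}. f x * basis_elt z x)"
    by (rule pairing_superset) (use assms in auto)
  also have "\<dots> = (\<Sum>x\<in>{z}. f x * basis_elt z x)"
    by (rule sum.mono_neutral_right) (use assms in \<open>auto simp: basis_elt_def\<close>)
  finally show ?thesis by (simp add: basis_elt_def)
qed

lemma pairing_ext:
  assumes "finite_support f" "finite_support g" "\<And>h. pairing f h = pairing g h"
  shows "f = g"
proof
  show "f z = g z" for z
    using assms(3)[of "basis_elt z"] assms(1,2) by (simp add: pairing_indicator)
qed

lemma sum_pairing_fibres:
  assumes "finite_support f" and "finite A" and "\<And>w. f w \<noteq> 0 \<Longrightarrow> p w \<in> A"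
  shows "pairing f h = (\<Sum>a\<in>A. pairing f (\<lambda>w. if p w = a then h w else 0))"
proof -
  have "pairing f h = pairing f (\<lambda>w. \<Sum>a\<in>A. if p w = a then h w else 0)"
    by (rule pairing_cong) (use assms in auto)
  then show ?thesis by (simp only: pairing_sum_right)
qed

lemma mem_monoid_algebra:
  "f \<in> carrier (monoid_algebra M) \<longleftrightarrow> finite_support f \<and> {x. f x \<noteq> 0} \<subseteq> carrier M"
  by (simp add: monoid_algebra_def)

lemma monoid_algebra_finite:
  "f \<in> carrier (monoid_algebra M) \<Longrightarrow> finite_support f"
  by (simp add: mem_monoid_algebra)

lemma monoid_algebra_supp:
  "f \<in> carrier (monoid_algebra M) \<Longrightarrow> f x \<noteq> 0 \<Longrightarrow> x \<in> carrier M"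
  by (auto simp: mem_monoid_algebra)

lemma pairing_cong_carrier:
  "f \<in> carrier (monoid_algebra M) \<Longrightarrow> (\<And>x. x \<in> carrier M \<Longrightarrow> h x = h' x) \<Longrightarrow>
    pairing f h = pairing f h'"
  by (rule pairing_cong) (auto simp: mem_monoid_algebra)

lemma monoid_algebra_simps [simp]:
  "\<zero>\<^bsub>monoid_algebra M\<^esub> = (\<lambda>z. 0)"
  "\<one>\<^bsub>monoid_algebra M\<^esub> = basis_elt \<one>\<^bsub>M\<^esub>"
  "f \<oplus>\<^bsub>monoid_algebra M\<^esub> g = (\<lambda>z. f z + g z)"
  "c \<odot>\<^bsub>monoid_algebra M\<^esub> f = (\<lambda>z. c * f z)"
  by (simp_all add: monoid_algebra_def basis_elt_def)

lemma basis_elt_closed [simp]: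
  "x \<in> carrier M \<Longrightarrow> basis_elt x \<in> carrier (monoid_algebra M)"
  by (auto simp: mem_monoid_algebra basis_elt_def)

lemma monoid_algebra_zero_closed: "(\<lambda>z. 0) \<in> carrier (monoid_algebra M)"
  by (simp add: mem_monoid_algebra)

lemma monoid_algebra_add_closed:
  assumes "f \<in> carrier (monoid_algebra M)" "g \<in> carrier (monoid_algebra M)"
  shows "(\<lambda>z. f z + g z) \<in> carrier (monoid_algebra M)"
proof -
  have "{x. f x + g x \<noteq> 0} \<subseteq> {x. f x \<noteq> 0} \<union> {x. g x \<noteq> 0}" by auto
  then show ?thesis
    using assms finite_subset[of "{x. f x + g x \<noteq> 0}"] unfolding mem_monoid_algebra by blast
qed

lemma monoid_algebra_smult_closed:
  assumes "f \<in> carrier (monoid_algebra M)"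
  shows "(\<lambda>z. c * f z) \<in> carrier (monoid_algebra M)"
proof -
  have "{x. c * f x \<noteq> 0} \<subseteq> {x. f x \<noteq> 0}" by auto
  then show ?thesis
    using assms finite_subset[of "{x. c * f x \<noteq> 0}"] unfolding mem_monoid_algebra by blast
qed

lemma monoid_algebra_sum_closed:
  assumes "finite A" "\<And>a. a \<in> A \<Longrightarrow> F a \<in> carrier (monoid_algebra M)"
  shows "(\<lambda>z. \<Sum>a\<in>A. F a z) \<in> carrier (monoid_algebra M)"
  using assms
proof (induction A rule: finite_induct)
  case empty
  then show ?case by (simp add: monoid_algebra_zero_closed)
next
  case (insert a A)
  then have "(\<lambda>z. F a z + (\<Sum>a\<in>A. F a z)) \<in> carrier (monoid_algebra M)"
    by (intro monoid_algebra_add_closed) auto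
  with insert show ?case by simp
qed

lemma monoid_algebra_subspace_induct [consumes 1, case_names zero add smult basis]:
  assumes "f \<in> carrier (monoid_algebra M)"
    and zero: "P (\<lambda>z. 0)"
    and add: "\<And>f g. f \<in> carrier (monoid_algebra M) \<Longrightarrow> g \<in> carrier (monoid_algebra M) \<Longrightarrow>
      P f \<Longrightarrow> P g \<Longrightarrow> P (\<lambda>z. f z + g z)"
    and smult: "\<And>c f. f \<in> carrier (monoid_algebra M) \<Longrightarrow> P f \<Longrightarrow> P (\<lambda>z. c * f z)"
    and basis: "\<And>x. x \<in> carrier M \<Longrightarrow> P (basis_elt x)"
  shows "P f"
proof -
  have "P (\<lambda>z. \<Sum>x\<in>A. f x * basis_elt x z)" if "finite A" "A \<subseteq> carrier M" for A
    using that
  proof (induction A rule: finite_induct)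
    case empty
    then show ?case by (simp add: zero)
  next
    case (insert x A)
    have "P (\<lambda>z. f x * basis_elt x z + (\<Sum>x\<in>A. f x * basis_elt x z))"
      using insert
      by (intro add smult basis monoid_algebra_smult_closed monoid_algebra_sum_closed) auto
    with insert show ?case by simp
  qed
  moreover have "(\<lambda>z. \<Sum>x | f x \<noteq> 0. f x * basis_elt x z) = f"
  proof
    fix z
    have "(\<Sum>x | f x \<noteq> 0. f x * basis_elt x z) = pairing f (basis_elt z)"
      unfolding pairing_def by (rule sum.cong) (auto simp: basis_elt_def)
    then show "(\<Sum>x | f x \<noteq> 0. f x * basis_elt x z) = f z"
      using assms(1) by (simp add: pairing_indicator monoid_algebra_finite)
  qed
  ultimately show ?thesis
    using assms(1) unfolding mem_monoid_algebra by metis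
qed

lemma monoid_algebra_mult_apply:
  assumes "finite_support f" "finite_support g"
  shows "(f \<otimes>\<^bsub>monoid_algebra M\<^esub> g) z =
    (\<Sum>(x, y)\<in>{x. f x \<noteq> 0} \<times> {y. g y \<noteq> 0}. if x \<otimes>\<^bsub>M\<^esub> y = z then f x * g y else 0)"
proof -
  have "(f \<otimes>\<^bsub>monoid_algebra M\<^esub> g) z =
      (\<Sum>(x, y)\<in>{(x, y). f x \<noteq> 0 \<and> g y \<noteq> 0 \<and> x \<otimes>\<^bsub>M\<^esub> y = z}.
        if x \<otimes>\<^bsub>M\<^esub> y = z then f x * g y else 0)"
    unfolding monoid_algebra_def by (auto intro!: sum.cong)
  also have "\<dots> = (\<Sum>(x, y)\<in>{x. f x \<noteq> 0} \<times> {y. g y \<noteq> 0}. if x \<otimes>\<^bsub>M\<^esub> y = z then f x * g y else 0)"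
    by (rule sum.mono_neutral_left) (use assms in \<open>auto split: if_splits\<close>)
  finally show ?thesis .
qed

lemma monoid_algebra_mult_supp:
  assumes "finite_support f" "finite_support g"
  shows "{z. (f \<otimes>\<^bsub>monoid_algebra M\<^esub> g) z \<noteq> 0} \<subseteq>
    (\<lambda>(x, y). x \<otimes>\<^bsub>M\<^esub> y) ` ({x. f x \<noteq> 0} \<times> {y. g y \<noteq> 0})"
proof
  fix z assume "z \<in> {z. (f \<otimes>\<^bsub>monoid_algebra M\<^esub> g) z \<noteq> 0}"
  then have "(\<Sum>(x, y)\<in>{x. f x \<noteq> 0} \<times> {y. g y \<noteq> 0}.
      if x \<otimes>\<^bsub>M\<^esub> y = z then f x * g y else 0) \<noteq> 0"
    by (simp add: monoid_algebra_mult_apply[OF assms])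
  then obtain p where "p \<in> {x. f x \<noteq> 0} \<times> {y. g y \<noteq> 0}"
      "(case p of (x, y) \<Rightarrow> if x \<otimes>\<^bsub>M\<^esub> y = z then f x * g y else 0) \<noteq> 0"
    by (rule sum.not_neutral_contains_not_neutral)
  then show "z \<in> (\<lambda>(x, y). x \<otimes>\<^bsub>M\<^esub> y) ` ({x. f x \<noteq> 0} \<times> {y. g y \<noteq> 0})"
    by (force split: if_splits)
qed

lemma monoid_algebra_mult_finite:
  assumes "finite_support f" "finite_support g"
  shows "finite_support (f \<otimes>\<^bsub>monoid_algebra M\<^esub> g)"
  using monoid_algebra_mult_supp[OF assms] by (rule finite_subset) (use assms in auto)

text \<open>Convolution is the push-forward of the product measure under the multiplication of the monoid.\<close>

lemma pairing_mult:
  assumes "finite_support f" "finite_support g"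
  shows "pairing (f \<otimes>\<^bsub>monoid_algebra M\<^esub> g) h = pairing f (\<lambda>x. pairing g (\<lambda>y. h (x \<otimes>\<^bsub>M\<^esub> y)))"
proof -
  let ?S = "{x. f x \<noteq> 0} \<times> {y. g y \<noteq> 0}"
  let ?Z = "(\<lambda>(x, y). x \<otimes>\<^bsub>M\<^esub> y) ` ?S"
  have "pairing (f \<otimes>\<^bsub>monoid_algebra M\<^esub> g) h =
      (\<Sum>z\<in>?Z. (\<Sum>(x, y)\<in>?S. if x \<otimes>\<^bsub>M\<^esub> y = z then f x * g y else 0) * h z)"
    using assms by (subst pairing_superset[OF _ monoid_algebra_mult_supp[OF assms]])
      (simp_all add: monoid_algebra_mult_apply)
  also have "\<dots> = (\<Sum>(x, y)\<in>?S. \<Sum>z\<in>?Z. (if x \<otimes>\<^bsub>M\<^esub> y = z then f x * g y else 0) * h z)"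
    unfolding sum_distrib_right by (subst sum.swap) (simp add: case_prod_unfold)
  also have "\<dots> = (\<Sum>(x, y)\<in>?S. f x * g y * h (x \<otimes>\<^bsub>M\<^esub> y))"
  proof (rule sum.cong[OF HOL.refl])
    fix p assume "p \<in> ?S"
    then obtain x y where xy: "p = (x, y)" "f x \<noteq> 0" "g y \<noteq> 0" by auto
    have "(\<Sum>z\<in>?Z. (if x \<otimes>\<^bsub>M\<^esub> y = z then f x * g y else 0) * h z) =
        (\<Sum>z\<in>{x \<otimes>\<^bsub>M\<^esub> y}. (if x \<otimes>\<^bsub>M\<^esub> y = z then f x * g y else 0) * h z)"
      by (rule sum.mono_neutral_right) (use assms xy in auto)
    then show "(case p of (x, y) \<Rightarrow> \<Sum>z\<in>?Z. (if x \<otimes>\<^bsub>M\<^esub> y = z then f x * g y else 0) * h z) =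
        (case p of (x, y) \<Rightarrow> f x * g y * h (x \<otimes>\<^bsub>M\<^esub> y))"
      by (simp add: xy(1))
  qed
  also have "\<dots> = pairing f (\<lambda>x. pairing g (\<lambda>y. h (x \<otimes>\<^bsub>M\<^esub> y)))"
    unfolding pairing_def by (simp add: sum.cartesian_product[symmetric] sum_distrib_left mult.assoc)
  finally show ?thesis .
qed

lemma monoid_algebra_mult_closed:
  assumes "monoid M" "f \<in> carrier (monoid_algebra M)" "g \<in> carrier (monoid_algebra M)"
  shows "f \<otimes>\<^bsub>monoid_algebra M\<^esub> g \<in> carrier (monoid_algebra M)"
proof -
  have fin: "finite_support f" "finite_support g"
    using assms by (auto dest: monoid_algebra_finite)
  have "(\<lambda>(x, y). x \<otimes>\<^bsub>M\<^esub> y) ` ({x. f x \<noteq> 0} \<times> {y. g y \<noteq> 0}) \<subseteq> carrier M"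
    using assms by (auto intro!: monoid.m_closed dest: monoid_algebra_supp)
  then show ?thesis
    unfolding mem_monoid_algebra
    using monoid_algebra_mult_finite[OF fin, of M] monoid_algebra_mult_supp[OF fin, of M] by simp
qed

lemma monoid_algebra_ext:
  assumes "f \<in> carrier (monoid_algebra M)" "g \<in> carrier (monoid_algebra M)"
    and "\<And>h. pairing f h = pairing g h"
  shows "f = g"
  using assms by (intro pairing_ext) (auto dest: monoid_algebra_finite)

lemma monoid_algebra_ring:
  fixes M :: "('m, 'x) monoid_scheme"
  assumes M: "monoid M"
  shows "ring (monoid_algebra M :: ('k::field, 'm \<Rightarrow> 'k) module)"
proof -
  interpret monoid M by fact
  let ?A = "monoid_algebra M :: ('k::field, 'm \<Rightarrow> 'k) module"
  note fin = monoid_algebra_finite[where M = M]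
  note closed = monoid_algebra_mult_closed[OF M] monoid_algebra_add_closed
  show ?thesis
  proof (rule ringI)
    show "abelian_group ?A"
    proof (rule abelian_groupI)
      fix x assume "x \<in> carrier ?A"
      then have "(\<lambda>z. (- 1) * x z) \<in> carrier ?A" by (rule monoid_algebra_smult_closed)
      then show "\<exists>y\<in>carrier ?A. y \<oplus>\<^bsub>?A\<^esub> x = \<zero>\<^bsub>?A\<^esub>" by (intro bexI) auto
    qed (auto simp: closed algebra_simps monoid_algebra_zero_closed)
    show "monoid ?A"
    proof (rule monoidI)
      fix x y z assume a: "x \<in> carrier ?A" "y \<in> carrier ?A" "z \<in> carrier ?A"
      show "x \<otimes>\<^bsub>?A\<^esub> y \<otimes>\<^bsub>?A\<^esub> z = x \<otimes>\<^bsub>?A\<^esub> (y \<otimes>\<^bsub>?A\<^esub> z)"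
      proof (rule monoid_algebra_ext)
        fix h
        show "pairing (x \<otimes>\<^bsub>?A\<^esub> y \<otimes>\<^bsub>?A\<^esub> z) h = pairing (x \<otimes>\<^bsub>?A\<^esub> (y \<otimes>\<^bsub>?A\<^esub> z)) h"
          using a unfolding pairing_mult[OF fin fin, OF a(1,2)]
            pairing_mult[OF fin fin, OF a(1) closed(1)[OF a(2,3)]]
            pairing_mult[OF fin fin, OF closed(1)[OF a(1,2)] a(3)]
            pairing_mult[OF fin fin, OF a(2,3)]
          by (intro pairing_cong) (simp add: m_assoc monoid_algebra_supp)
      qed (use a in \<open>auto intro: closed\<close>)
    next
      fix x assume a: "x \<in> carrier ?A"
      have one: "\<one>\<^bsub>?A\<^esub> \<in> carrier ?A" by simp
      show "\<one>\<^bsub>?A\<^esub> \<otimes>\<^bsub>?A\<^esub> x = x"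
        by (rule monoid_algebra_ext[of _ M])
          (use a in \<open>auto intro!: closed(1) pairing_cong simp: pairing_mult[OF fin fin, OF one a, simplified]
            dest: monoid_algebra_supp\<close>)
      show "x \<otimes>\<^bsub>?A\<^esub> \<one>\<^bsub>?A\<^esub> = x"
        by (rule monoid_algebra_ext[of _ M])
          (use a in \<open>auto intro!: closed(1) pairing_cong simp: pairing_mult[OF fin fin, OF a one, simplified]
            dest: monoid_algebra_supp\<close>)
    qed (auto intro: closed(1))
    fix x y z assume a: "x \<in> carrier ?A" "y \<in> carrier ?A" "z \<in> carrier ?A"
    show "(x \<oplus>\<^bsub>?A\<^esub> y) \<otimes>\<^bsub>?A\<^esub> z = x \<otimes>\<^bsub>?A\<^esub> z \<oplus>\<^bsub>?A\<^esub> y \<otimes>\<^bsub>?A\<^esub> z"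
      by (rule monoid_algebra_ext[of _ M])
        (use a in \<open>simp_all add: closed pairing_mult pairing_add_left fin\<close>)
    show "z \<otimes>\<^bsub>?A\<^esub> (x \<oplus>\<^bsub>?A\<^esub> y) = z \<otimes>\<^bsub>?A\<^esub> x \<oplus>\<^bsub>?A\<^esub> z \<otimes>\<^bsub>?A\<^esub> y"
      by (rule monoid_algebra_ext[of _ M])
        (use a in \<open>simp_all add: closed pairing_mult pairing_add_left pairing_add_right fin\<close>)
  qed
qed

lemma basis_elt_mult:
  assumes "monoid M" "x \<in> carrier M" "y \<in> carrier M"
  shows "basis_elt x \<otimes>\<^bsub>monoid_algebra M\<^esub> basis_elt y = basis_elt (x \<otimes>\<^bsub>M\<^esub> y)"
proof (rule monoid_algebra_ext[of _ M])
  have e: "basis_elt x \<in> carrier (monoid_algebra M)" "basis_elt y \<in> carrier (monoid_algebra M)"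
    using assms by simp_all
  show "basis_elt x \<otimes>\<^bsub>monoid_algebra M\<^esub> basis_elt y \<in> carrier (monoid_algebra M)"
    using assms(1) e by (rule monoid_algebra_mult_closed)
  show "basis_elt (x \<otimes>\<^bsub>M\<^esub> y) \<in> carrier (monoid_algebra M)"
    using assms by (intro basis_elt_closed monoid.m_closed)
  show "pairing (basis_elt x \<otimes>\<^bsub>monoid_algebra M\<^esub> basis_elt y) h = pairing (basis_elt (x \<otimes>\<^bsub>M\<^esub> y)) h" for h
    using pairing_mult[OF monoid_algebra_finite[OF e(1)] monoid_algebra_finite[OF e(2)]] by simp
qed

lemma monoid_algebra_minus:
  fixes f g :: "'m \<Rightarrow> 'k::field"
  assumes "monoid M" "f \<in> carrier (monoid_algebra M)" "g \<in> carrier (monoid_algebra M)"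
  shows "f \<ominus>\<^bsub>monoid_algebra M\<^esub> g = (\<lambda>z. f z - g z)"
proof -
  interpret ring "monoid_algebra M :: ('k, 'm \<Rightarrow> 'k) module"
    by (rule monoid_algebra_ring) fact
  have c: "(\<lambda>z. (- 1) * g z) \<in> carrier (monoid_algebra M)"
    by (rule monoid_algebra_smult_closed) fact
  have "\<ominus>\<^bsub>monoid_algebra M\<^esub> g = (\<lambda>z. (- 1) * g z)"
    by (rule minus_equality[OF _ assms(3) c]) simp
  then show ?thesis by (simp add: a_minus_def)
qed

lemma monoid_algebra_finsum:
  fixes F :: "'a \<Rightarrow> 'm \<Rightarrow> 'k::field"
  assumes "monoid M" "finite A" "\<And>a. a \<in> A \<Longrightarrow> F a \<in> carrier (monoid_algebra M)"
  shows "(\<Oplus>\<^bsub>monoid_algebra M\<^esub>a\<in>A. F a) = (\<lambda>z. \<Sum>a\<in>A. F a z)"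
proof -
  interpret ring "monoid_algebra M :: ('k, 'm \<Rightarrow> 'k) module"
    by (rule monoid_algebra_ring) fact
  show ?thesis using assms(2,3)
  proof (induction A rule: finite_induct)
    case (insert a A)
    then show ?case by (subst finsum_insert) auto
  qed simp
qed

definition lin_ext :: "('w \<Rightarrow> 'm \<Rightarrow> 'k::field) \<Rightarrow> ('w \<Rightarrow> 'k) \<Rightarrow> 'm \<Rightarrow> 'k" where
  "lin_ext ev f = (\<lambda>z. pairing f (\<lambda>w. ev w z))"

lemma lin_ext_closed:
  assumes "finite_support f" and "\<And>w. f w \<noteq> 0 \<Longrightarrow> ev w \<in> carrier (monoid_algebra M)"
  shows "lin_ext ev f \<in> carrier (monoid_algebra M)"
  unfolding lin_ext_def pairing_def using assms
  by (intro monoid_algebra_sum_closed monoid_algebra_smult_closed) auto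

lemma pairing_lin_ext:
  assumes "finite_support f" and "\<And>w. f w \<noteq> 0 \<Longrightarrow> finite_support (ev w)"
  shows "pairing (lin_ext ev f) h = pairing f (\<lambda>w. pairing (ev w) h)"
proof -
  have fs: "finite_support (\<lambda>z. f w * ev w z)" if "f w \<noteq> 0" for w
    using assms(2)[OF that] by (rule rev_finite_subset) auto
  have "pairing (lin_ext ev f) h = (\<Sum>w | f w \<noteq> 0. pairing (\<lambda>z. f w * ev w z) h)"
    unfolding lin_ext_def pairing_def[of f]
    by (rule pairing_sum_left) (use assms fs in auto)
  then show ?thesis
    by (simp add: pairing_smult_left pairing_def[of f])
qed

lemma lin_ext_basis [simp]: "lin_ext ev (basis_elt w) = ev w"
  by (simp add: lin_ext_def)

lemma lin_ext_linear:
  assumes "\<And>w. w \<in> carrier M \<Longrightarrow> ev w \<in> carrier (monoid_algebra N)"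
  shows "lin_ext ev \<in> linear_maps (monoid_algebra M) (monoid_algebra N)"
  unfolding linear_maps_def
  by (auto intro!: lin_ext_closed assms dest: monoid_algebra_supp monoid_algebra_finite)
    (simp_all add: lin_ext_def pairing_add_left pairing_smult_left monoid_algebra_finite)

text \<open>Multiplicativity on monomials suffices: tested against \<open>h\<close>, both sides are the same fourfold iterated
pairing, with the two inner variables exchanged.\<close>

lemma lin_ext_alg_hom:
  fixes ev :: "'w \<Rightarrow> 'm \<Rightarrow> 'k::field"
  assumes M: "monoid M" and N: "monoid N"
    and ev: "\<And>w. w \<in> carrier M \<Longrightarrow> ev w \<in> carrier (monoid_algebra N)"
    and one: "ev \<one>\<^bsub>M\<^esub> = basis_elt \<one>\<^bsub>N\<^esub>"
    and mult: "\<And>v w. v \<in> carrier M \<Longrightarrow> w \<in> carrier M \<Longrightarrow>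
      ev (v \<otimes>\<^bsub>M\<^esub> w) = ev v \<otimes>\<^bsub>monoid_algebra N\<^esub> ev w"
  shows "lin_ext ev \<in> alg_hom (monoid_algebra M) (monoid_algebra N)"
proof -
  have lin: "lin_ext ev \<in> linear_maps (monoid_algebra M) (monoid_algebra N)"
    by (rule lin_ext_linear) (rule ev)
  have fin: "finite_support (ev w)" if "f \<in> carrier (monoid_algebra M)" "f w \<noteq> 0" for f and w
    using ev[OF monoid_algebra_supp[OF that]] by (rule monoid_algebra_finite)
  have cl: "lin_ext ev f \<in> carrier (monoid_algebra N)" if "f \<in> carrier (monoid_algebra M)" for f
    using lin that by (auto simp: linear_maps_def)
  note ring_closed = monoid_algebra_mult_closed[OF M] monoid_algebra_mult_closed[OF N]
  have "lin_ext ev (f \<otimes>\<^bsub>monoid_algebra M\<^esub> g) = lin_ext ev f \<otimes>\<^bsub>monoid_algebra N\<^esub> lin_ext ev g"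
    if fg: "f \<in> carrier (monoid_algebra M)" "g \<in> carrier (monoid_algebra M)" for f g
  proof (rule monoid_algebra_ext)
    fix h
    have fsup: "finite_support f" "finite_support g"
      using fg by (auto dest: monoid_algebra_finite)
    have fgc: "f \<otimes>\<^bsub>monoid_algebra M\<^esub> g \<in> carrier (monoid_algebra M)"
      using fg by (rule ring_closed)
    have "pairing (lin_ext ev (f \<otimes>\<^bsub>monoid_algebra M\<^esub> g)) h =
        pairing (f \<otimes>\<^bsub>monoid_algebra M\<^esub> g) (\<lambda>w. pairing (ev w) h)"
      by (rule pairing_lin_ext[OF monoid_algebra_finite[OF fgc] fin[OF fgc]])
    also have "\<dots> = pairing f (\<lambda>v. pairing g (\<lambda>w. pairing (ev (v \<otimes>\<^bsub>M\<^esub> w)) h))"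
      using fsup by (rule pairing_mult)
    also have "\<dots> = pairing f (\<lambda>v. pairing g (\<lambda>w. pairing (ev v) (\<lambda>x. pairing (ev w) (\<lambda>y. h (x \<otimes>\<^bsub>N\<^esub> y)))))"
      using fg by (intro pairing_cong) (simp add: mult monoid_algebra_supp pairing_mult fin)
    also have "\<dots> = pairing f (\<lambda>v. pairing (ev v) (\<lambda>x. pairing g (\<lambda>w. pairing (ev w) (\<lambda>y. h (x \<otimes>\<^bsub>N\<^esub> y)))))"
      by (subst pairing_swap[of g]) simp
    also have "\<dots> = pairing (lin_ext ev f) (\<lambda>x. pairing (lin_ext ev g) (\<lambda>y. h (x \<otimes>\<^bsub>N\<^esub> y)))"
      using fg fsup by (simp add: pairing_lin_ext fin)
    also have "\<dots> = pairing (lin_ext ev f \<otimes>\<^bsub>monoid_algebra N\<^esub> lin_ext ev g) h"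
      using cl[OF fg(1)] cl[OF fg(2)] by (simp add: pairing_mult monoid_algebra_finite)
    finally show "pairing (lin_ext ev (f \<otimes>\<^bsub>monoid_algebra M\<^esub> g)) h =
        pairing (lin_ext ev f \<otimes>\<^bsub>monoid_algebra N\<^esub> lin_ext ev g) h" .
  qed (use fg in \<open>auto intro: cl ring_closed\<close>)
  then have "lin_ext ev \<in> ring_hom (monoid_algebra M) (monoid_algebra N)"
    using lin by (auto simp: ring_hom_def linear_maps_def one)
  then show ?thesis using lin by (simp add: alg_hom_def)
qed

lemma linear_maps_agree:
  assumes M: "monoid M" and F: "F \<in> linear_maps (monoid_algebra M) B" "G \<in> linear_maps (monoid_algebra M) B"
    and basis: "\<And>x. x \<in> carrier M \<Longrightarrow> F (basis_elt x) = G (basis_elt x)"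
    and f: "f \<in> carrier (monoid_algebra M)"
  shows "F f = G f"
  using f
proof (induction rule: monoid_algebra_subspace_induct)
  case zero
  let ?e = "basis_elt \<one>\<^bsub>M\<^esub>"
  have e: "\<one>\<^bsub>M\<^esub> \<in> carrier M" using M by (rule monoid.one_closed)
  have zero: "H (\<lambda>z. 0) = 0 \<odot>\<^bsub>B\<^esub> H ?e" if "H \<in> linear_maps (monoid_algebra M) B" for H
  proof -
    have "H (0 \<odot>\<^bsub>monoid_algebra M\<^esub> ?e) = 0 \<odot>\<^bsub>B\<^esub> H ?e"
      using that basis_elt_closed[OF e] unfolding linear_maps_def by blast
    then show ?thesis by simp
  qed
  show ?case unfolding zero[OF F(1)] zero[OF F(2)] basis[OF e] ..
next
  case (add f g)
  then show ?case using F by (simp add: linear_maps_def)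
next
  case (smult c f)
  then show ?case using F by (simp add: linear_maps_def)
qed (use basis in auto)

lemma pairing_uminus_left: "pairing (\<lambda>z. - f z) h = - pairing f h"
  using pairing_smult_left[of "- 1" f h] by simp

lemma pairing_diff_left:
  assumes "finite_support f" "finite_support g"
  shows "pairing (\<lambda>z. f z - g z) h = pairing f h - pairing g h"
  using pairing_add_left[of f "\<lambda>z. - g z" h] assms by (simp add: pairing_uminus_left)

lemma monoid_algebra_uminus_closed:
  "f \<in> carrier (monoid_algebra M) \<Longrightarrow> (\<lambda>z. - f z) \<in> carrier (monoid_algebra M)"
  using monoid_algebra_smult_closed[of f M "- 1"] by simp

section \<open>Presented groups and presented algebras\<close>

locale group_presentation =
  fixes Gs :: "'g set" and R :: "('g gword \<times> 'g gword) set"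
  assumes relators: "R \<subseteq> lists (Gs \<times> UNIV) \<times> lists (Gs \<times> UNIV)"
begin

abbreviation "words \<equiv> lists (Gs \<times> (UNIV :: bool set))"
abbreviation "PG \<equiv> presented_group Gs R"

definition cl :: "'g gword \<Rightarrow> 'g gword set" where
  "cl w = word_cong Gs R `` {w}"

definition rep :: "'g gword set \<Rightarrow> 'g gword" where
  "rep C = (SOME w. w \<in> C)"

lemma word_cong_words: "(u, v) \<in> word_cong Gs R \<Longrightarrow> u \<in> words \<and> v \<in> words"
  by (induction rule: word_cong.induct) (use relators in auto)

lemma equiv_word_cong: "equiv words (word_cong Gs R)"
proof (rule equivI)
  show "word_cong Gs R \<subseteq> words \<times> words"
  proof
    show "p \<in> words \<times> words" if "p \<in> word_cong Gs R" for p
      using that word_cong_words[of "fst p" "snd p"] by (simp add: mem_Times_iff)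
  qed
  show "refl_on words (word_cong Gs R)"
    by (rule refl_onI) (auto intro: word_cong.refl dest: word_cong_words)
  show "sym (word_cong Gs R)" by (rule symI) (rule word_cong.sym)
  show "trans (word_cong Gs R)" by (rule transI) (rule word_cong.trans)
qed

lemma cl_eq_iff: "u \<in> words \<Longrightarrow> v \<in> words \<Longrightarrow> cl u = cl v \<longleftrightarrow> (u, v) \<in> word_cong Gs R"
  unfolding cl_def by (rule eq_equiv_class_iff[OF equiv_word_cong])

lemma cl_eqI: "(u, v) \<in> word_cong Gs R \<Longrightarrow> cl u = cl v"
  unfolding cl_def by (rule equiv_class_eq[OF equiv_word_cong])

lemma carrier_PG: "carrier PG = cl ` words"
  by (auto simp: presented_group_def quotient_def cl_def)

lemma cl_closed [simp]: "w \<in> words \<Longrightarrow> cl w \<in> carrier PG"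
  by (simp add: carrier_PG)

lemma mult_cl:
  assumes "u \<in> words" "v \<in> words"
  shows "cl u \<otimes>\<^bsub>PG\<^esub> cl v = cl (u @ v)"
proof -
  have "cl (a @ b) = cl (u @ v)" if "a \<in> cl u" "b \<in> cl v" for a b
    using that by (intro cl_eqI word_cong.sym[OF word_cong.append]) (auto simp: cl_def)
  moreover have "u \<in> cl u" "v \<in> cl v" using assms by (auto simp: cl_def intro: word_cong.refl)
  ultimately have "(\<Union>a\<in>cl u. \<Union>b\<in>cl v. cl (a @ b)) = cl (u @ v)" by blast
  then show ?thesis by (simp add: presented_group_def cl_def)
qed

lemma one_PG: "\<one>\<^bsub>PG\<^esub> = cl []"
  by (simp add: presented_group_def cl_def)

lemma cl_cancel:
  assumes "x \<in> Gs" shows "cl [(x, b)] \<otimes>\<^bsub>PG\<^esub> cl [(x, \<not> b)] = \<one>\<^bsub>PG\<^esub>"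
  using assms by (simp add: mult_cl one_PG cl_eqI word_cong.cancel)

sublocale PG: group PG
proof (rule groupI)
  fix x assume "x \<in> carrier PG"
  then obtain w where "w \<in> words" "x = cl w" by (auto simp: carrier_PG)
  moreover have "\<exists>v\<in>words. (v @ w, []) \<in> word_cong Gs R" if "w \<in> words" for w
    using that
  proof (induction w)
    case Nil
    then show ?case by (intro bexI[of _ "[]"]) (auto intro: word_cong.refl)
  next
    case (Cons a w)
    obtain x b where a: "a = (x, b)" by force
    with Cons obtain v where v: "v \<in> words" "(v @ w, []) \<in> word_cong Gs R" by auto
    have wf: "x \<in> Gs" "w \<in> words" using Cons a by auto
    have "([(x, \<not> b), (x, b)] @ w, [] @ w) \<in> word_cong Gs R"
      using word_cong.cancel[OF wf(1), of "\<not> b"] wf by (intro word_cong.append word_cong.refl) auto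
    with word_cong.refl[OF v(1)] have "(v @ ([(x, \<not> b), (x, b)] @ w), v @ ([] @ w)) \<in> word_cong Gs R"
      by (rule word_cong.append)
    with v(2) have "((v @ [(x, \<not> b)]) @ a # w, []) \<in> word_cong Gs R"
      by (auto simp: a intro: word_cong.trans)
    with v(1) wf(1) show ?case by (intro bexI[of _ "v @ [(x, \<not> b)]"]) auto
  qed
  ultimately obtain v where "v \<in> words" "(v @ w, []) \<in> word_cong Gs R" by blast
  with \<open>w \<in> words\<close> \<open>x = cl w\<close> show "\<exists>y\<in>carrier PG. y \<otimes>\<^bsub>PG\<^esub> x = \<one>\<^bsub>PG\<^esub>"
    by (intro bexI[of _ "cl v"]) (auto simp: mult_cl one_PG cl_eqI)
qed (unfold carrier_PG one_PG, ((elim imageE)?, simp add: mult_cl del: in_lists_conv_set)+)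

lemma inv_letter:
  assumes "x \<in> Gs" shows "inv\<^bsub>PG\<^esub> (cl [(x, b)]) = cl [(x, \<not> b)]"
proof (rule PG.inv_equality)
  show "cl [(x, \<not> b)] \<otimes>\<^bsub>PG\<^esub> cl [(x, b)] = \<one>\<^bsub>PG\<^esub>"
    using cl_cancel[OF assms, of "\<not> b"] by simp
qed (use assms in auto)

lemma rep_cong:
  assumes "C \<in> carrier PG" shows "rep C \<in> words" and "cl (rep C) = C"
proof -
  obtain w where w: "w \<in> words" "C = cl w" using assms by (auto simp: carrier_PG)
  then have "w \<in> C" by (auto simp: cl_def intro: word_cong.refl)
  then have "rep C \<in> C" unfolding rep_def by (rule someI)
  then have "(w, rep C) \<in> word_cong Gs R" using w by (simp add: cl_def)
  then show "rep C \<in> words" "cl (rep C) = C"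
    using w word_cong_words cl_eqI word_cong.sym by blast+
qed

lemma rep_cl: "w \<in> words \<Longrightarrow> (rep (cl w), w) \<in> word_cong Gs R"
  using rep_cong[of "cl w"] by (simp add: cl_eq_iff)

end

lemma free_monoid_simps [simp]:
  "carrier (free_monoid Gs) = lists Gs"
  "u \<otimes>\<^bsub>free_monoid Gs\<^esub> v = u @ v"
  "\<one>\<^bsub>free_monoid Gs\<^esub> = []"
  by (simp_all add: free_monoid_def)

lemma monoid_free_monoid: "monoid (free_monoid Gs)"
  by (rule monoidI) auto

lemma ring_free_algebra: "ring (free_algebra Gs :: ('k::field, 'g list \<Rightarrow> 'k) module)"
  by (rule monoid_algebra_ring[OF monoid_free_monoid])

locale algebra_presentation =
  fixes Gs :: "'g set" and R :: "('g list \<times> 'g list) set" and k_type :: "'k::field itself"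
  assumes relators: "R \<subseteq> lists Gs \<times> lists Gs"
begin

abbreviation FA :: "('k, 'g list \<Rightarrow> 'k) module" where "FA \<equiv> free_algebra Gs"
abbreviation RI :: "('g list \<Rightarrow> 'k) set" where "RI \<equiv> relation_ideal Gs R"
abbreviation PA :: "('k, ('g list \<Rightarrow> 'k) set) module" where "PA \<equiv> presented_algebra Gs R"
abbreviation proj :: "('g list \<Rightarrow> 'k) \<Rightarrow> ('g list \<Rightarrow> 'k) set" where "proj f \<equiv> RI +>\<^bsub>FA\<^esub> f"
abbreviation mono :: "'g list \<Rightarrow> ('g list \<Rightarrow> 'k) set" where "mono w \<equiv> proj (basis_elt w)"

sublocale FA: ring FA by (rule ring_free_algebra)

lemma generators_subset: "{basis_elt u \<ominus>\<^bsub>FA\<^esub> basis_elt v | u v. (u, v) \<in> R} \<subseteq> carrier FA"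
  using relators by (auto intro!: FA.minus_closed basis_elt_closed)

sublocale RI: ideal RI FA
  unfolding relation_ideal_def by (rule FA.genideal_ideal[OF generators_subset])

text \<open>Scalars act as multiples of the empty word, which is why an ideal is a linear subspace.\<close>

lemma RI_mult: 
  assumes "f \<in> carrier FA" shows "(\<lambda>z. c * f z) = (\<lambda>z. c * basis_elt [] z) \<otimes>\<^bsub>FA\<^esub> f"
proof (rule monoid_algebra_ext)
  let ?c = "\<lambda>z. c * basis_elt [] z"
  have c: "?c \<in> carrier FA" by (rule monoid_algebra_smult_closed) simp
  then show "?c \<otimes>\<^bsub>FA\<^esub> f \<in> carrier FA" using assms by (rule FA.m_closed)
  show "pairing (\<lambda>z. c * f z) h = pairing (?c \<otimes>\<^bsub>FA\<^esub> f) h" for h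
    by (simp add: pairing_mult[OF monoid_algebra_finite[OF c] monoid_algebra_finite[OF assms]]
        pairing_smult_left)
qed (use assms in \<open>rule monoid_algebra_smult_closed\<close>)

lemma RI_smult: "f \<in> RI \<Longrightarrow> (\<lambda>z. c * f z) \<in> RI"
  unfolding RI_mult[OF RI.Icarr] by (rule RI.I_l_closed) (simp_all add: monoid_algebra_smult_closed)

lemma proj_eq_iff:
  assumes "f \<in> carrier FA" "g \<in> carrier FA"
  shows "proj f = proj g \<longleftrightarrow> (\<lambda>z. f z - g z) \<in> RI"
  using FA.quotient_eq_iff_same_a_r_cos[OF RI.is_ideal assms] assms
  by (simp add: monoid_algebra_minus[OF monoid_free_monoid])

lemma carrier_PA: "carrier PA = proj ` carrier FA"
  by (auto simp: presented_algebra_def quotient_algebra_def ring.defs FactRing_def A_RCOSETS_def')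

lemma PA_ring_simps:
  assumes "f \<in> carrier FA" "g \<in> carrier FA"
  shows "proj f \<otimes>\<^bsub>PA\<^esub> proj g = proj (f \<otimes>\<^bsub>FA\<^esub> g)"
    and "proj f \<oplus>\<^bsub>PA\<^esub> proj g = proj (f \<oplus>\<^bsub>FA\<^esub> g)"
  using assms
  by (simp_all add: presented_algebra_def quotient_algebra_def ring.defs FactRing_def
      RI.rcoset_mult_add RI.a_rcos_sum)

lemma one_PA: "\<one>\<^bsub>PA\<^esub> = mono []"
  by (simp add: presented_algebra_def quotient_algebra_def ring.defs FactRing_def)

lemma PA_smult:
  assumes "f \<in> carrier FA"
  shows "c \<odot>\<^bsub>PA\<^esub> proj f = proj (c \<odot>\<^bsub>FA\<^esub> f)"
proof -
  have "proj (c \<odot>\<^bsub>FA\<^esub> x) = proj (c \<odot>\<^bsub>FA\<^esub> f)" if "x \<in> proj f" for x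
  proof -
    obtain j where j: "j \<in> RI" "x = j \<oplus>\<^bsub>FA\<^esub> f"
      using \<open>x \<in> proj f\<close> by (auto simp: a_r_coset_def r_coset_def)
    have jc: "j \<in> carrier FA" using j RI.Icarr by blast
    have x: "x \<in> carrier FA" using j jc assms by (simp add: monoid_algebra_add_closed)
    have "(\<lambda>z. c * x z - c * f z) = (\<lambda>z. c * j z)" using j by (simp add: algebra_simps)
    then show ?thesis
      using RI_smult[OF j(1), of c] x assms by (simp add: proj_eq_iff monoid_algebra_smult_closed)
  qed
  moreover have "f \<in> proj f" using assms by (rule RI.a_rcos_self)
  ultimately have "(\<Union>x\<in>proj f. proj (c \<odot>\<^bsub>FA\<^esub> x)) = proj (c \<odot>\<^bsub>FA\<^esub> f)" by blast
  then show ?thesis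
    by (simp add: presented_algebra_def quotient_algebra_def ring.defs module.defs)
qed

lemma mono_mult:
  assumes "u \<in> lists Gs" "v \<in> lists Gs"
  shows "mono u \<otimes>\<^bsub>PA\<^esub> mono v = mono (u @ v)"
proof -
  have b: "basis_elt u \<in> carrier FA" "basis_elt v \<in> carrier FA" using assms by simp_all
  have "basis_elt u \<otimes>\<^bsub>FA\<^esub> basis_elt v = (basis_elt (u @ v) :: _ \<Rightarrow> 'k)"
    using basis_elt_mult[OF monoid_free_monoid, of u Gs v] assms by simp
  then show ?thesis by (simp only: PA_ring_simps(1)[OF b])
qed

lemma PA_assoc:
  assumes "X \<in> carrier PA" "Y \<in> carrier PA" "Z \<in> carrier PA"
  shows "X \<otimes>\<^bsub>PA\<^esub> Y \<otimes>\<^bsub>PA\<^esub> Z = X \<otimes>\<^bsub>PA\<^esub> (Y \<otimes>\<^bsub>PA\<^esub> Z)"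
  using assms by (auto simp: carrier_PA PA_ring_simps FA.m_assoc)

lemma PA_mult_closed: "X \<in> carrier PA \<Longrightarrow> Y \<in> carrier PA \<Longrightarrow> X \<otimes>\<^bsub>PA\<^esub> Y \<in> carrier PA"
  by (auto simp: carrier_PA PA_ring_simps)

lemma PA_l_one: "X \<in> carrier PA \<Longrightarrow> \<one>\<^bsub>PA\<^esub> \<otimes>\<^bsub>PA\<^esub> X = X"
  using FA.l_one by (auto simp: carrier_PA one_PA PA_ring_simps)

lemma PA_r_one: "X \<in> carrier PA \<Longrightarrow> X \<otimes>\<^bsub>PA\<^esub> \<one>\<^bsub>PA\<^esub> = X"
  using FA.r_one by (auto simp: carrier_PA one_PA PA_ring_simps)

lemma mono_closed [simp]: "w \<in> lists Gs \<Longrightarrow> mono w \<in> carrier PA"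
  by (simp add: carrier_PA)

lemma mono_relation: "(u, v) \<in> R \<Longrightarrow> mono u = mono v"
proof -
  assume uv: "(u, v) \<in> R"
  then have w: "u \<in> lists Gs" "v \<in> lists Gs" using relators by auto
  have "basis_elt u \<ominus>\<^bsub>FA\<^esub> basis_elt v \<in> RI"
    unfolding relation_ideal_def using FA.genideal_self[OF generators_subset] uv by blast
  then show ?thesis
    using w by (simp add: proj_eq_iff monoid_algebra_minus[OF monoid_free_monoid])
qed

text \<open>The functionals on words that descend to the presented algebra.\<close>

definition invariant :: "('g list \<Rightarrow> 'k) \<Rightarrow> bool" where
  "invariant h \<longleftrightarrow> (\<forall>(u, v)\<in>R. \<forall>p\<in>lists Gs. \<forall>q\<in>lists Gs. h (p @ u @ q) = h (p @ v @ q))"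

lemma invariant_shift:
  assumes "invariant h" "x \<in> lists Gs"
  shows "invariant (\<lambda>y. h (x @ y))" "invariant (\<lambda>y. h (y @ x))"
proof -
  have h: "h (p @ u @ q) = h (p @ v @ q)"
    if "(u, v) \<in> R" "p \<in> lists Gs" "q \<in> lists Gs" for u v p q
    using assms(1) that unfolding invariant_def by blast
  show "invariant (\<lambda>y. h (x @ y))"
    unfolding invariant_def using assms(2) h[where p = "x @ p" for p] by auto
  show "invariant (\<lambda>y. h (y @ x))"
    unfolding invariant_def using assms(2) h[where q = "q @ x" for q] by auto
qed

text \<open>The common kernel of all invariant functionals is a two-sided ideal, because a functional stays
invariant when its argument is multiplied by a fixed word, and it contains the relators. Invariant
functionals therefore serve both to define maps on a presented algebra and to show that an element
of it is not zero.\<close>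

lemma relation_ideal_annihilated:
  assumes "f \<in> RI" "invariant h"
  shows "pairing f h = 0"
proof -
  define N where "N = {f \<in> carrier FA. \<forall>h. invariant h \<longrightarrow> pairing f h = 0}"
  note fin = monoid_algebra_finite[where M = "free_monoid Gs"]
  have "ideal N FA"
  proof (rule idealI)
    show "ring FA" by (rule FA.ring_axioms)
    have inv: "\<ominus>\<^bsub>FA\<^esub> f = (\<lambda>z. - f z)" if "f \<in> carrier FA" for f
      using that by (intro FA.minus_equality) (auto intro: monoid_algebra_uminus_closed)
    show "subgroup N (add_monoid FA)"
    proof (rule FA.add.subgroupI)
      have "(\<lambda>z. 0) \<in> N" by (simp add: N_def monoid_algebra_zero_closed)
      then show "N \<noteq> {}" by blast
    qed (auto simp: N_def inv pairing_add_left fin monoid_algebra_add_closed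
        pairing_uminus_left monoid_algebra_uminus_closed)
    fix a x assume a: "a \<in> N" and x: "x \<in> carrier FA"
    then have ac: "a \<in> carrier FA" by (simp add: N_def)
    have "pairing (x \<otimes>\<^bsub>FA\<^esub> a) h = pairing x (\<lambda>y. 0)" if "invariant h" for h
      unfolding pairing_mult[OF fin fin, OF x ac]
      using a x invariant_shift(1)[OF that] by (intro pairing_cong_carrier) (auto simp: N_def)
    then show "x \<otimes>\<^bsub>FA\<^esub> a \<in> N" using x ac by (simp add: N_def)
    have "pairing (a \<otimes>\<^bsub>FA\<^esub> x) h = pairing x (\<lambda>y. 0)" if "invariant h" for h
      unfolding pairing_mult[OF fin fin, OF ac x] pairing_swap[of a]
      using a x invariant_shift(2)[OF that] by (intro pairing_cong_carrier) (auto simp: N_def)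
    then show "a \<otimes>\<^bsub>FA\<^esub> x \<in> N" using x ac by (simp add: N_def)
  qed
  moreover have "{basis_elt u \<ominus>\<^bsub>FA\<^esub> basis_elt v | u v. (u, v) \<in> R} \<subseteq> N"
  proof clarify
    fix u v assume uv: "(u, v) \<in> R"
    then have w: "u \<in> lists Gs" "v \<in> lists Gs" using relators by auto
    have "pairing (\<lambda>z. basis_elt u z - basis_elt v z) h = h u - h v" for h :: "_ \<Rightarrow> 'k"
      using w by (simp add: pairing_diff_left fin)
    moreover have "h u = h v" if "invariant h" for h
      using that uv unfolding invariant_def by (auto dest!: bspec[of _ _ "(u, v)"] bspec[of _ _ "[]"])
    ultimately show "basis_elt u \<ominus>\<^bsub>FA\<^esub> basis_elt v \<in> N"
      using w FA.minus_closed[of "basis_elt u" "basis_elt v"]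
      by (simp add: N_def monoid_algebra_minus[OF monoid_free_monoid])
  qed
  ultimately have "RI \<subseteq> N" unfolding relation_ideal_def by (rule FA.genideal_minimal)
  with assms show ?thesis by (auto simp: N_def)
qed

lemma proj_induct [consumes 1, case_names add smult mono]:
  assumes "X \<in> carrier PA"
    and add: "\<And>X Y. X \<in> carrier PA \<Longrightarrow> Y \<in> carrier PA \<Longrightarrow> P X \<Longrightarrow> P Y \<Longrightarrow> P (X \<oplus>\<^bsub>PA\<^esub> Y)"
    and smult: "\<And>c X. X \<in> carrier PA \<Longrightarrow> P X \<Longrightarrow> P (c \<odot>\<^bsub>PA\<^esub> X)"
    and mono: "\<And>w. w \<in> lists Gs \<Longrightarrow> P (mono w)"
  shows "P X"
proof -
  obtain f where f: "f \<in> carrier FA" "X = proj f" using assms(1) by (auto simp: carrier_PA)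
  from f(1) have "P (proj f)"
  proof (induction rule: monoid_algebra_subspace_induct)
    case zero
    have "P (0 \<odot>\<^bsub>PA\<^esub> mono [])" by (intro smult mono) auto
    then show ?case by (simp add: PA_smult)
  next
    case (add f g)
    then have "P (proj f \<oplus>\<^bsub>PA\<^esub> proj g)" by (intro assms(2)) (auto simp: carrier_PA)
    with add show ?case by (simp add: PA_ring_simps)
  next
    case (smult c f)
    then have "P (c \<odot>\<^bsub>PA\<^esub> proj f)" by (intro assms(3)) (auto simp: carrier_PA)
    with smult show ?case by (simp add: PA_smult)
  qed (simp add: mono)
  with f show ?thesis by simp
qed

lemma presented_algebra_lift:
  assumes T: "T \<in> alg_hom FA B"
    and resp: "\<And>f g. f \<in> carrier FA \<Longrightarrow> g \<in> carrier FA \<Longrightarrow> (\<lambda>z. f z - g z) \<in> RI \<Longrightarrow> T f = T g"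
  obtains \<phi> where "\<phi> \<in> alg_hom PA B" "\<And>f. f \<in> carrier FA \<Longrightarrow> \<phi> (proj f) = T f"
proof -
  define \<phi> where "\<phi> X = T (SOME f. f \<in> carrier FA \<and> proj f = X)" for X
  have \<phi>: "\<phi> (proj f) = T f" if f: "f \<in> carrier FA" for f
  proof -
    let ?g = "SOME g. g \<in> carrier FA \<and> proj g = proj f"
    have "?g \<in> carrier FA \<and> proj ?g = proj f" by (rule someI[of _ f]) (use f in simp)
    then show ?thesis unfolding \<phi>_def using f by (intro resp) (auto simp: proj_eq_iff)
  qed
  have Tc: "T f \<in> carrier B" if "f \<in> carrier FA" for f
    using T that by (auto simp: alg_hom_def linear_maps_def)
  have "\<phi> \<in> ring_hom PA B"
  proof (rule ring_hom_memI)
    show "\<phi> X \<in> carrier B" if "X \<in> carrier PA" for X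
      using that \<phi> Tc by (auto simp: carrier_PA)
    show "\<phi> (X \<otimes>\<^bsub>PA\<^esub> Y) = \<phi> X \<otimes>\<^bsub>B\<^esub> \<phi> Y" if "X \<in> carrier PA" "Y \<in> carrier PA" for X Y
      using that T by (auto simp: carrier_PA PA_ring_simps \<phi> alg_hom_def ring_hom_def)
    show "\<phi> (X \<oplus>\<^bsub>PA\<^esub> Y) = \<phi> X \<oplus>\<^bsub>B\<^esub> \<phi> Y" if "X \<in> carrier PA" "Y \<in> carrier PA" for X Y
    proof -
      obtain f g where fg: "f \<in> carrier FA" "g \<in> carrier FA" "X = proj f" "Y = proj g"
        using \<open>X \<in> carrier PA\<close> \<open>Y \<in> carrier PA\<close> by (auto simp: carrier_PA)
      have "\<phi> (proj (f \<oplus>\<^bsub>FA\<^esub> g)) = T (f \<oplus>\<^bsub>FA\<^esub> g)" using fg by (intro \<phi> FA.a_closed)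
      also have "\<dots> = T f \<oplus>\<^bsub>B\<^esub> T g" using T fg unfolding alg_hom_def ring_hom_def by blast
      finally show ?thesis using fg by (simp only: PA_ring_simps \<phi>)
    qed
    have "\<phi> \<one>\<^bsub>PA\<^esub> = T \<one>\<^bsub>FA\<^esub>" using \<phi>[OF FA.one_closed] by (simp add: one_PA)
    then show "\<phi> \<one>\<^bsub>PA\<^esub> = \<one>\<^bsub>B\<^esub>" using T by (simp add: alg_hom_def ring_hom_def)
  qed
  moreover have "\<phi> (c \<odot>\<^bsub>PA\<^esub> X) = c \<odot>\<^bsub>B\<^esub> \<phi> X" if "X \<in> carrier PA" for c X
  proof -
    obtain f where f: "f \<in> carrier FA" "X = proj f" using \<open>X \<in> carrier PA\<close> by (auto simp: carrier_PA)
    have "\<phi> (proj (c \<odot>\<^bsub>FA\<^esub> f)) = T (c \<odot>\<^bsub>FA\<^esub> f)"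
      using f by (intro \<phi>) (simp add: monoid_algebra_smult_closed)
    also have "\<dots> = c \<odot>\<^bsub>B\<^esub> T f" using T f unfolding alg_hom_def linear_maps_def by blast
    finally show ?thesis using f by (simp only: PA_smult \<phi>)
  qed
  ultimately have "\<phi> \<in> alg_hom PA B"
    unfolding alg_hom_def linear_maps_def ring_hom_def by auto
  then show ?thesis using \<phi> by (rule that)
qed

end

section \<open>Permutations of a finite set\<close>

lemma extend_to_permutation:
  assumes "finite S" "A \<subseteq> S" "inj_on f A" "f ` A \<subseteq> S"
  obtains p where "p permutes S" "\<And>a. a \<in> A \<Longrightarrow> p a = f a"
proof -
  have fin: "finite A" using assms finite_subset by blast
  have "card (S - A) = card (S - f ` A)"
    using assms fin by (simp add: card_Diff_subset card_image)
  then obtain g where g: "bij_betw g (S - A) (S - f ` A)"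
    using assms finite_same_card_bij[of "S - A" "S - f ` A"] by auto
  define p where "p x = (if x \<in> A then f x else if x \<in> S then g x else x)" for x
  have "bij_betw p A (f ` A)"
    using assms(3) by (auto simp: p_def bij_betw_def inj_on_def)
  moreover have "bij_betw p (S - A) (S - f ` A)"
    using g by (subst bij_betw_cong[of _ _ g]) (auto simp: p_def)
  ultimately have "bij_betw p (A \<union> (S - A)) (f ` A \<union> (S - f ` A))"
    by (rule bij_betw_combine) auto
  moreover have "A \<union> (S - A) = S" "f ` A \<union> (S - f ` A) = S" using assms by auto
  ultimately have "bij_betw p S S" by simp
  then have "p permutes S"
    using assms(2) by (intro bij_imp_permutes) (auto simp: p_def)
  then show ?thesis by (rule that) (simp add: p_def)
qed

abbreviation adj :: "nat \<Rightarrow> nat \<Rightarrow> nat" where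
  "adj k \<equiv> Transposition.transpose k (k + 1)"

lemma adj_mem: "k \<in> {1..<n} \<Longrightarrow> adj k a \<in> {1..n} \<longleftrightarrow> a \<in> {1..n}"
  by (auto simp: Transposition.transpose_def)

section \<open>Words in the tied braid generators\<close>

text \<open>The ties of a word after all of them have been moved to its left end. A tie that passes a braid
generator is carried along by the transposition of its two strands.\<close>

fun ties :: "tb_gen list \<Rightarrow> (nat \<times> nat) list" where
  "ties [] = []"
| "ties (TE i # w) = (i, i + 1) # ties w"
| "ties (TS i # w) = map (map_prod (adj i) (adj i)) (ties w)"
| "ties (TSinv i # w) = map (map_prod (adj i) (adj i)) (ties w)"

definition satisfies :: "(nat \<Rightarrow> nat) \<Rightarrow> (nat \<times> nat) list \<Rightarrow> bool" where
  "satisfies J L \<longleftrightarrow> (\<forall>(a, b)\<in>set L. J a = J b)"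

text \<open>A word acts on colourings: braid generators permute the colours, and \<open>TE i\<close> is the projection onto
the colourings in which the strands \<open>i\<close> and \<open>i + 1\<close> agree. The predicate holds if none of the
projections annihilates \<open>J\<close>.\<close>

fun compatible :: "tb_gen list \<Rightarrow> (nat \<Rightarrow> nat) \<Rightarrow> bool" where
  "compatible [] J \<longleftrightarrow> True"
| "compatible (TE i # w) J \<longleftrightarrow> J i = J (i + 1) \<and> compatible w J"
| "compatible (TS i # w) J \<longleftrightarrow> compatible w (J \<circ> adj i)"
| "compatible (TSinv i # w) J \<longleftrightarrow> compatible w (J \<circ> adj i)"

lemma satisfies_map: "satisfies J (map (map_prod f f) L) \<longleftrightarrow> satisfies (J \<circ> f) L"
  by (auto simp: satisfies_def)

lemma satisfies_simps:
  "satisfies J []" "satisfies J ((a, b) # L) \<longleftrightarrow> J a = J b \<and> satisfies J L"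
  by (auto simp: satisfies_def)

lemma compatible_iff_satisfies: "compatible w J \<longleftrightarrow> satisfies J (ties w)"
  by (induction w arbitrary: J rule: ties.induct) (simp_all add: satisfies_map satisfies_simps)

lemma ties_range:
  "w \<in> lists (tb_gens n) \<Longrightarrow> set (ties w) \<subseteq> {1..n} \<times> {1..n}"
  by (induction w rule: ties.induct) (auto simp: tb_gens_def adj_mem[of _ n, simplified] Transposition.transpose_def)

definition untie :: "tb_gen list \<Rightarrow> tb_gen list" where
  "untie w = filter (\<lambda>g. \<forall>i. g \<noteq> TE i) w"

lemma untie_simps [simp]:
  "untie [] = []" "untie (TE i # w) = untie w"
  "untie (TS i # w) = TS i # untie w" "untie (TSinv i # w) = TSinv i # untie w"
  by (auto simp: untie_def)

section \<open>Operators satisfying the tied braid relations\<close>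

text \<open>The relations are stated for operators applied to an arbitrary \<open>x\<close>, because composition then is
nested application and rewriting needs no associativity law.\<close>

locale tied_operators =
  fixes n :: nat and s s' E :: "nat \<Rightarrow> 'b \<Rightarrow> 'b"
  assumes inv: "i \<in> {1..<n} \<Longrightarrow> s i (s' i x) = x" "i \<in> {1..<n} \<Longrightarrow> s' i (s i x) = x"
    and ss: "\<lbrakk>i \<in> {1..<n}; j \<in> {1..<n}; \<bar>int i - int j\<bar> > 1\<rbrakk> \<Longrightarrow> s i (s j x) = s j (s i x)"
    and sss: "\<lbrakk>i \<in> {1..<n}; j \<in> {1..<n}; \<bar>int i - int j\<bar> = 1\<rbrakk> \<Longrightarrow>
      s i (s j (s i x)) = s j (s i (s j x))"
    and EE: "\<lbrakk>i \<in> {1..<n}; j \<in> {1..<n}\<rbrakk> \<Longrightarrow> E i (E j x) = E j (E i x)"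
    and E_idem: "i \<in> {1..<n} \<Longrightarrow> E i (E i x) = E i x"
    and sE: "i \<in> {1..<n} \<Longrightarrow> s i (E i x) = E i (s i x)"
    and sE_far: "\<lbrakk>i \<in> {1..<n}; j \<in> {1..<n}; \<bar>int i - int j\<bar> > 1\<rbrakk> \<Longrightarrow> s i (E j x) = E j (s i x)"
    and Ess: "\<lbrakk>i \<in> {1..<n}; j \<in> {1..<n}; \<bar>int i - int j\<bar> = 1\<rbrakk> \<Longrightarrow>
      E i (s j (s i x)) = s j (s i (E j x))"
    and Ess_inv: "\<lbrakk>i \<in> {1..<n}; j \<in> {1..<n}; \<bar>int i - int j\<bar> = 1\<rbrakk> \<Longrightarrow>
      E i (s j (s' i x)) = s j (s' i (E j x))"
    and EEs: "\<lbrakk>i \<in> {1..<n}; j \<in> {1..<n}; \<bar>int i - int j\<bar> = 1\<rbrakk> \<Longrightarrow>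
      E i (E j (s i x)) = E j (s i (E j x))"
begin

lemma s'_push:
  assumes "i \<in> {1..<n}" "\<And>x. s i (X x) = Y (s i x)"
  shows "X (s' i x) = s' i (Y x)"
  using assms by (metis inv)

lemma ss'_far:
  assumes "i \<in> {1..<n}" "j \<in> {1..<n}" "\<bar>int i - int j\<bar> > 1"
  shows "s i (s' j x) = s' j (s i x)"
  using assms by (intro s'_push) (auto intro: ss)

text \<open>The relations \<open>Ess\<close> and \<open>Ess_inv\<close> differ only in the sign of the crossing \<open>s i\<close>. Comparing them
shows that the full twist of the strands \<open>i\<close> and \<open>i + 1\<close> commutes with \<open>E j\<close>.\<close>

lemma s_square_E:
  assumes ij: "i \<in> {1..<n}" "j \<in> {1..<n}" "\<bar>int i - int j\<bar> = 1"
  shows "s i (s i (E j x)) = E j (s i (s i x))"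
proof -
  have "s j (s' i (E j (s i (s i x)))) = E i (s j (s' i (s i (s i x))))"
    using ij by (simp add: Ess_inv)
  also have "\<dots> = s j (s i (E j x))" using ij by (simp add: inv Ess)
  finally show ?thesis using ij by (metis inv)
qed

text \<open>Two strands at distance two can be tied from either side: the end of the tie that moves over the
middle strand may be the upper or the lower one.\<close>

lemma tie_shift:
  assumes ij: "i \<in> {1..<n}" "j \<in> {1..<n}" "\<bar>int i - int j\<bar> = 1"
  shows "s i (E j (s' i x)) = s j (E i (s' j x))"
proof -
  have ji: "\<bar>int j - int i\<bar> = 1" using ij by simp
  have "s j (s i (E j (s' i x))) = E i (s j x)"
    using ij by (simp add: Ess[symmetric] inv)
  also have "\<dots> = s j (s j (E i (s' j x)))"
    using ij ji s_square_E[of j i "s' j x"] by (simp add: inv)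
  finally show ?thesis using ij by (metis inv)
qed

fun tie_up :: "nat \<Rightarrow> nat \<Rightarrow> 'b \<Rightarrow> 'b" where
  "tie_up i 0 x = E i x"
| "tie_up i (Suc m) x = s (i + Suc m) (tie_up i m (s' (i + Suc m) x))"

lemma tie_up_far:
  assumes "k \<in> {1..<n}" "1 \<le> i" "i + m < n" "k + 1 < i \<or> i + m + 1 < k"
  shows "s k (tie_up i m x) = tie_up i m (s k x)"
  using assms(3,4)
proof (induction m arbitrary: x)
  case 0
  then have "\<bar>int k - int i\<bar> > 1" by auto
  with 0 show ?case using assms(1,2) by (simp add: sE_far)
next
  case (Suc m)
  have "\<bar>int k - int (i + Suc m)\<bar> > 1" "i + Suc m \<in> {1..<n}" using Suc.prems by auto
  then have "s k (s (i + Suc m) y) = s (i + Suc m) (s k y)"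
      "s k (s' (i + Suc m) y) = s' (i + Suc m) (s k y)" for y
    using assms(1) by (auto intro: ss ss'_far)
  then show ?case using Suc by auto
qed

text \<open>The tie between \<open>i\<close> and \<open>i + m + 2\<close> is obtained from a shorter one by moving the lower end as well as
by moving the upper end. The recursion of \<open>tie_up\<close> handles conjugation at the upper end, this lemma
handles the lower end.\<close>

lemma tie_up_down:
  assumes "1 \<le> i" "i + Suc m < n"
  shows "tie_up i (Suc m) x = s i (tie_up (i + 1) m (s' i x))"
  using assms(2)
proof (induction m arbitrary: x)
  case 0
  then show ?case using assms(1) tie_shift[of "i + 1" i x] by simp
next
  case (Suc m)
  let ?k = "i + Suc (Suc m)"
  have k: "?k \<in> {1..<n}" "i \<in> {1..<n}" "\<bar>int ?k - int i\<bar> > 1" "\<bar>int i - int ?k\<bar> > 1"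
    using Suc.prems assms(1) by auto
  have "tie_up i (Suc (Suc m)) x = s ?k (s i (tie_up (i + 1) m (s' i (s' ?k x))))"
    using Suc by simp
  also have "\<dots> = s i (s ?k (tie_up (i + 1) m (s' ?k (s' i x))))"
  proof -
    have "s' i (s' ?k x) = s' ?k (s' i x)"
      using k by (metis s'_push ss'_far)
    then show ?thesis using ss[OF k(1,2,3)] by simp
  qed
  finally show ?case by simp
qed

lemma tie_up_square_top:
  assumes "1 \<le> i" "i + m + 1 < n"
  shows "s (i + m + 1) (s (i + m + 1) (tie_up i m x)) = tie_up i m (s (i + m + 1) (s (i + m + 1) x))"
  using assms
proof (induction m arbitrary: i x)
  case 0
  then show ?case by (simp add: s_square_E)
next
  case (Suc m)
  let ?k = "i + Suc m + 1"
  have k: "?k \<in> {1..<n}" "i \<in> {1..<n}" "\<bar>int ?k - int i\<bar> > 1" using Suc.prems by auto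
  have IH: "s ?k (s ?k (tie_up (i + 1) m y)) = tie_up (i + 1) m (s ?k (s ?k y))" for y
    using Suc.IH[of "i + 1" y] Suc.prems by (simp add: add_ac)
  have d: "tie_up i (Suc m) y = s i (tie_up (i + 1) m (s' i y))" for y
    using Suc.prems by (intro tie_up_down) auto
  have c: "s ?k (s i y) = s i (s ?k y)" "s ?k (s' i y) = s' i (s ?k y)" for y
    using k by (auto intro: ss ss'_far)
  show ?case unfolding d c IH ..
qed

lemma tie_up_square_bot:
  assumes "1 \<le> i" "i + m + 1 < n"
  shows "s i (s i (tie_up (i + 1) m x)) = tie_up (i + 1) m (s i (s i x))"
  using assms(2)
proof (induction m arbitrary: x)
  case 0
  then show ?case using assms(1) by (simp add: s_square_E)
next
  case (Suc m)
  let ?k = "i + 1 + Suc m"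
  have k: "?k \<in> {1..<n}" "i \<in> {1..<n}" "\<bar>int i - int ?k\<bar> > 1" using Suc.prems assms by auto
  have c: "s i (s ?k y) = s ?k (s i y)" "s i (s' ?k y) = s' ?k (s i y)" for y
    using k by (auto intro: ss ss'_far)
  have IH: "s i (s i (tie_up (i + 1) m y)) = tie_up (i + 1) m (s i (s i y))" for y
    using Suc by simp
  show ?case unfolding tie_up.simps c IH ..
qed

text \<open>A crossing strictly between the two ends slides along the band of the tie by the braid relation,
becomes a crossing above the shorter tie, and slides back.\<close>

lemma tie_up_mid:
  assumes "1 \<le> i" "i + m < n" "i < k" "k < i + m"
  shows "s k (tie_up i m x) = tie_up i m (s k x)"
  using assms(2,4)
proof (induction m arbitrary: x)
  case (Suc m)
  let ?j = "i + Suc m"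
  have kj: "k \<in> {1..<n}" "?j \<in> {1..<n}" using assms Suc.prems by auto
  show ?case
  proof (cases "k < i + m")
    case True
    have "\<bar>int k - int ?j\<bar> > 1" using True by auto
    then have c: "s k (s ?j y) = s ?j (s k y)" "s k (s' ?j y) = s' ?j (s k y)" for y
      using kj by (auto intro: ss ss'_far)
    have IH: "s k (tie_up i m y) = tie_up i m (s k y)" for y using Suc True by simp
    show ?thesis unfolding tie_up.simps c IH ..
  next
    case False
    with Suc.prems have k: "k = i + m" by simp
    with assms(3) obtain m' where m: "m = Suc m'" by (cases m) auto
    have braid: "s k (s ?j (s k y)) = s ?j (s k (s ?j y))" for y
      using kj k by (intro sss) auto
    have far: "s ?j (tie_up i m' y) = tie_up i m' (s ?j y)" for y
      using kj k m assms(1) by (intro tie_up_far) auto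
    have inv_braid: "s ?j (s' k (s' ?j y)) = s' k (s' ?j (s k y))" for y
      using kj braid by (metis inv)
    then have "s k (s ?j (s k (tie_up i m' (s' k (s' ?j x))))) =
        s ?j (s k (tie_up i m' (s' k (s' ?j (s k x)))))"
      by (simp only: braid far inv_braid)
    then show ?thesis using k m by simp
  qed
qed (use assms(3) in simp)

definition tie :: "nat \<Rightarrow> nat \<Rightarrow> 'b \<Rightarrow> 'b" where
  "tie a b x = (if a = b then x else if a < b then tie_up a (b - a - 1) x else tie_up b (a - b - 1) x)"

lemma tie_sym: "tie a b = tie b a"
  by (auto simp: tie_def)

lemma tie_self [simp]: "tie a a x = x"
  by (simp add: tie_def)

text \<open>An adjacent crossing either touches one end of the tie and moves it, exchanges the two ends of a tie
between neighbours, or leaves the tie alone.\<close>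

lemma s_tie_less:
  assumes k: "k \<in> {1..<n}" and ab: "1 \<le> a" "b \<le> n" "a < b"
  shows "s k (tie a b x) = tie (adj k a) (adj k b) (s k x)"
proof -
  obtain m where b: "b = a + m + 1" using ab(3) by (metis less_imp_add_positive Suc_eq_plus1 add.assoc gr0_implies_Suc)
  have e: "tie a (a + m + 1) = tie_up a m" for a m by (simp add: tie_def fun_eq_iff)
  have kn: "1 \<le> k" "k < n" using k by auto
  consider "k + 1 < a \<or> a + m + 1 < k" | "k + 1 = a" | "k = a" "m = 0" | "k = a" "m > 0"
    | "a < k" "k < a + m" | "a < k" "k = a + m" | "k = a + m + 1" by linarith
  then show ?thesis
  proof cases
    case 1
    then have "adj k a = a" "adj k b = b" using b by (auto simp: Transposition.transpose_def)
    with 1 show ?thesis using kn ab b k tie_up_far[of k a m x] e[of a m] by simp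
  next
    case 2
    have "tie_up k (Suc m) (s k x) = s k (tie_up a m x)"
      using tie_up_down[of k m "s k x"] 2 kn ab b k by (simp add: inv)
    moreover have "adj k a = k" "adj k b = k + Suc m + 1"
      using 2 b by (auto simp: Transposition.transpose_def)
    ultimately show ?thesis using e[of a m] e[of k "Suc m"] b by simp
  next
    case 3
    then have "tie (adj k a) (adj k b) = tie a b"
      using b by (simp add: tie_sym)
    moreover have "tie a b = tie_up a 0" using e[of a m] b 3 by simp
    ultimately show ?thesis using 3 k by (simp add: sE)
  next
    case 4
    then obtain m' where m: "m = Suc m'" by (cases m) auto
    have "s k (tie_up a m x) = s k (s k (tie_up (a + 1) m' (s' k x)))"
      using tie_up_down[of a m' x] m 4 ab b kn by simp
    also have "\<dots> = tie_up (a + 1) m' (s k x)"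
      using tie_up_square_bot[of a m' "s' k x"] 4 m ab b kn k by (simp add: inv)
    finally have "s k (tie_up a m x) = tie_up (a + 1) m' (s k x)" .
    moreover have "adj k a = a + 1" "adj k b = (a + 1) + m' + 1"
      using 4 b m by (auto simp: Transposition.transpose_def)
    ultimately show ?thesis using e[of a m] e[of "a + 1" m'] b by simp
  next
    case 5
    then have "adj k a = a" "adj k b = b" using b by (auto simp: Transposition.transpose_def)
    with 5 show ?thesis using kn ab b k tie_up_mid[of a m k x] e[of a m] by simp
  next
    case 6
    then obtain m' where m: "m = Suc m'" by (cases m) auto
    have "s k (tie_up a m x) = s k (s k (tie_up a m' (s' k x)))"
      using m 6 by simp
    also have "\<dots> = tie_up a m' (s k x)"
      using tie_up_square_top[of a m' "s' k x"] 6 m ab b kn k by (simp add: inv)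
    finally have "s k (tie_up a m x) = tie_up a m' (s k x)" .
    moreover have "adj k a = a" "adj k b = a + m' + 1"
      using 6 b m by (auto simp: Transposition.transpose_def)
    ultimately show ?thesis using e[of a m] e[of a m'] b by simp
  next
    case 7
    have "s k (tie_up a m x) = tie_up a (Suc m) (s k x)"
      using 7 k by (simp add: inv)
    moreover have "adj k a = a" "adj k b = a + Suc m + 1"
      using 7 b by (auto simp: Transposition.transpose_def)
    ultimately show ?thesis using e[of a m] e[of a "Suc m"] b by simp
  qed
qed

lemma s_tie:
  assumes k: "k \<in> {1..<n}" and ab: "a \<in> {1..n}" "b \<in> {1..n}"
  shows "s k (tie a b x) = tie (adj k a) (adj k b) (s k x)"
proof (cases a b rule: linorder_cases)
  case less
  then show ?thesis using s_tie_less[OF k] ab by simp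
next
  case equal
  then show ?thesis by simp
next
  case greater
  then have "s k (tie b a x) = tie (adj k b) (adj k a) (s k x)"
    using s_tie_less[OF k] ab by simp
  then show ?thesis using tie_sym[of b a] tie_sym[of "adj k b"] by simp
qed

lemma s'_tie:
  assumes k: "k \<in> {1..<n}" and ab: "a \<in> {1..n}" "b \<in> {1..n}"
  shows "s' k (tie a b x) = tie (adj k a) (adj k b) (s' k x)"
proof -
  have "s k (tie (adj k a) (adj k b) y) = tie a b (s k y)" for y
    using s_tie[OF k, of "adj k a" "adj k b"] ab adj_mem[OF k] by simp
  then show ?thesis using s'_push[OF k] by metis
qed

text \<open>Some operator \<open>g\<close> carries every tie along \<open>p\<close>. The right inverse \<open>g'\<close> is what allows identities
between ties to be transported: each argument can be written as \<open>g (g' x)\<close>.\<close>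

definition realizable :: "(nat \<Rightarrow> nat) \<Rightarrow> bool" where
  "realizable p \<longleftrightarrow> (\<exists>g g'. (\<forall>x. g (g' x) = x) \<and>
    (\<forall>a\<in>{1..n}. \<forall>b\<in>{1..n}. \<forall>x. g (tie a b x) = tie (p a) (p b) (g x)))"

lemma realizable_comp:
  assumes "realizable p" "realizable q" "q permutes {1..n}"
  shows "realizable (p \<circ> q)"
proof -
  obtain g g' where g: "\<And>x. g (g' x) = x"
    "\<And>a b x. a \<in> {1..n} \<Longrightarrow> b \<in> {1..n} \<Longrightarrow> g (tie a b x) = tie (p a) (p b) (g x)"
    using assms(1) unfolding realizable_def by blast
  obtain h h' where h: "\<And>x. h (h' x) = x"
    "\<And>a b x. a \<in> {1..n} \<Longrightarrow> b \<in> {1..n} \<Longrightarrow> h (tie a b x) = tie (q a) (q b) (h x)"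
    using assms(2) unfolding realizable_def by blast
  have "q a \<in> {1..n}" if "a \<in> {1..n}" for a
    using that by (simp only: permutes_in_image[OF assms(3)])
  then show ?thesis
    unfolding realizable_def using g h
    by (intro exI[of _ "g \<circ> h"] exI[of _ "h' \<circ> g'"]) (simp del: atLeastAtMost_iff)
qed

lemma adj_permutes: "k \<in> {1..<n} \<Longrightarrow> adj k permutes {1..n}"
  by (rule permutes_swap_id) auto

lemma realizable_adj: "k \<in> {1..<n} \<Longrightarrow> realizable (adj k)"
  unfolding realizable_def using s_tie inv
  by (intro exI[of _ "s k"] exI[of _ "s' k"]) auto

lemma realizable_transpose:
  assumes "1 \<le> a" "a + Suc m \<le> n"
  shows "realizable (Transposition.transpose a (a + Suc m))"
  using assms(2)
proof (induction m)
  case 0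
  then show ?case using assms realizable_adj[of a] by simp
next
  case (Suc m)
  let ?k = "a + Suc m"
  have k: "?k \<in> {1..<n}" using Suc.prems by auto
  have "Transposition.transpose a (a + Suc (Suc m)) = adj ?k \<circ> (Transposition.transpose a ?k \<circ> adj ?k)"
    by (auto simp: fun_eq_iff Transposition.transpose_def)
  moreover have "Transposition.transpose a ?k permutes {1..n}"
    using assms(1) Suc.prems by (intro permutes_swap_id) auto
  moreover have "realizable (Transposition.transpose a ?k)"
    using Suc.prems by (intro Suc.IH) auto
  ultimately show ?case
    by (simp only: realizable_comp[OF realizable_adj[OF k] realizable_comp[OF _ realizable_adj[OF k]
        adj_permutes[OF k]]] permutes_compose[OF adj_permutes[OF k]])
qed

lemma realizable_permutes:
  assumes "p permutes {1..n}" shows "realizable p"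
proof -
  have less: "realizable (Transposition.transpose a b)" if "a < b" "a \<in> {1..n}" "b \<in> {1..n}" for a b
    using realizable_transpose[of a "b - a - 1"] that by auto
  have tr: "realizable (Transposition.transpose a b)" if "a \<in> {1..n}" "b \<in> {1..n}" "a \<noteq> b" for a b
    using less[of a b] less[of b a] that transpose_commute[of a b] by (metis linorder_neqE_nat)
  have "finite {1..n}" by simp
  with assms show ?thesis
  proof (induction rule: permutes_induct)
    case id
    show ?case unfolding realizable_def by (intro exI[of _ "\<lambda>x. x"]) auto
  next
    case (swap a b p)
    then show ?case by (intro realizable_comp tr) auto
  qed
qed

text \<open>A configuration of distinct strands can be moved onto any other configuration of the same size.
Identities between ties thus need to be checked only for the strands \<open>1, 2, 3, 4\<close>, where they
come from the defining relations.\<close>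

lemma realize_injection:
  assumes "inj_on f A" "A \<subseteq> {1..n}" "f ` A \<subseteq> {1..n}"
  obtains g g' where "\<And>x. g (g' x) = x"
    "\<And>a b x. a \<in> A \<Longrightarrow> b \<in> A \<Longrightarrow> g (tie a b x) = tie (f a) (f b) (g x)"
proof -
  have "finite {1..n}" by simp
  from extend_to_permutation[OF this assms(2,1,3)] obtain p
    where p: "p permutes {1..n}" "\<And>a. a \<in> A \<Longrightarrow> p a = f a" by blast
  obtain g g' where g: "\<And>x. g (g' x) = x"
    "\<And>a b x. a \<in> {1..n} \<Longrightarrow> b \<in> {1..n} \<Longrightarrow> g (tie a b x) = tie (p a) (p b) (g x)"
    using realizable_permutes[OF p(1)] unfolding realizable_def by blast
  show ?thesis
  proof (rule that[of g g'])
    fix a b x assume "a \<in> A" "b \<in> A"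
    then show "g (tie a b x) = tie (f a) (f b) (g x)"
      using assms(2) g(2)[of a b] by (simp add: p(2) subset_eq)
  qed (rule g(1))
qed

lemma tie_E: "tie i (i + 1) = E i"
  by (auto simp: tie_def fun_eq_iff)

lemma tie_idem:
  assumes "a \<in> {1..n}" "b \<in> {1..n}" shows "tie a b (tie a b x) = tie a b x"
proof (cases "a = b")
  case False
  define f where "f = (\<lambda>i::nat. if i = 1 then a else b)"
  have n: "1 \<in> {1..<n}" using assms False by auto
  have f: "f 1 = a" "f 2 = b" by (auto simp: f_def)
  obtain g g' where g: "\<And>x. g (g' x) = x"
    "\<And>i j x. i \<in> {1, 2} \<Longrightarrow> j \<in> {1, 2} \<Longrightarrow> g (tie i j x) = tie (f i) (f j) (g x)"
    by (rule realize_injection[of f "{1, 2}"]) (use assms False in \<open>auto simp: f_def inj_on_def\<close>)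
  have "tie a b (tie a b (g y)) = tie a b (g y)" for y
    using E_idem[OF n, of y] tie_E[of 1] g(2)[of 1 2] f by (simp add: numeral_2_eq_2) metis
  then show ?thesis using g(1) by metis
qed simp

text \<open>For the strands \<open>1, 2, 3\<close> the second identity is the relation between \<open>E 2 E 1 s 2\<close> and
\<open>E 1 s 2 E 1\<close>, with \<open>s 2\<close> cancelled on the right.\<close>

lemma tie_three:
  assumes "a \<in> {1..n}" "b \<in> {1..n}" "c \<in> {1..n}" "a \<noteq> b" "b \<noteq> c" "a \<noteq> c"
  shows "tie a b (tie b c x) = tie b c (tie a b x)" "tie a b (tie b c x) = tie a b (tie a c x)"
proof -
  define f where "f = (\<lambda>i::nat. if i = 1 then a else if i = 2 then b else c)"
  have f: "f 1 = a" "f 2 = b" "f 3 = c" by (auto simp: f_def)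
  have "card {a, b, c} \<le> card {1..n}" using assms by (intro card_mono) auto
  then have n: "n \<ge> 3" using assms by simp
  obtain g g' where g: "\<And>x. g (g' x) = x"
    "\<And>i j x. i \<in> {1, 2, 3} \<Longrightarrow> j \<in> {1, 2, 3} \<Longrightarrow> g (tie i j x) = tie (f i) (f j) (g x)"
    by (rule realize_injection[of f "{1, 2, 3}"]) (use assms n in \<open>auto simp: f_def inj_on_def\<close>)
  have t12: "g (tie 1 2 x) = tie a b (g x)" for x using g(2)[of 1 2 x] f by simp
  have t23: "g (tie 2 3 x) = tie b c (g x)" for x using g(2)[of 2 3 x] f by simp
  have t13: "g (tie 1 3 x) = tie a c (g x)" for x using g(2)[of 1 3 x] f by simp
  have E12: "tie 1 2 = E 1" "tie 2 3 = E 2" using tie_E[of 1] tie_E[of 2] by (simp_all add: numeral_eq_Suc)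
  have E13: "tie 1 3 y = s 2 (E 1 (s' 2 y))" for y
    by (simp add: tie_def numeral_eq_Suc)
  have c: "tie 1 2 (tie 2 3 y) = tie 2 3 (tie 1 2 y)" for y
    unfolding E12 using n by (intro EE) auto
  have "E 2 (E 1 y) = E 1 (s 2 (E 1 (s' 2 y)))" for y
    using EEs[of 2 1 "s' 2 y"] n by (simp add: inv)
  then have "tie 2 3 (tie 1 2 y) = tie 1 2 (tie 1 3 y)" for y
    unfolding E12 E13 .
  then have t: "tie 1 2 (tie 2 3 y) = tie 1 2 (tie 1 3 y)" for y
    by (simp only: c)
  show "tie a b (tie b c x) = tie b c (tie a b x)"
    using arg_cong[OF c[of "g' x"], of g] by (simp only: t12 t23 g(1))
  show "tie a b (tie b c x) = tie a b (tie a c x)"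
    using arg_cong[OF t[of "g' x"], of g] by (simp only: t12 t23 t13 g(1))
qed

lemma tie_disjoint:
  assumes "{a, b, c, d} \<subseteq> {1..n}" "card {a, b, c, d} = 4"
  shows "tie a b (tie c d x) = tie c d (tie a b x)"
proof -
  define f where "f = (\<lambda>i::nat. if i = 1 then a else if i = 2 then b else if i = 3 then c else d)"
  have f: "f 1 = a" "f 2 = b" "f 3 = c" "f 4 = d" by (auto simp: f_def)
  have "card {a, b, c, d} \<le> card {1..n}" using assms by (intro card_mono) auto
  then have n: "n \<ge> 4" using assms by simp
  have dis: "a \<noteq> b" "a \<noteq> c" "a \<noteq> d" "b \<noteq> c" "b \<noteq> d" "c \<noteq> d"
    using assms(2) by (auto simp: card_insert_if split: if_splits)
  obtain g g' where g: "\<And>x. g (g' x) = x"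
    "\<And>i j x. i \<in> {1, 2, 3, 4} \<Longrightarrow> j \<in> {1, 2, 3, 4} \<Longrightarrow> g (tie i j x) = tie (f i) (f j) (g x)"
    by (rule realize_injection[of f "{1, 2, 3, 4}"])
      (use assms(1) dis n in \<open>auto simp: f_def inj_on_def\<close>)
  have t12: "g (tie 1 2 x) = tie a b (g x)" for x using g(2)[of 1 2 x] f by simp
  have t34: "g (tie 3 4 x) = tie c d (g x)" for x using g(2)[of 3 4 x] f by simp
  have E: "tie 1 2 = E 1" "tie 3 4 = E 3" using tie_E[of 1] tie_E[of 3] by (simp_all add: numeral_eq_Suc)
  have "tie 1 2 (tie 3 4 y) = tie 3 4 (tie 1 2 y)" for y
    unfolding E using n by (intro EE) auto
  from arg_cong[OF this[of "g' x"], of g] show ?thesis by (simp only: t12 t34 g(1))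
qed

lemma tie_commute:
  assumes r: "a \<in> {1..n}" "b \<in> {1..n}" "c \<in> {1..n}" "d \<in> {1..n}"
  shows "tie a b (tie c d x) = tie c d (tie a b x)"
proof -
  consider "a = b \<or> c = d" | "a = c \<and> b = d \<or> a = d \<and> b = c"
    | "a \<noteq> b" "a \<noteq> c" "a \<noteq> d" "b \<noteq> c" "b \<noteq> d" "c \<noteq> d"
    | "a \<noteq> b" "c \<noteq> d" "a = c" "b \<noteq> d" | "a \<noteq> b" "c \<noteq> d" "a = d" "b \<noteq> c"
    | "a \<noteq> b" "c \<noteq> d" "b = c" "a \<noteq> d" | "a \<noteq> b" "c \<noteq> d" "b = d" "a \<noteq> c"
    by blast
  then show ?thesis
  proof cases
    case 2
    then have "tie a b = tie c d" using tie_sym by auto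
    then show ?thesis by simp
  next
    case 3
    then show ?thesis using r by (intro tie_disjoint) auto
  next
    case 4
    then show ?thesis using tie_three(1)[of b a d] r tie_sym[of b a] by simp
  next
    case 5
    then show ?thesis using tie_three(1)[of b a c] r tie_sym[of b a] tie_sym[of a c] by simp
  next
    case 6
    then show ?thesis using tie_three(1)[of a b d] r by simp
  next
    case 7
    then show ?thesis using tie_three(1)[of a b c] r tie_sym[of b c] by simp
  qed auto
qed

lemma tie_trans:
  assumes "a \<in> {1..n}" "b \<in> {1..n}" "c \<in> {1..n}"
  shows "tie a b (tie b c x) = tie a b (tie a c x)"
  using assms tie_three(2)[of a b c x] tie_idem[of a b x] tie_sym[of b a]
  by (cases "a = b"; cases "b = c"; cases "a = c") auto

fun tie_list :: "(nat \<times> nat) list \<Rightarrow> 'b \<Rightarrow> 'b" where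
  "tie_list [] x = x"
| "tie_list ((a, b) # L) x = tie a b (tie_list L x)"

lemma tie_tie_list:
  assumes "a \<in> {1..n}" "b \<in> {1..n}" "set L \<subseteq> {1..n} \<times> {1..n}"
  shows "tie a b (tie_list L x) = tie_list L (tie a b x)"
  using assms(3)
proof (induction L)
  case (Cons p L)
  obtain c d where p: "p = (c, d)" by force
  with Cons assms tie_commute[of a b c d] show ?case by auto
qed simp

lemma tie_list_commute:
  assumes "set L \<subseteq> {1..n} \<times> {1..n}" "set L' \<subseteq> {1..n} \<times> {1..n}"
  shows "tie_list L (tie_list L' x) = tie_list L' (tie_list L x)"
  using assms(1)
proof (induction L)
  case (Cons p L)
  obtain c d where p: "p = (c, d)" by force
  with Cons assms(2) show ?case by (simp add: tie_tie_list)
qed simp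

lemma tie_list_absorb_member:
  assumes "set L \<subseteq> {1..n} \<times> {1..n}" "(a, b) \<in> set L"
  shows "tie_list L (tie a b x) = tie_list L x"
  using assms
proof (induction L)
  case (Cons p L)
  obtain c d where p: "p = (c, d)" by force
  have r: "a \<in> {1..n}" "b \<in> {1..n}" "set L \<subseteq> {1..n} \<times> {1..n}" using Cons.prems by auto
  show ?case
  proof (cases "(a, b) = p")
    case True
    then show ?thesis using p r tie_idem[of a b "tie_list L x"]
      by (simp add: tie_tie_list[symmetric])
  next
    case False
    then have "(a, b) \<in> set L" using Cons.prems by auto
    then show ?thesis using Cons.IH[OF r(3)] by (simp add: p)
  qed
qed simp

text \<open>Absorption of the tie between \<open>a\<close> and \<open>b\<close> by \<open>L\<close> is an equivalence relation on strands, by symmetry and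
transitivity of ties. Colouring each strand by the least member of its class satisfies \<open>L\<close>, so a
tie that \<open>L\<close> forces on all such colourings joins equivalent strands.\<close>

lemma tie_list_absorb:
  assumes L: "set L \<subseteq> {1..n} \<times> {1..n}" and ab: "a \<in> {1..n}" "b \<in> {1..n}"
    and implied: "\<And>J. J ` {1..n} \<subseteq> {1..n} \<Longrightarrow> satisfies J L \<Longrightarrow> J a = J b"
  shows "tie_list L (tie a b x) = tie_list L x"
proof -
  define eq where "eq a b \<longleftrightarrow> b \<in> {1..n} \<and> (\<forall>x. tie_list L (tie a b x) = tie_list L x)" for a b
  define J where "J a = (LEAST b. eq a b)" for a
  have refl: "eq a a" if "a \<in> {1..n}" for a using that by (simp add: eq_def)
  have sym: "eq b a" if "eq a b" "a \<in> {1..n}" for a b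
    using that tie_sym by (auto simp: eq_def)
  have trans: "eq a c" if "eq a b" "eq b c" "a \<in> {1..n}" for a b c
  proof -
    have r: "b \<in> {1..n}" "c \<in> {1..n}" using that by (auto simp: eq_def)
    have "tie_list L (tie a c x) = tie_list L x" for x
    proof -
      have "tie_list L (tie a c x) = tie_list L (tie a b (tie a c x))"
        using that(1) by (simp add: eq_def)
      also have "\<dots> = tie_list L (tie a b (tie b c x))"
        by (simp only: tie_trans[OF that(3) r])
      also have "\<dots> = tie_list L (tie b c x)"
        using that(1) by (simp add: eq_def)
      finally show ?thesis using that(2) by (simp add: eq_def)
    qed
    then show ?thesis using r by (simp add: eq_def)
  qed
  have J: "eq a (J a)" if "a \<in> {1..n}" for a
    unfolding J_def by (rule LeastI) (rule refl[OF that])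
  have "satisfies J L"
    unfolding satisfies_def
  proof clarify
    fix a b assume m: "(a, b) \<in> set L"
    then have r: "a \<in> {1..n}" "b \<in> {1..n}" using L by auto
    have "eq a b" using tie_list_absorb_member[OF L m] r by (simp add: eq_def)
    then have "eq a = eq b" using sym trans r by (intro ext) blast
    then show "J a = J b" by (simp add: J_def)
  qed
  moreover have "J ` {1..n} \<subseteq> {1..n}" using J unfolding eq_def by blast
  ultimately have "J a = J b" by (intro implied)
  then have "eq a b" using J ab sym trans by metis
  then show ?thesis by (simp add: eq_def)
qed

lemma tie_list_determined:
  assumes L: "set L \<subseteq> {1..n} \<times> {1..n}" and L': "set L' \<subseteq> {1..n} \<times> {1..n}"
    and eq: "\<And>J. J ` {1..n} \<subseteq> {1..n} \<Longrightarrow> satisfies J L \<longleftrightarrow> satisfies J L'"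
  shows "tie_list L x = tie_list L' x"
proof -
  have absorb: "tie_list L (tie_list M x) = tie_list L x"
    if "set L \<subseteq> {1..n} \<times> {1..n}" "set M \<subseteq> set L'" "set L' \<subseteq> {1..n} \<times> {1..n}"
      "\<And>J. J ` {1..n} \<subseteq> {1..n} \<Longrightarrow> satisfies J L \<longleftrightarrow> satisfies J L'" for L L' M x
    using that(2)
  proof (induction M)
    case (Cons p M)
    obtain a b where p: "p = (a, b)" by force
    have m: "(a, b) \<in> set L'" using Cons.prems p by auto
    have "tie_list L (tie a b (tie_list M x)) = tie_list L (tie_list M x)"
    proof (rule tie_list_absorb[OF that(1)])
      show "a \<in> {1..n}" "b \<in> {1..n}" using m that(3) by auto
      fix J assume "J ` {1..n} \<subseteq> {1..n}" "satisfies J L"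
      with that(4) have "satisfies J L'" by blast
      with m show "J a = J b" by (auto simp: satisfies_def)
    qed
    with Cons p show ?case by simp
  qed simp
  have "tie_list L x = tie_list L (tie_list L' x)" using absorb[OF L subset_refl L' eq] by simp
  also have "\<dots> = tie_list L' (tie_list L x)" using L L' by (rule tie_list_commute)
  also have "\<dots> = tie_list L' x" using absorb[OF L' subset_refl L] eq by simp
  finally show ?thesis .
qed

fun act :: "tb_gen list \<Rightarrow> 'b \<Rightarrow> 'b" where
  "act [] x = x"
| "act (TE i # w) x = E i (act w x)"
| "act (TS i # w) x = s i (act w x)"
| "act (TSinv i # w) x = s' i (act w x)"

lemma s_tie_list:
  assumes "k \<in> {1..<n}" "set L \<subseteq> {1..n} \<times> {1..n}"
  shows "s k (tie_list L x) = tie_list (map (map_prod (adj k) (adj k)) L) (s k x)"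
    and "s' k (tie_list L x) = tie_list (map (map_prod (adj k) (adj k)) L) (s' k x)"
  using assms(2)
  by (induction L) (use assms(1) in \<open>auto simp: s_tie s'_tie simp del: One_nat_def\<close>)

lemma act_normal_form:
  "w \<in> lists (tb_gens n) \<Longrightarrow> act w x = tie_list (ties w) (act (untie w) x)"
proof (induction w rule: ties.induct)
  case (2 i w)
  then show ?case using tie_E[of i] by simp
next
  case (3 i w)
  then show ?case using ties_range[of w n] s_tie_list(1)[of i "ties w"] by (auto simp: tb_gens_def)
next
  case (4 i w)
  then show ?case using ties_range[of w n] s_tie_list(2)[of i "ties w"] by (auto simp: tb_gens_def)
qed simp

theorem act_determined:
  assumes uv: "u \<in> lists (tb_gens n)" "v \<in> lists (tb_gens n)"
    and "\<And>J. J ` {1..n} \<subseteq> {1..n} \<Longrightarrow> compatible u J \<longleftrightarrow> compatible v J"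
    and "\<And>x. act (untie u) x = act (untie v) x"
  shows "act u x = act v x"
  using tie_list_determined[OF ties_range[OF uv(1)] ties_range[OF uv(2)]] assms
  by (simp add: act_normal_form compatible_iff_satisfies)

end

section \<open>The framed braid group\<close>

lemma fb_gens_iff [simp]:
  "Sigma_gen i \<in> fb_gens n \<longleftrightarrow> i \<in> {1..<n}" "T_gen i \<in> fb_gens n \<longleftrightarrow> i \<in> {1..n}"
  by (auto simp: fb_gens_def)

lemma fb_rels_words:
  "fb_rels d n \<subseteq> lists (fb_gens n \<times> UNIV) \<times> lists (fb_gens n \<times> UNIV)"
proof (rule subrelI)
  fix u v assume "(u, v) \<in> fb_rels d n"
  then show "(u, v) \<in> lists (fb_gens n \<times> UNIV) \<times> lists (fb_gens n \<times> UNIV)"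
    by cases (auto simp: adj_mem[of _ n, simplified] Transposition.transpose_def)
qed

interpretation FB: group_presentation "fb_gens n" "fb_rels d n" for d n
  by unfold_locales (rule fb_rels_words)

abbreviation fb_cl :: "nat \<Rightarrow> nat \<Rightarrow> fb_gen gword \<Rightarrow> fb_gen gword set" where
  "fb_cl d n \<equiv> FB.cl n d"

lemmas fb_carrier = FB.carrier_PG[of n d for n d, folded framed_braid_group_def]
lemmas fb_cl_closed = FB.cl_closed[of _ n d for n d, folded framed_braid_group_def]
lemmas fb_mult_cl = FB.mult_cl[of _ n _ d for n d, folded framed_braid_group_def]
lemmas fb_one = FB.one_PG[of n d for n d, folded framed_braid_group_def]
lemmas fb_inv_letter = FB.inv_letter[of _ n d for n d, folded framed_braid_group_def]

lemma fb_group: "group (framed_braid_group d n)"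
  unfolding framed_braid_group_def by (rule FB.PG.is_group)

text \<open>On the level of words this is the projection of the framed braid group onto the braid group; it
realises the braid group inside a group that is given only by a presentation.\<close>

fun unframe :: "fb_gen gword \<Rightarrow> fb_gen gword" where
  "unframe [] = []"
| "unframe ((Sigma_gen i, b) # w) = (Sigma_gen i, b) # unframe w"
| "unframe ((T_gen i, b) # w) = unframe w"

lemma unframe_append [simp]: "unframe (u @ v) = unframe u @ unframe v"
  by (induction u rule: unframe.induct) auto

lemma unframe_idem [simp]: "unframe (unframe w) = unframe w"
  by (induction w rule: unframe.induct) auto

lemma unframe_words: "w \<in> lists (fb_gens n \<times> UNIV) \<Longrightarrow> unframe w \<in> lists (fb_gens n \<times> UNIV)"
  by (induction w rule: unframe.induct) auto

lemma unframe_replicate [simp]: "unframe (replicate k (T_gen i, b)) = []"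
  by (induction k) auto

lemma unframe_cong:
  "(u, v) \<in> word_cong (fb_gens n) (fb_rels d n) \<Longrightarrow>
    (unframe u, unframe v) \<in> word_cong (fb_gens n) (fb_rels d n)"
proof (induction rule: word_cong.induct)
  case (refl w)
  then show ?case by (intro word_cong.refl unframe_words)
next
  case (append u v u' v')
  then show ?case by (simp add: word_cong.append)
next
  case (cancel x b)
  then show ?case by (cases x) (auto intro: word_cong.cancel word_cong.refl)
next
  case (relation u v)
  then show ?case
    by cases (auto intro: word_cong.refl word_cong.relation[OF fb_rels.ss, simplified]
        word_cong.relation[OF fb_rels.sss, simplified])
qed (auto intro: word_cong.sym word_cong.trans)

text \<open>The right action of words on colourings through their underlying permutations.\<close>

fun recolour :: "(nat \<Rightarrow> nat) \<Rightarrow> fb_gen gword \<Rightarrow> nat \<Rightarrow> nat" where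
  "recolour J [] = J"
| "recolour J ((Sigma_gen i, b) # w) = recolour (J \<circ> adj i) w"
| "recolour J ((T_gen i, b) # w) = recolour J w"

lemma recolour_append: "recolour J (u @ v) = recolour (recolour J u) v"
  by (induction u arbitrary: J rule: unframe.induct) simp_all

lemma adj_braid:
  assumes "\<bar>int i - int j\<bar> = 1"
  shows "J \<circ> adj i \<circ> adj j \<circ> adj i = J \<circ> adj j \<circ> adj i \<circ> adj j"
proof -
  have "j = i + 1 \<or> i = j + 1" using assms by auto
  then show ?thesis by (auto simp: fun_eq_iff Transposition.transpose_def)
qed

lemma adj_far:
  assumes "\<bar>int i - int j\<bar> > 1"
  shows "J \<circ> adj i \<circ> adj j = J \<circ> adj j \<circ> adj i"
  using assms by (auto simp: fun_eq_iff Transposition.transpose_def)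

locale framed_braid =
  fixes d n :: nat and \<zeta> :: "'k::field"
  assumes d_invertible: "of_nat d \<noteq> (0 :: 'k)"
    and root: "primitive_root_of_unity d \<zeta>"
begin

abbreviation "G \<equiv> framed_braid_group d n"
abbreviation A :: "('k, fb_gen gword set \<Rightarrow> 'k) module" where "A \<equiv> fb_algebra d n"
abbreviation group_mult (infixl \<open>\<cdot>\<close> 70) where "x \<cdot> y \<equiv> x \<otimes>\<^bsub>G\<^esub> y"
abbreviation algebra_mult (infixl \<open>\<star>\<close> 70) where "x \<star> y \<equiv> x \<otimes>\<^bsub>A\<^esub> y"
abbreviation "words \<equiv> lists (fb_gens n \<times> (UNIV :: bool set))"
abbreviation "cl \<equiv> fb_cl d n"
abbreviation "t \<equiv> fb_t d n"
abbreviation "s \<equiv> fb_s d n"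
abbreviation "B \<equiv> braid_subgroup d n"

sublocale G: group G by (rule fb_group)
sublocale A: ring A unfolding fb_algebra_def by (rule monoid_algebra_ring) (rule G.is_monoid)

text \<open>The eigenvalue of \<open>t\<^sub>i\<close> on a strand of colour \<open>c\<close>. Colours start at \<open>1\<close>, which has eigenvalue \<open>1\<close>.\<close>

definition weight :: "nat \<Rightarrow> 'k" where "weight c = \<zeta> powi (int c - 1)"

lemma d_pos: "d > 0" using d_invertible by (cases d) auto

lemma root_pow: "\<zeta> ^ d = 1" using root by (simp add: primitive_root_of_unity_def)

lemma root_nonzero: "\<zeta> \<noteq> 0" using root_pow d_pos by (auto simp: power_0_left)

lemma weight_nonzero [simp]: "weight c \<noteq> 0"
  by (simp add: weight_def root_nonzero)

lemma weight_pow: "weight c ^ d = 1"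
proof -
  have "weight c ^ d = (\<zeta> powi int d) powi (int c - 1)"
    unfolding weight_def by (metis power_int_mult power_int_of_nat mult.commute)
  then show ?thesis by (simp add: root_pow)
qed

lemma weight_eq: "c \<ge> 1 \<Longrightarrow> weight c = \<zeta> ^ (c - 1)"
proof -
  assume "c \<ge> 1"
  then have "int c - 1 = int (c - 1)" by simp
  then show ?thesis unfolding weight_def by (simp only: power_int_of_nat)
qed

lemma weight_inj:
  assumes "a \<in> {1..d}" "b \<in> {1..d}" "weight a = weight b" shows "a = b"
proof -
  have less: False if "a < b" "a \<in> {1..d}" "b \<in> {1..d}" "weight a = weight b" for a b
  proof -
    have "b - 1 = (a - 1) + (b - a)" using that by auto
    then have "\<zeta> ^ (a - 1) * \<zeta> ^ (b - a) = \<zeta> ^ (a - 1)"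
      using that by (metis atLeastAtMost_iff power_add weight_eq)
    then have "\<zeta> ^ (b - a) = 1" using root_nonzero by simp
    then show False using root that by (auto simp: primitive_root_of_unity_def)
  qed
  show ?thesis using less[of a b] less[of b a] assms by (cases a b rule: linorder_cases) auto
qed

lemma sum_powers:
  fixes q :: 'k
  assumes "q ^ d = 1"
  shows "(\<Sum>l\<in>{1..d}. q ^ l) = (if q = 1 then of_nat d else 0)"
proof -
  have "(\<Sum>l\<in>{1..d}. q ^ l) = q * (\<Sum>l<d. q ^ l)"
    by (simp add: sum.atLeast1_atMost_eq sum_distrib_left)
  then show ?thesis using assms by (simp add: geometric_sum)
qed

lemma sum_weights:
  assumes "a \<in> {1..d}" "b \<in> {1..d}"
  shows "(\<Sum>l\<in>{1..d}. weight a ^ l * inverse (weight b ^ l)) = (if a = b then of_nat d else 0)"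
proof -
  have "(\<Sum>l\<in>{1..d}. weight a ^ l * inverse (weight b ^ l)) = (\<Sum>l\<in>{1..d}. (weight a * inverse (weight b)) ^ l)"
    by (simp add: power_mult_distrib power_inverse)
  also have "\<dots> = (if weight a * inverse (weight b) = 1 then of_nat d else 0)"
    by (rule sum_powers) (simp add: power_mult_distrib power_inverse weight_pow)
  also have "weight a * inverse (weight b) = 1 \<longleftrightarrow> a = b"
    using weight_inj[OF assms] by (auto simp: field_simps)
  finally show ?thesis .
qed

text \<open>The nonzero entry in row \<open>J\<close> of the monomial matrix by which a word acts on colourings.\<close>

fun scalar :: "(nat \<Rightarrow> nat) \<Rightarrow> fb_gen gword \<Rightarrow> 'k" where
  "scalar J [] = 1"
| "scalar J ((Sigma_gen i, b) # w) = scalar (J \<circ> adj i) w"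
| "scalar J ((T_gen i, b) # w) = (if b then weight (J i) else inverse (weight (J i))) * scalar J w"

lemma scalar_append: "scalar J (u @ v) = scalar J u * scalar (recolour J u) v"
  by (induction u arbitrary: J rule: unframe.induct) simp_all

lemma scalar_unframe [simp]: "scalar J (unframe w) = 1"
  by (induction w arbitrary: J rule: unframe.induct) simp_all

lemma scalar_replicate: "scalar J (replicate k (T_gen i, True)) = weight (J i) ^ k"
  by (induction k) auto

lemma recolour_replicate [simp]: "recolour J (replicate k (T_gen i, b)) = J"
  by (induction k) auto

lemma scalar_cong:
  "(u, v) \<in> word_cong (fb_gens n) (fb_rels d n) \<Longrightarrow>
    (\<forall>J. scalar J u = scalar J v \<and> recolour J u = recolour J v)"
proof (induction rule: word_cong.induct)
  case (append u v u' v')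
  then show ?case by (simp add: scalar_append recolour_append)
next
  case (cancel x b)
  have "J \<circ> adj i \<circ> adj i = J" for J :: "nat \<Rightarrow> nat" and i by (auto simp: fun_eq_iff)
  then show ?case by (cases x) (auto simp del: Suc_eq_plus1)
next
  case (relation u v)
  then show ?case
  proof cases
    case (ss i j)
    show ?thesis unfolding ss(1,2)
      by (simp only: append.simps scalar.simps recolour.simps adj_far[OF ss(5)] simp_thms)
  next
    case (sss i j)
    show ?thesis unfolding sss(1,2)
      by (simp only: append.simps scalar.simps recolour.simps adj_braid[OF sss(5)] simp_thms)
  qed (auto simp: scalar_replicate weight_pow)
qed auto

definition unframed :: "fb_gen gword set \<Rightarrow> fb_gen gword set" where
  "unframed C = cl (unframe (FB.rep C))"

text \<open>The coordinate functional at the colouring \<open>J\<close>. It remembers the braid part of a group element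
through an arbitrary function \<open>H\<close>; taking \<open>H\<close> to be the indicator of a braid \<open>\<sigma>\<close> gives the
coefficient of \<open>E\<^sub>J \<sigma>\<close>.\<close>

definition character :: "(nat \<Rightarrow> nat) \<Rightarrow> (fb_gen gword set \<Rightarrow> 'k) \<Rightarrow> fb_gen gword set \<Rightarrow> 'k" where
  "character J H C = scalar J (FB.rep C) * H (unframed C)"

lemma rep_cl: "w \<in> words \<Longrightarrow> (FB.rep (cl w), w) \<in> word_cong (fb_gens n) (fb_rels d n)"
  by (rule FB.rep_cl)

lemma unframed_cl: "w \<in> words \<Longrightarrow> unframed (cl w) = cl (unframe w)"
  unfolding unframed_def by (intro FB.cl_eqI unframe_cong rep_cl)

lemma character_cl: "w \<in> words \<Longrightarrow> character J H (cl w) = scalar J w * H (cl (unframe w))"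
  using scalar_cong[OF rep_cl] by (simp add: character_def unframed_cl)

lemma carrier_cl: "x \<in> carrier G \<Longrightarrow> \<exists>w\<in>words. x = cl w"
  by (auto simp: fb_carrier)

lemma t_cl: "t i = cl [(T_gen i, True)]"
  by (simp add: fb_t_def group_gen_def FB.cl_def)

lemma s_cl: "s i = cl [(Sigma_gen i, True)]"
  by (simp add: fb_s_def group_gen_def FB.cl_def)

lemma inv_t_cl: "i \<in> {1..n} \<Longrightarrow> inv\<^bsub>G\<^esub> (t i) = cl [(T_gen i, False)]"
  using fb_inv_letter[of "T_gen i" n d True] by (simp add: t_cl)

lemma inv_s_cl: "i \<in> {1..<n} \<Longrightarrow> inv\<^bsub>G\<^esub> (s i) = cl [(Sigma_gen i, False)]"
  using fb_inv_letter[of "Sigma_gen i" n d True] by (simp add: s_cl)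

lemma t_closed [simp]: "i \<in> {1..n} \<Longrightarrow> t i \<in> carrier G"
  unfolding t_cl by (rule fb_cl_closed) auto

lemma s_closed [simp]: "i \<in> {1..<n} \<Longrightarrow> s i \<in> carrier G"
  unfolding s_cl by (rule fb_cl_closed) auto

lemma t_pow: "i \<in> {1..n} \<Longrightarrow> t i [^]\<^bsub>G\<^esub> d = \<one>\<^bsub>G\<^esub>"
proof -
  assume i: "i \<in> {1..n}"
  have "t i [^]\<^bsub>G\<^esub> k = cl (replicate k (T_gen i, True))" for k
  proof (induction k)
    case (Suc k)
    have w: "replicate k (T_gen i, True) \<in> words" "[(T_gen i, True)] \<in> words" using i by auto
    from Suc show ?case
      by (simp add: t_cl fb_mult_cl[OF w] replicate_append_same)
  qed (simp add: fb_one)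
  then show ?thesis
    using FB.cl_eqI[OF word_cong.relation[OF fb_rels.t_pow[OF i, of d]]] by (simp add: fb_one)
qed

lemma t_commute:
  assumes "i \<in> {1..n}" "j \<in> {1..n}" shows "t i \<cdot> t j = t j \<cdot> t i"
proof -
  have "[(T_gen i, True)] \<in> words" "[(T_gen j, True)] \<in> words" using assms by auto
  then show ?thesis
    using FB.cl_eqI[OF word_cong.relation[OF fb_rels.tt[OF assms, of d]]]
    by (simp add: t_cl fb_mult_cl del: in_lists_conv_set)
qed

lemma s_t:
  assumes "i \<in> {1..<n}" "j \<in> {1..n}" shows "s i \<cdot> t j = t (adj i j) \<cdot> s i"
proof -
  have "adj i j \<in> {1..n}" using assms adj_mem by blast
  then have "[(Sigma_gen i, True)] \<in> words" "[(T_gen j, True)] \<in> words" "[(T_gen (adj i j), True)] \<in> words"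
    using assms by auto
  then show ?thesis
    using FB.cl_eqI[OF word_cong.relation[OF fb_rels.st[OF assms, of d]]]
    by (simp add: t_cl s_cl fb_mult_cl del: in_lists_conv_set)
qed

lemma character_t:
  assumes "i \<in> {1..n}" "y \<in> carrier G"
  shows "character J H (t i \<cdot> y) = weight (J i) * character J H y"
proof -
  obtain w where w: "w \<in> words" "y = cl w" using carrier_cl[OF assms(2)] by blast
  have t: "[(T_gen i, True)] \<in> words" using assms by simp
  then have "[(T_gen i, True)] @ w \<in> words" using w by (simp del: in_lists_conv_set)
  then show ?thesis
    unfolding w(2) t_cl fb_mult_cl[OF t w(1)] by (simp add: character_cl w(1) del: in_lists_conv_set)
qed

lemma character_s:
  assumes "i \<in> {1..<n}" "y \<in> carrier G"
  shows "character J H (s i \<cdot> y) = character (J \<circ> adj i) (\<lambda>b. H (s i \<cdot> b)) y"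
    and "character J H (inv\<^bsub>G\<^esub> (s i) \<cdot> y) =
      character (J \<circ> adj i) (\<lambda>b. H (inv\<^bsub>G\<^esub> (s i) \<cdot> b)) y"
proof -
  obtain w where w: "w \<in> words" "y = cl w" using carrier_cl[OF assms(2)] by blast
  note uw = unframe_words[OF w(1)]
  have *: "character J H (cl [(Sigma_gen i, b)] \<cdot> y) =
      character (J \<circ> adj i) (\<lambda>x. H (cl [(Sigma_gen i, b)] \<cdot> x)) y" for b
  proof -
    have s: "[(Sigma_gen i, b)] \<in> words" using assms by simp
    then have "[(Sigma_gen i, b)] @ w \<in> words" using w by (simp del: in_lists_conv_set)
    then show ?thesis
      unfolding w(2) fb_mult_cl[OF s w(1)]
      by (simp add: character_cl w(1) fb_mult_cl[OF s uw] del: in_lists_conv_set)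
  qed
  show "character J H (s i \<cdot> y) = character (J \<circ> adj i) (\<lambda>b. H (s i \<cdot> b)) y"
    using *[of True] by (simp add: s_cl)
  show "character J H (inv\<^bsub>G\<^esub> (s i) \<cdot> y) =
      character (J \<circ> adj i) (\<lambda>b. H (inv\<^bsub>G\<^esub> (s i) \<cdot> b)) y"
    using *[of False] assms(1) by (simp only: inv_s_cl)
qed

lemma character_t_pow:
  assumes "i \<in> {1..n}" "y \<in> carrier G"
  shows "character J H (t i [^]\<^bsub>G\<^esub> (k::nat) \<cdot> y) = weight (J i) ^ k * character J H y"
  using assms(2)
proof (induction k arbitrary: y)
  case (Suc k)
  then show ?case using assms(1) by (simp add: G.m_assoc character_t mult_ac)
qed simp

lemma character_inv_t_pow:
  assumes "i \<in> {1..n}" "y \<in> carrier G"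
  shows "character J H (inv\<^bsub>G\<^esub> (t i [^]\<^bsub>G\<^esub> (k::nat)) \<cdot> y) = inverse (weight (J i) ^ k) * character J H y"
proof -
  let ?x = "t i [^]\<^bsub>G\<^esub> k"
  have "character J H (?x \<cdot> (inv\<^bsub>G\<^esub> ?x \<cdot> y)) =
      weight (J i) ^ k * character J H (inv\<^bsub>G\<^esub> ?x \<cdot> y)"
    using assms by (intro character_t_pow) auto
  moreover have "?x \<cdot> (inv\<^bsub>G\<^esub> ?x \<cdot> y) = y"
    using assms by (simp add: G.inv_solve_left' flip: G.m_assoc)
  ultimately show ?thesis by (simp add: field_simps)
qed

lemma braid_subgroup_eq: "B = unframed ` carrier G"
proof
  show "B \<subseteq> unframed ` carrier G"
  proof
    fix x assume "x \<in> B"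
    then have "x \<in> generate G (s ` {1..<n})" by (simp add: braid_subgroup_def)
    then have "\<exists>w\<in>words. unframe w = w \<and> x = cl w"
    proof (induction rule: generate.induct)
      case one
      show ?case by (intro bexI[of _ "[]"]) (auto simp: fb_one)
    next
      case (incl h)
      then obtain i where "i \<in> {1..<n}" "h = s i" by blast
      then show ?case by (intro bexI[of _ "[(Sigma_gen i, True)]"]) (auto simp: s_cl)
    next
      case (inv h)
      then obtain i where "i \<in> {1..<n}" "h = s i" by blast
      then show ?case by (intro bexI[of _ "[(Sigma_gen i, False)]"]) (auto simp: inv_s_cl)
    next
      case (eng h1 h2)
      then obtain u v where "u \<in> words" "unframe u = u" "h1 = cl u" "v \<in> words" "unframe v = v" "h2 = cl v"
        by blast
      then show ?case by (intro bexI[of _ "u @ v"]) (simp_all add: fb_mult_cl del: in_lists_conv_set)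
    qed
    then show "x \<in> unframed ` carrier G"
      by (metis fb_cl_closed imageI unframed_cl)
  qed
  show "unframed ` carrier G \<subseteq> B"
  proof clarify
    fix x assume "x \<in> carrier G"
    then obtain w where w: "w \<in> words" "x = cl w" using carrier_cl by blast
    have "cl (unframe w) \<in> generate G (s ` {1..<n})" using w(1)
    proof (induction w rule: unframe.induct)
      case 1
      then show ?case using generate.one[of G] by (simp add: fb_one)
    next
      case (2 i b w)
      then have i: "i \<in> {1..<n}" and w: "w \<in> words" by auto
      have l: "[(Sigma_gen i, b)] \<in> words" using i by simp
      have "cl [(Sigma_gen i, b)] \<in> generate G (s ` {1..<n})"
        using generate.incl[of "s i" "s ` {1..<n}" G] generate.inv[of "s i" "s ` {1..<n}" G] i
        by (cases b) (auto simp: inv_s_cl simp flip: s_cl)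
      from generate.eng[OF this 2(1)[OF w]] show ?case
        by (simp add: fb_mult_cl[OF l unframe_words[OF w]])
    qed auto
    then show "unframed x \<in> B" using w by (simp add: unframed_cl braid_subgroup_def)
  qed
qed

lemma braid_words: "b \<in> B \<Longrightarrow> \<exists>w\<in>words. unframe w = w \<and> b = cl w"
proof -
  assume "b \<in> B"
  then obtain x where "x \<in> carrier G" "b = unframed x" by (auto simp: braid_subgroup_eq)
  then obtain w where "w \<in> words" "b = cl (unframe w)" using carrier_cl unframed_cl by metis
  then show ?thesis using unframe_words unframe_idem by blast
qed

lemma B_closed: "b \<in> B \<Longrightarrow> b \<in> carrier G"
  using braid_words fb_cl_closed by metis

lemma unframed_B: "x \<in> carrier G \<Longrightarrow> unframed x \<in> B"
  by (simp add: braid_subgroup_eq)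

lemma one_B: "\<one>\<^bsub>G\<^esub> \<in> B"
  unfolding braid_subgroup_def by (rule generate.one)

lemma character_B:
  assumes "b \<in> B" shows "character J H b = H b"
proof -
  obtain w where w: "w \<in> words" "unframe w = w" "b = cl w" using braid_words[OF assms] by blast
  then show ?thesis using character_cl[OF w(1), of J H] scalar_unframe[of J w] by simp
qed

lemma conj_inverse:
  assumes "a \<in> carrier G" "b \<in> carrier G" "c \<in> carrier G" "a \<cdot> b = c \<cdot> a"
  shows "a \<cdot> inv\<^bsub>G\<^esub> b = inv\<^bsub>G\<^esub> c \<cdot> a" "inv\<^bsub>G\<^esub> a \<cdot> c = b \<cdot> inv\<^bsub>G\<^esub> a"
proof -
  have "c \<cdot> (a \<cdot> inv\<^bsub>G\<^esub> b) = a \<cdot> b \<cdot> inv\<^bsub>G\<^esub> b"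
    using assms by (simp only: G.m_assoc[symmetric] G.inv_closed)
  also have "\<dots> = a" using assms(1-3) by (simp add: G.m_assoc)
  finally show "a \<cdot> inv\<^bsub>G\<^esub> b = inv\<^bsub>G\<^esub> c \<cdot> a"
    using assms(1-3) G.inv_solve_left[of "a \<cdot> inv\<^bsub>G\<^esub> b" c a] by simp
  have "a \<cdot> (b \<cdot> inv\<^bsub>G\<^esub> a) = c \<cdot> a \<cdot> inv\<^bsub>G\<^esub> a"
    using assms by (simp only: G.m_assoc[symmetric] G.inv_closed)
  also have "\<dots> = c" using assms(1-3) by (simp add: G.m_assoc)
  finally show "inv\<^bsub>G\<^esub> a \<cdot> c = b \<cdot> inv\<^bsub>G\<^esub> a"
    using assms(1-3) G.inv_solve_left[of "b \<cdot> inv\<^bsub>G\<^esub> a" a c] by simp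
qed

text \<open>The relation \<open>s\<^sub>i t\<^sub>j = t\<^sub>k s\<^sub>i\<close>, where \<open>k\<close> is the image of \<open>j\<close>, holds for all signs of the two letters,
since it can be solved for the inverses.\<close>

lemma sigma_t_letters:
  assumes "i \<in> {1..<n}" "j \<in> {1..n}"
  shows "cl [(Sigma_gen i, b)] \<cdot> cl [(T_gen j, c)] = cl [(T_gen (adj i j), c)] \<cdot> cl [(Sigma_gen i, b)]"
proof -
  have j': "adj i j \<in> {1..n}" using assms adj_mem by blast
  have 1: "s i \<cdot> t j = t (adj i j) \<cdot> s i" by (rule s_t[OF assms])
  have 2: "s i \<cdot> t (adj i j) = t j \<cdot> s i" using s_t[OF assms(1) j'] by simp
  note c = s_closed[OF assms(1)] t_closed[OF assms(2)] t_closed[OF j']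
  have 3: "inv\<^bsub>G\<^esub> (s i) \<cdot> t j = t (adj i j) \<cdot> inv\<^bsub>G\<^esub> (s i)"
    by (rule conj_inverse(2)[OF c(1,3,2) 2])
  note 4 = conj_inverse(1)[OF c 1] conj_inverse(1)[OF G.inv_closed[OF c(1)] c(2,3) 3]
  show ?thesis
    using 1 3 4 inv_t_cl[OF assms(2)] inv_t_cl[OF j'] inv_s_cl[OF assms(1)]
    by (cases b; cases c) (simp_all add: t_cl s_cl)
qed

lemma sigma_past_framing:
  assumes i: "i \<in> {1..<n}" and u: "u \<in> words" "unframe u = []"
  shows "\<exists>v\<in>words. unframe v = [] \<and> cl [(Sigma_gen i, b)] \<cdot> cl u = cl v \<cdot> cl [(Sigma_gen i, b)]"
  using u
proof (induction u rule: unframe.induct)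
  case 1
  show ?case using i by (intro bexI[of _ "[]"]) (auto simp: fb_mult_cl)
next
  case (3 j c u)
  have j: "j \<in> {1..n}" "adj i j \<in> {1..n}" and u: "u \<in> words" "unframe u = []"
    using 3(2,3) adj_mem[OF i] by auto
  obtain v where v: "v \<in> words" "unframe v = []"
    "cl [(Sigma_gen i, b)] \<cdot> cl u = cl v \<cdot> cl [(Sigma_gen i, b)]"
    using 3(1)[OF u] by blast
  have w: "[(Sigma_gen i, b)] \<in> words" "[(T_gen j, c)] \<in> words" "[(T_gen (adj i j), c)] \<in> words"
    using i j by auto
  note c = fb_cl_closed[OF w(1), of d] fb_cl_closed[OF w(2), of d] fb_cl_closed[OF w(3), of d]
    fb_cl_closed[OF u(1), of d] fb_cl_closed[OF v(1), of d]
  have "cl [(Sigma_gen i, b)] \<cdot> cl ([(T_gen j, c)] @ u) =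
      (cl [(Sigma_gen i, b)] \<cdot> cl [(T_gen j, c)]) \<cdot> cl u"
    using c by (simp only: fb_mult_cl[OF w(2) u(1), symmetric] G.m_assoc)
  also have "\<dots> = cl [(T_gen (adj i j), c)] \<cdot> (cl [(Sigma_gen i, b)] \<cdot> cl u)"
    using c by (simp only: sigma_t_letters[OF i j(1)] G.m_assoc)
  also have "\<dots> = cl ([(T_gen (adj i j), c)] @ v) \<cdot> cl [(Sigma_gen i, b)]"
    using c by (simp only: v(3) fb_mult_cl[OF w(3) v(1), symmetric] G.m_assoc)
  finally show ?case using v w by (intro bexI[of _ "[(T_gen (adj i j), c)] @ v"]) auto
qed auto

text \<open>The framed braid group is the product of the framings with the braid group: framing letters move to
the left past every braid letter.\<close>

lemma framing_normal_form:
  assumes "x \<in> carrier G"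
  obtains u where "u \<in> words" "unframe u = []" "x = cl u \<cdot> unframed x"
proof -
  obtain w where w: "w \<in> words" "x = cl w" using carrier_cl[OF assms] by blast
  have "\<exists>u\<in>words. unframe u = [] \<and> cl w = cl u \<cdot> cl (unframe w)"
    using w(1)
  proof (induction w rule: unframe.induct)
    case 1
    show ?case by (intro bexI[of _ "[]"]) (auto simp: fb_mult_cl)
  next
    case (2 i b w)
    then have i: "i \<in> {1..<n}" and w: "w \<in> words" by auto
    have l: "[(Sigma_gen i, b)] \<in> words" using i by simp
    note uw = unframe_words[OF w]
    obtain u where u: "u \<in> words" "unframe u = []" "cl w = cl u \<cdot> cl (unframe w)"
      using 2(1)[OF w] by blast
    obtain v where v: "v \<in> words" "unframe v = []"
      "cl [(Sigma_gen i, b)] \<cdot> cl u = cl v \<cdot> cl [(Sigma_gen i, b)]"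
      using sigma_past_framing[OF i u(1,2)] by blast
    note c = fb_cl_closed[OF l, of d] fb_cl_closed[OF u(1), of d] fb_cl_closed[OF v(1), of d]
      fb_cl_closed[OF uw, of d]
    have "cl ([(Sigma_gen i, b)] @ w) = (cl [(Sigma_gen i, b)] \<cdot> cl u) \<cdot> cl (unframe w)"
      using c by (simp only: fb_mult_cl[OF l w, symmetric] u(3) G.m_assoc)
    also have "\<dots> = cl v \<cdot> cl ([(Sigma_gen i, b)] @ unframe w)"
      using c by (simp only: fb_mult_cl[OF l uw, symmetric] v(3) G.m_assoc)
    finally show ?case using v by auto
  next
    case (3 j c w)
    then have l: "[(T_gen j, c)] \<in> words" and w: "w \<in> words" by auto
    note uw = unframe_words[OF w]
    obtain u where u: "u \<in> words" "unframe u = []" "cl w = cl u \<cdot> cl (unframe w)"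
      using 3(1)[OF w] by blast
    note c = fb_cl_closed[OF l, of d] fb_cl_closed[OF u(1), of d] fb_cl_closed[OF uw, of d]
    have "cl ([(T_gen j, c)] @ w) = cl ([(T_gen j, c)] @ u) \<cdot> cl (unframe w)"
      using c by (simp only: fb_mult_cl[OF l w, symmetric] fb_mult_cl[OF l u(1), symmetric] u(3) G.m_assoc)
    then show ?case using u l by (intro bexI[of _ "[(T_gen j, c)] @ u"]) auto
  qed
  then obtain u where "u \<in> words" "unframe u = []" "cl w = cl u \<cdot> cl (unframe w)" by blast
  then show ?thesis using w(2) unframed_cl[OF w(1)] by (intro that[of u]) simp_all
qed

end

section \<open>The Fourier transform over the framings\<close>

context framed_braid
begin

lemma A_simps [simp]:
  "\<zero>\<^bsub>A\<^esub> = (\<lambda>z. 0)" "\<one>\<^bsub>A\<^esub> = basis_elt \<one>\<^bsub>G\<^esub>"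
  "x \<oplus>\<^bsub>A\<^esub> y = (\<lambda>z. x z + y z)" "c \<odot>\<^bsub>A\<^esub> x = (\<lambda>z. c * x z)"
  by (simp_all add: fb_algebra_def)

lemma A_finite: "x \<in> carrier A \<Longrightarrow> finite_support x"
  unfolding fb_algebra_def by (rule monoid_algebra_finite)

lemma A_basis [simp]: "g \<in> carrier G \<Longrightarrow> basis_elt g \<in> carrier A"
  by (simp add: fb_algebra_def)

lemma A_ext:
  "x \<in> carrier A \<Longrightarrow> y \<in> carrier A \<Longrightarrow> (\<And>h. pairing x h = pairing y h) \<Longrightarrow> x = y"
  unfolding fb_algebra_def by (rule monoid_algebra_ext)

lemma A_smult: "x \<in> carrier A \<Longrightarrow> (\<lambda>z. c * x z) \<in> carrier A"
  unfolding fb_algebra_def by (rule monoid_algebra_smult_closed)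

lemma A_sum: "finite S \<Longrightarrow> (\<And>a. a \<in> S \<Longrightarrow> F a \<in> carrier A) \<Longrightarrow> (\<lambda>z. \<Sum>a\<in>S. F a z) \<in> carrier A"
  unfolding fb_algebra_def by (rule monoid_algebra_sum_closed)

lemma A_finsum:
  "finite S \<Longrightarrow> (\<And>a. a \<in> S \<Longrightarrow> F a \<in> carrier A) \<Longrightarrow> (\<Oplus>\<^bsub>A\<^esub>a\<in>S. F a) = (\<lambda>z. \<Sum>a\<in>S. F a z)"
  unfolding fb_algebra_def by (rule monoid_algebra_finsum[OF G.is_monoid])

lemma A_cong: "x \<in> carrier A \<Longrightarrow> (\<And>g. g \<in> carrier G \<Longrightarrow> h g = h' g) \<Longrightarrow> pairing x h = pairing x h'"
  unfolding fb_algebra_def by (rule pairing_cong_carrier)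

lemma A_mult:
  assumes "x \<in> carrier A" "y \<in> carrier A"
  shows "pairing (x \<star> y) h = pairing x (\<lambda>u. pairing y (\<lambda>v. h (u \<cdot> v)))"
  using pairing_mult[of x y G h] assms[THEN A_finite] by (simp add: fb_algebra_def)

lemma A_smult_assoc:
  assumes "x \<in> carrier A" "y \<in> carrier A"
  shows "(c \<odot>\<^bsub>A\<^esub> x) \<star> y = c \<odot>\<^bsub>A\<^esub> (x \<star> y)" "x \<star> (c \<odot>\<^bsub>A\<^esub> y) = c \<odot>\<^bsub>A\<^esub> (x \<star> y)"
  using assms by (auto intro!: A_ext A_smult A.m_closed simp: A_mult A_smult pairing_smult_left pairing_smult_right)

text \<open>The factor of \<open>E\<^sub>I\<close> that belongs to a strand \<open>i\<close> of colour \<open>c\<close>.\<close>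

definition colour_idem :: "nat \<Rightarrow> nat \<Rightarrow> fb_gen gword set \<Rightarrow> 'k" where
  "colour_idem i c = (1 / of_nat d) \<odot>\<^bsub>A\<^esub> (\<Oplus>\<^bsub>A\<^esub>l\<in>{1..d}.
    (\<zeta> powi (- (int l * (int c - 1)))) \<odot>\<^bsub>A\<^esub> basis_elt (t i [^]\<^bsub>G\<^esub> l))"

lemma idem_factor_eq: "idem_factor d n \<zeta> I i = colour_idem i (part_pos d I i)"
  by (simp only: idem_factor_def colour_idem_def)

lemma weight_powi: "\<zeta> powi (- (int l * (int c - 1))) = inverse (weight c ^ l)"
  unfolding weight_def by (metis mult.commute power_int_minus power_int_mult power_int_of_nat)

lemma colour_idem_apply:
  assumes "i \<in> {1..n}"
  shows "colour_idem i c = (\<lambda>z. 1 / of_nat d * (\<Sum>l\<in>{1..d}. inverse (weight c ^ l) * basis_elt (t i [^]\<^bsub>G\<^esub> l) z))"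
  unfolding colour_idem_def
  using assms by (subst A_finsum) (auto simp: weight_powi intro!: A_smult)

lemma colour_idem_closed [simp]:
  assumes "i \<in> {1..n}" shows "colour_idem i c \<in> carrier A"
  unfolding colour_idem_apply[OF assms] using assms by (intro A_smult A_sum) auto

lemma pairing_colour_idem:
  assumes "i \<in> {1..n}"
  shows "pairing (colour_idem i c) h = 1 / of_nat d * (\<Sum>l\<in>{1..d}. inverse (weight c ^ l) * h (t i [^]\<^bsub>G\<^esub> l))"
proof -
  have "basis_elt (t i [^]\<^bsub>G\<^esub> (l::nat)) \<in> carrier A" for l using assms by simp
  then show ?thesis
    unfolding colour_idem_apply[OF assms] pairing_smult_left
    by (subst pairing_sum_left) (auto simp: pairing_smult_left intro!: A_finite A_smult)
qed

text \<open>Orthogonality of the characters of the cyclic group generated by \<open>t\<^sub>i\<close>.\<close>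

lemma character_colour_idem:
  assumes i: "i \<in> {1..n}" and c: "c \<in> {1..d}" "J i \<in> {1..d}" and x: "x \<in> carrier A"
  shows "pairing (colour_idem i c \<star> x) (character J H) =
    (if c = J i then pairing x (character J H) else 0)"
proof -
  have "pairing (colour_idem i c \<star> x) (character J H) =
      1 / of_nat d * (\<Sum>l\<in>{1..d}. inverse (weight c ^ l) *
        pairing x (\<lambda>v. character J H (t i [^]\<^bsub>G\<^esub> l \<cdot> v)))"
    by (simp only: A_mult[OF colour_idem_closed[OF i] x] pairing_colour_idem[OF i])
  also have "\<dots> = 1 / of_nat d * (\<Sum>l\<in>{1..d}. inverse (weight c ^ l) *
        (weight (J i) ^ l * pairing x (character J H)))"
    using A_cong[OF x character_t_pow[OF i]] by (simp only: pairing_smult_right)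
  also have "\<dots> = 1 / of_nat d * (\<Sum>l\<in>{1..d}. weight (J i) ^ l * inverse (weight c ^ l)) *
      pairing x (character J H)"
    by (simp add: sum_distrib_right sum_distrib_left mult_ac)
  also have "\<dots> = (if c = J i then pairing x (character J H) else 0)"
    using sum_weights[OF c(2,1)] d_invertible by auto
  finally show ?thesis .
qed

text \<open>Multiplication by \<open>t\<^sub>i\<close> shifts the summation index, and the sum over a full period is invariant under
the shift.\<close>

lemma t_colour_idem:
  assumes i: "i \<in> {1..n}"
  shows "basis_elt (t i) \<star> colour_idem i c = weight c \<odot>\<^bsub>A\<^esub> colour_idem i c"
proof (rule A_ext)
  have b: "basis_elt (t i) \<in> carrier A" using i by simp
  show "basis_elt (t i) \<star> colour_idem i c \<in> carrier A" using b i by simp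
  show "weight c \<odot>\<^bsub>A\<^esub> colour_idem i c \<in> carrier A" using A_smult[OF colour_idem_closed[OF i]] by simp
  fix h
  define g where "g l = inverse (weight c ^ l) * h (t i [^]\<^bsub>G\<^esub> l)" for l :: nat
  have "pairing (basis_elt (t i) \<star> colour_idem i c) h =
      1 / of_nat d * (\<Sum>l\<in>{1..d}. inverse (weight c ^ l) * h (t i \<cdot> t i [^]\<^bsub>G\<^esub> l))"
    by (simp only: A_mult[OF b colour_idem_closed[OF i]] pairing_basis pairing_colour_idem[OF i])
  also have "(\<Sum>l\<in>{1..d}. inverse (weight c ^ l) * h (t i \<cdot> t i [^]\<^bsub>G\<^esub> l)) = weight c * (\<Sum>l\<in>{1..d}. g (Suc l))"
    using i unfolding sum_distrib_left g_def G.nat_pow_Suc2[OF t_closed[OF i]]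
    by (intro sum.cong) auto
  also have "(\<Sum>l\<in>{1..d}. g (Suc l)) = (\<Sum>l\<in>{1..d}. g l)"
  proof -
    have "g (Suc d) = g 1" using i by (simp add: g_def t_pow weight_pow)
    moreover have "(\<Sum>l\<in>{1..k}. g (Suc l)) + g 1 = (\<Sum>l\<in>{1..k}. g l) + g (Suc k)" for k
      by (induction k) auto
    ultimately show ?thesis by (metis add_right_cancel)
  qed
  finally show "pairing (basis_elt (t i) \<star> colour_idem i c) h = pairing (weight c \<odot>\<^bsub>A\<^esub> colour_idem i c) h"
    by (simp add: pairing_smult_left pairing_colour_idem[OF i] g_def)
qed

lemma t_colour_idem_commute:
  assumes i: "i \<in> {1..n}" and j: "j \<in> {1..n}"
  shows "basis_elt (t j) \<star> colour_idem i c = colour_idem i c \<star> basis_elt (t j)"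
proof (rule A_ext)
  have b: "basis_elt (t j) \<in> carrier A" using j by simp
  note f = colour_idem_closed[OF i]
  show "basis_elt (t j) \<star> colour_idem i c \<in> carrier A" "colour_idem i c \<star> basis_elt (t j) \<in> carrier A"
    using b f by simp_all
  have tl: "t j \<cdot> t i [^]\<^bsub>G\<^esub> l = t i [^]\<^bsub>G\<^esub> l \<cdot> t j" for l :: nat
    by (rule G.group_commutes_pow[OF t_commute[OF i j] t_closed[OF i] t_closed[OF j], symmetric])
  show "pairing (basis_elt (t j) \<star> colour_idem i c) h = pairing (colour_idem i c \<star> basis_elt (t j)) h" for h
    by (simp only: A_mult[OF b f] A_mult[OF f b] pairing_basis pairing_colour_idem[OF i] tl)
qed

text \<open>For \<open>l\<close> between \<open>1\<close> and \<open>d\<close>, the sum of \<open>inverse (weight c ^ l)\<close> over all colours \<open>c\<close> vanishes unless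
\<open>l = d\<close>, and \<open>t\<^sub>i\<close> to the power \<open>d\<close> is the unit.\<close>

lemma sum_colour_idem:
  assumes i: "i \<in> {1..n}"
  shows "(\<Sum>c\<in>{1..d}. pairing (colour_idem i c) h) = h \<one>\<^bsub>G\<^esub>"
proof -
  have orth: "(\<Sum>c\<in>{1..d}. inverse (weight c ^ l)) = (if l = d then of_nat d else 0)" if "l \<in> {1..d}" for l
  proof -
    let ?q = "inverse (\<zeta> ^ l)"
    have q: "?q ^ d = 1" by (simp add: power_inverse power_mult[symmetric] mult.commute[of l] power_mult root_pow)
    have "(\<Sum>c\<in>{1..d}. inverse (weight c ^ l)) = (\<Sum>c\<in>{1..d}. \<zeta> ^ l * ?q ^ c)"
    proof (rule sum.cong[OF HOL.refl])
      fix c assume "c \<in> {1..d}"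
      then have c: "c \<ge> 1" by simp
      then have "c = Suc (c - 1)" by simp
      then have "?q ^ c = ?q * ?q ^ (c - 1)" by (metis power_Suc)
      then show "inverse (weight c ^ l) = \<zeta> ^ l * ?q ^ c"
        using root_nonzero c by (simp add: weight_eq power_inverse mult.commute flip: power_mult)
    qed
    also have "\<dots> = \<zeta> ^ l * (if ?q = 1 then of_nat d else 0)"
      by (simp only: sum_powers[OF q] flip: sum_distrib_left)
    also have "?q = 1 \<longleftrightarrow> l = d"
    proof
      assume "?q = 1"
      then have "\<zeta> ^ l = 1" by simp
      then have "\<not> (0 < l \<and> l < d)"
        using root unfolding primitive_root_of_unity_def by blast
      then show "l = d" using that by auto
    qed (simp add: root_pow)
    finally show ?thesis by (auto simp: root_pow)
  qed
  have "(\<Sum>c\<in>{1..d}. pairing (colour_idem i c) h) =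
      1 / of_nat d * (\<Sum>c\<in>{1..d}. \<Sum>l\<in>{1..d}. inverse (weight c ^ l) * h (t i [^]\<^bsub>G\<^esub> l))"
    by (simp only: pairing_colour_idem[OF i] sum_distrib_left)
  also have "\<dots> = 1 / of_nat d * (\<Sum>l\<in>{1..d}. (\<Sum>c\<in>{1..d}. inverse (weight c ^ l)) * h (t i [^]\<^bsub>G\<^esub> l))"
    by (subst sum.swap) (simp only: sum_distrib_right)
  also have "\<dots> = 1 / of_nat d * (\<Sum>l\<in>{1..d}. if l = d then of_nat d * h (t i [^]\<^bsub>G\<^esub> d) else 0)"
  proof (intro arg_cong[of _ _ "(*) _"] sum.cong HOL.refl)
    fix l assume l: "l \<in> {1..d}"
    show "(\<Sum>c\<in>{1..d}. inverse (weight c ^ l)) * h (t i [^]\<^bsub>G\<^esub> l) =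
        (if l = d then of_nat d * h (t i [^]\<^bsub>G\<^esub> d) else 0)"
      unfolding orth[OF l] by simp
  qed
  also have "\<dots> = h \<one>\<^bsub>G\<^esub>"
    using d_pos d_invertible i by (simp add: t_pow)
  finally show ?thesis .
qed

definition idem_list :: "nat list \<Rightarrow> (nat \<Rightarrow> nat) \<Rightarrow> fb_gen gword set \<Rightarrow> 'k" where
  "idem_list xs J = foldr (\<lambda>i x. colour_idem i (J i) \<star> x) xs \<one>\<^bsub>A\<^esub>"

definition idem :: "(nat \<Rightarrow> nat) \<Rightarrow> fb_gen gword set \<Rightarrow> 'k" where
  "idem = idem_list [1..<Suc n]"

lemma part_idem_eq: "part_idem d n \<zeta> I = idem (part_pos d I)"
  by (simp only: part_idem_def idem_def idem_list_def idem_factor_eq)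

lemma idem_list_simps:
  "idem_list [] J = \<one>\<^bsub>A\<^esub>"
  "idem_list (i # xs) J = colour_idem i (J i) \<star> idem_list xs J"
  by (simp_all add: idem_list_def)

lemma idem_list_closed: "set xs \<subseteq> {1..n} \<Longrightarrow> idem_list xs J \<in> carrier A"
  by (induction xs) (simp_all add: idem_list_simps del: A_simps(2) atLeastAtMost_iff)

lemma idem_list_cong: "(\<And>i. i \<in> set xs \<Longrightarrow> J i = J' i) \<Longrightarrow> idem_list xs J = idem_list xs J'"
  by (induction xs) (simp_all add: idem_list_simps)

lemma character_idem_list:
  assumes "set xs \<subseteq> {1..n}" "I ` {1..n} \<subseteq> {1..d}" "J ` {1..n} \<subseteq> {1..d}" "x \<in> carrier A"
  shows "pairing (idem_list xs I \<star> x) (character J H) =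
    (if \<forall>i\<in>set xs. I i = J i then pairing x (character J H) else 0)"
  using assms(1)
proof (induction xs)
  case Nil
  then show ?case using A.l_one[OF assms(4)] by (simp add: idem_list_simps)
next
  case (Cons i xs)
  then have i: "i \<in> {1..n}" and xs: "set xs \<subseteq> {1..n}" by auto
  have c: "I i \<in> {1..d}" "J i \<in> {1..d}" using assms(2,3) i by blast+
  have "idem_list (i # xs) I \<star> x = colour_idem i (I i) \<star> (idem_list xs I \<star> x)"
    using i xs assms(4) by (simp only: idem_list_simps A.m_assoc colour_idem_closed idem_list_closed)
  then show ?case
    using character_colour_idem[where J = J and c = "I i", OF i c] A.m_closed[OF idem_list_closed[OF xs] assms(4)] Cons.IH[OF xs]
    by simp
qed

lemma t_idem_list:
  assumes "set xs \<subseteq> {1..n}" "i \<in> set xs"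
  shows "basis_elt (t i) \<star> idem_list xs J = weight (J i) \<odot>\<^bsub>A\<^esub> idem_list xs J"
  using assms
proof (induction xs)
  case (Cons j xs)
  then have j: "j \<in> {1..n}" and xs: "set xs \<subseteq> {1..n}" and i: "i \<in> {1..n}" by auto
  have b: "basis_elt (t i) \<in> carrier A" using i by simp
  note f = colour_idem_closed[OF j] and e = idem_list_closed[OF xs]
  show ?case
  proof (cases "i = j")
    case True
    have "basis_elt (t i) \<star> idem_list (j # xs) J = (basis_elt (t i) \<star> colour_idem j (J j)) \<star> idem_list xs J"
      by (simp only: idem_list_simps A.m_assoc[OF b f e])
    also have "\<dots> = weight (J i) \<odot>\<^bsub>A\<^esub> idem_list (j # xs) J"
      unfolding True t_colour_idem[OF j] A_smult_assoc(1)[OF f e] idem_list_simps ..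
    finally show ?thesis .
  next
    case False
    then have "i \<in> set xs" using Cons.prems by simp
    have "basis_elt (t i) \<star> idem_list (j # xs) J = (basis_elt (t i) \<star> colour_idem j (J j)) \<star> idem_list xs J"
      by (simp only: idem_list_simps A.m_assoc[OF b f e])
    also have "\<dots> = colour_idem j (J j) \<star> (basis_elt (t i) \<star> idem_list xs J)"
      by (simp only: t_colour_idem_commute[OF j i] A.m_assoc[OF f b e])
    also have "\<dots> = weight (J i) \<odot>\<^bsub>A\<^esub> idem_list (j # xs) J"
      by (simp only: Cons.IH[OF xs \<open>i \<in> set xs\<close>] A_smult_assoc(2)[OF f e] idem_list_simps)
    finally show ?thesis .
  qed
qed simp

text \<open>The unit is the sum of the \<open>colour_idem i c\<close> over all colours, for each strand; expanding the product
of these sums gives one term for each colouring.\<close>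

lemma sum_idem_list:
  assumes "distinct xs" "set xs \<subseteq> {1..n}"
  shows "(\<Sum>J\<in>set xs \<rightarrow>\<^sub>E {1..d}. pairing (idem_list xs J) h) = h \<one>\<^bsub>G\<^esub>"
  using assms
proof (induction xs arbitrary: h)
  case Nil
  then show ?case by (simp add: idem_list_simps)
next
  case (Cons i xs)
  then have i: "i \<in> {1..n}" "i \<notin> set xs" and xs: "distinct xs" "set xs \<subseteq> {1..n}" by auto
  note f = colour_idem_closed[OF i(1)] and e = idem_list_closed[OF xs(2)]
  have "(\<Sum>J\<in>set (i # xs) \<rightarrow>\<^sub>E {1..d}. pairing (idem_list (i # xs) J) h) =
      (\<Sum>p\<in>{1..d} \<times> (set xs \<rightarrow>\<^sub>E {1..d}). pairing (idem_list (i # xs) ((snd p)(i := fst p))) h)"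
    unfolding list.set PiE_insert_eq
    by (subst sum.reindex[OF inj_combinator[OF i(2)]]) (simp add: case_prod_unfold)
  also have "\<dots> = (\<Sum>c\<in>{1..d}. \<Sum>J\<in>set xs \<rightarrow>\<^sub>E {1..d}. pairing (idem_list (i # xs) (J(i := c))) h)"
    by (simp add: sum.cartesian_product case_prod_unfold)
  also have "\<dots> = (\<Sum>c\<in>{1..d}. \<Sum>J\<in>set xs \<rightarrow>\<^sub>E {1..d}.
      pairing (colour_idem i c) (\<lambda>u. pairing (idem_list xs J) (\<lambda>v. h (u \<cdot> v))))"
  proof (intro sum.cong HOL.refl)
    fix c J
    have "idem_list xs (J(i := c)) = idem_list xs J" using i(2) by (intro idem_list_cong) auto
    then show "pairing (idem_list (i # xs) (J(i := c))) h =
        pairing (colour_idem i c) (\<lambda>u. pairing (idem_list xs J) (\<lambda>v. h (u \<cdot> v)))"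
      by (simp add: idem_list_simps A_mult[OF f e] del: A_simps)
  qed
  also have "\<dots> = (\<Sum>c\<in>{1..d}. pairing (colour_idem i c) (\<lambda>u. h (u \<cdot> \<one>\<^bsub>G\<^esub>)))"
    by (simp only: Cons.IH[OF xs] flip: pairing_sum_right)
  also have "\<dots> = h \<one>\<^bsub>G\<^esub>" using sum_colour_idem[OF i(1)] by simp
  finally show ?case .
qed

abbreviation colourings :: "(nat \<Rightarrow> nat) set" where
  "colourings \<equiv> {1..n} \<rightarrow>\<^sub>E {1..d}"

lemma finite_colourings [simp]: "finite colourings"
  by (intro finite_PiE) auto

lemma set_upt_n: "set [1..<Suc n] = {1..n}" by auto

lemma idem_closed [simp]: "idem J \<in> carrier A"
  unfolding idem_def by (rule idem_list_closed) auto

lemma idem_cong: "(\<And>i. i \<in> {1..n} \<Longrightarrow> J i = J' i) \<Longrightarrow> idem J = idem J'"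
  unfolding idem_def by (rule idem_list_cong) (simp only: set_upt_n)

lemma idem_basis_closed [simp]: "b \<in> carrier G \<Longrightarrow> idem J \<star> basis_elt b \<in> carrier A"
  by simp

lemma dual_basis:
  assumes "I ` {1..n} \<subseteq> {1..d}" "J ` {1..n} \<subseteq> {1..d}" "b \<in> B"
  shows "pairing (idem I \<star> basis_elt b) (character J H) = (if \<forall>i\<in>{1..n}. I i = J i then H b else 0)"
proof -
  have b: "basis_elt b \<in> carrier A" using B_closed[OF assms(3)] by simp
  show ?thesis
    using character_idem_list[of "[1..<Suc n]" I J "basis_elt b" H] assms b
    unfolding set_upt_n idem_def[symmetric] by (simp add: character_B)
qed

text \<open>The idempotents are simultaneous eigenvectors of the framings. For an inverse letter the eigenvalue
equation is multiplied by the inverse.\<close>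

lemma framing_idem:
  assumes "u \<in> words" "unframe u = []"
  shows "basis_elt (cl u) \<star> idem J = scalar J u \<odot>\<^bsub>A\<^esub> idem J"
  using assms
proof (induction u rule: unframe.induct)
  case 1
  have "basis_elt (cl []) \<star> idem J = idem J" using A.l_one[OF idem_closed] by (simp add: fb_one)
  then show ?case by simp
next
  case (3 i b u)
  then have i: "i \<in> {1..n}" and u: "u \<in> words" "unframe u = []" by auto
  have l: "[(T_gen i, b)] \<in> words" using i by simp
  let ?x = "basis_elt (cl [(T_gen i, b)])" and ?y = "basis_elt (cl u)"
  have x: "?x \<in> carrier A" and y: "?y \<in> carrier A"
    using fb_cl_closed[OF l] fb_cl_closed[OF u(1)] by simp_all
  have T: "basis_elt (t i) \<star> idem J = weight (J i) \<odot>\<^bsub>A\<^esub> idem J"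
    unfolding idem_def by (rule t_idem_list) (use i in auto)
  have letter: "?x \<star> idem J = (if b then weight (J i) else inverse (weight (J i))) \<odot>\<^bsub>A\<^esub> idem J"
  proof (cases b)
    case True
    then show ?thesis using T by (simp add: t_cl)
  next
    case False
    have ti: "basis_elt (t i) \<in> carrier A" using i by simp
    have "?x \<star> basis_elt (t i) = \<one>\<^bsub>A\<^esub>"
      using basis_elt_mult[OF G.is_monoid G.inv_closed[OF t_closed[OF i]] t_closed[OF i]] False
        G.l_inv[OF t_closed[OF i]]
      by (simp only: inv_t_cl[OF i] fb_algebra_def monoid_algebra_simps)
    then have "idem J = ?x \<star> (weight (J i) \<odot>\<^bsub>A\<^esub> idem J)"
      using A.m_assoc[OF x ti idem_closed, of J] A.l_one[OF idem_closed, of J] by (simp only: T)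
    then have "idem J = weight (J i) \<odot>\<^bsub>A\<^esub> (?x \<star> idem J)"
      by (simp only: A_smult_assoc(2)[OF x idem_closed])
    then have "idem J z = weight (J i) * (?x \<star> idem J) z" for z by (simp add: fun_eq_iff)
    then show ?thesis using False by (simp add: fun_eq_iff)
  qed
  have "basis_elt (cl ([(T_gen i, b)] @ u)) = ?x \<star> ?y"
    by (simp only: fb_algebra_def fb_mult_cl[OF l u(1)]
        basis_elt_mult[OF G.is_monoid fb_cl_closed[OF l] fb_cl_closed[OF u(1)]])
  then have "basis_elt (cl ([(T_gen i, b)] @ u)) \<star> idem J = ?x \<star> (scalar J u \<odot>\<^bsub>A\<^esub> idem J)"
    by (simp only: A.m_assoc[OF x y idem_closed] 3(1)[OF u])
  also have "\<dots> = scalar J u \<odot>\<^bsub>A\<^esub> (?x \<star> idem J)" by (rule A_smult_assoc(2)[OF x idem_closed])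
  finally show ?case unfolding letter by (simp add: mult_ac fun_eq_iff)
qed auto

text \<open>The elements \<open>E\<^sub>J \<sigma>\<close> span: the unit is the sum of all \<open>idem J\<close>, and on each of them the framing part of
\<open>g\<close> acts by a scalar, so that only its braid part is left.\<close>

lemma basis_expansion:
  assumes "g \<in> carrier G"
  shows "h g = (\<Sum>J\<in>colourings. character J (\<lambda>_. 1) g * pairing (idem J \<star> basis_elt (unframed g)) h)"
proof -
  obtain u where u: "u \<in> words" "unframe u = []" "g = cl u \<cdot> unframed g"
    using framing_normal_form[OF assms] by blast
  let ?b = "unframed g"
  have bB: "?b \<in> B" using assms by (rule unframed_B)
  then have b: "?b \<in> carrier G" by (rule B_closed)
  have cu: "cl u \<in> carrier G" using u(1) by (rule fb_cl_closed)
  have char: "character J (\<lambda>_. 1) g = scalar J u" for J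
  proof -
    obtain w where w: "w \<in> words" "unframe w = w" "?b = cl w" using braid_words[OF bB] by blast
    have "u @ w \<in> words" using u w by (simp del: in_lists_conv_set)
    then have "character J (\<lambda>_. 1) (cl u \<cdot> cl w) = scalar J u * scalar (recolour J u) (unframe w)"
      using u(1) w(1,2) by (simp add: fb_mult_cl character_cl scalar_append del: in_lists_conv_set scalar_unframe)
    moreover have "scalar (recolour J u) (unframe w) = 1" by (rule scalar_unframe)
    ultimately show ?thesis using u(3) w(3) by simp
  qed
  have "h g = (\<Sum>J\<in>colourings. pairing (idem J) (\<lambda>v. h (cl u \<cdot> (v \<cdot> ?b))))"
    using sum_idem_list[of "[1..<Suc n]" "\<lambda>v. h (cl u \<cdot> (v \<cdot> ?b))"] u(3) b
    unfolding set_upt_n idem_def[symmetric] by simp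
  also have "\<dots> = (\<Sum>J\<in>colourings. scalar J u * pairing (idem J \<star> basis_elt ?b) h)"
  proof (intro sum.cong HOL.refl)
    fix J
    have cuA: "basis_elt (cl u) \<in> carrier A" and bA: "basis_elt ?b \<in> carrier A" using cu b by simp_all
    have "pairing (idem J) (\<lambda>v. h (cl u \<cdot> (v \<cdot> ?b))) =
        pairing (basis_elt (cl u) \<star> (idem J \<star> basis_elt ?b)) h"
      using cuA bA by (simp add: A_mult)
    also have "\<dots> = pairing ((scalar J u \<odot>\<^bsub>A\<^esub> idem J) \<star> basis_elt ?b) h"
      using cuA bA by (simp only: framing_idem[OF u(1,2)] idem_closed flip: A.m_assoc)
    also have "\<dots> = scalar J u * pairing (idem J \<star> basis_elt ?b) h"
      using bA by (simp add: A_mult A_smult pairing_smult_left)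
    finally show "pairing (idem J) (\<lambda>v. h (cl u \<cdot> (v \<cdot> ?b))) = scalar J u * pairing (idem J \<star> basis_elt ?b) h" .
  qed
  finally show ?thesis by (simp only: char)
qed

lemma character_split: "character J H g = character J (\<lambda>_. 1) g * H (unframed g)"
  by (simp add: character_def)

lemma pairing_expansion:
  assumes "x \<in> carrier A"
  shows "pairing x h = (\<Sum>J\<in>colourings. pairing x (character J (\<lambda>b. pairing (idem J \<star> basis_elt b) h)))"
proof -
  have "pairing x h = pairing x (\<lambda>g. \<Sum>J\<in>colourings. character J (\<lambda>b. pairing (idem J \<star> basis_elt b) h) g)"
  proof (rule A_cong[OF assms])
    fix g assume "g \<in> carrier G"
    from basis_expansion[OF this, of h]
    show "h g = (\<Sum>J\<in>colourings. character J (\<lambda>b. pairing (idem J \<star> basis_elt b) h) g)"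
      by (simp add: character_def)
  qed
  then show ?thesis by (simp only: pairing_sum_right)
qed

lemma colourings_image: "J \<in> colourings \<Longrightarrow> J ` {1..n} \<subseteq> {1..d}"
  by auto

lemma character_ext:
  assumes "x \<in> carrier A" "y \<in> carrier A"
    and "\<And>J H. J ` {1..n} \<subseteq> {1..d} \<Longrightarrow> pairing x (character J H) = pairing y (character J H)"
  shows "x = y"
proof (rule A_ext[OF assms(1,2)])
  show "pairing x h = pairing y h" for h
    unfolding pairing_expansion[OF assms(1), of h] pairing_expansion[OF assms(2), of h]
    by (intro sum.cong HOL.refl assms(3) colourings_image)
qed

lemma scalar_colour_cong:
  assumes "w \<in> words" "\<And>i. i \<in> {1..n} \<Longrightarrow> J i = J' i"
  shows "scalar J w = scalar J' w"
  using assms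
proof (induction w arbitrary: J J' rule: unframe.induct)
  case (2 i b w)
  then have i: "i \<in> {1..<n}" and w: "w \<in> words" by auto
  have "(J \<circ> adj i) a = (J' \<circ> adj i) a" if "a \<in> {1..n}" for a
    using 2(3) adj_mem[OF i, of a] that by (simp del: atLeastAtMost_iff)
  from 2(1)[OF w this] show ?case by (simp only: scalar.simps)
next
  case (3 i b w)
  then have i: "i \<in> {1..n}" and w: "w \<in> words" by auto
  show ?case by (simp only: scalar.simps 3(3)[OF i] 3(1)[OF w 3(3)])
qed simp

lemma character_colour_cong:
  assumes "x \<in> carrier G" "\<And>i. i \<in> {1..n} \<Longrightarrow> J i = J' i"
  shows "character J H x = character J' H x"
proof -
  have "FB.rep x \<in> words" using FB.rep_cong(1)[of x n d] assms(1) by (simp add: framed_braid_group_def)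
  then have "scalar J (FB.rep x) = scalar J' (FB.rep x)" using assms(2) by (rule scalar_colour_cong)
  then show ?thesis by (simp add: character_def)
qed

end

section \<open>The action of the symmetric group on colours\<close>

lemma linear_maps_sum:
  assumes f: "f \<in> linear_maps (monoid_algebra M) (monoid_algebra N)"
    and S: "finite S" "\<And>a. a \<in> S \<Longrightarrow> F a \<in> carrier (monoid_algebra M)"
  shows "f (\<lambda>z. \<Sum>a\<in>S. c a * F a z) = (\<lambda>z. \<Sum>a\<in>S. c a * f (F a) z)"
proof -
  have smult: "f (\<lambda>z. c * x z) = (\<lambda>z. c * f x z)" if "x \<in> carrier (monoid_algebra M)" for c x
    using f that by (simp add: linear_maps_def)
  have add: "f (\<lambda>z. x z + y z) = (\<lambda>z. f x z + f y z)"
    if "x \<in> carrier (monoid_algebra M)" "y \<in> carrier (monoid_algebra M)" for x y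
    using f that by (simp add: linear_maps_def)
  show ?thesis
    using S
  proof (induction S rule: finite_induct)
    case empty
    show ?case using smult[OF monoid_algebra_zero_closed, of 0] by simp
  next
    case (insert a S)
    have "f (\<lambda>z. c a * F a z + (\<Sum>a\<in>S. c a * F a z)) =
        (\<lambda>z. f (\<lambda>z. c a * F a z) z + f (\<lambda>z. \<Sum>a\<in>S. c a * F a z) z)"
      using insert by (intro add monoid_algebra_smult_closed monoid_algebra_sum_closed) auto
    then show ?case using insert by (simp add: smult)
  qed
qed

lemma part_pos:
  assumes "I \<in> ordered_partitions d n" "j \<in> {1..n}"
  shows "part_pos d I j \<in> {1..d}" "j \<in> I (part_pos d I j)"
    and "a \<in> {1..d} \<Longrightarrow> j \<in> I a \<Longrightarrow> part_pos d I j = a"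
proof -
  have dis: "I a \<inter> I b = {}" if "a \<in> {1..d}" "b \<in> {1..d}" "a \<noteq> b" for a b
    using assms(1) that unfolding ordered_partitions_def disjoint_family_on_def by blast
  have "j \<in> (\<Union>a\<in>{1..d}. I a)" using assms unfolding ordered_partitions_def by blast
  then obtain a where a: "a \<in> {1..d}" "j \<in> I a" by blast
  have unique: "b = a" if "b \<in> {1..d} \<and> j \<in> I b" for b
    using dis[of a b] a that by blast
  have pos: "part_pos d I j = a"
    unfolding part_pos_def by (rule the_equality) (use a unique in auto)
  show "part_pos d I j \<in> {1..d}" "j \<in> I (part_pos d I j)" using a pos by simp_all
  show "part_pos d I j = b" if "b \<in> {1..d}" "j \<in> I b" for b using pos unique[OF conjI[OF that]] by simp
qed

lemma perm_part_ordered: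
  assumes I: "I \<in> ordered_partitions d n" and w: "w permutes {1..d}"
  shows "perm_part w I \<in> ordered_partitions d n"
    and "j \<in> {1..n} \<Longrightarrow> part_pos d (perm_part w I) j = w (part_pos d I j)"
proof -
  let ?v = "inv_into UNIV w"
  have v: "?v permutes {1..d}" using w by (rule permutes_inv)
  have vin: "?v a \<in> {1..d} \<longleftrightarrow> a \<in> {1..d}" for a by (rule permutes_in_image[OF v])
  have "(\<Union>a\<in>{1..d}. I (?v a)) = (\<Union>a\<in>?v ` {1..d}. I a)" by simp
  also have "\<dots> = {1..n}" unfolding permutes_image[OF v] using I by (simp add: ordered_partitions_def)
  finally have "(\<Union>a\<in>{1..d}. I (?v a)) = {1..n}" .
  moreover have "disjoint_family_on (\<lambda>a. I (?v a)) {1..d}"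
    unfolding disjoint_family_on_def
  proof (intro ballI impI)
    fix a b assume "a \<in> {1..d}" "b \<in> {1..d}" "a \<noteq> b"
    then have "?v a \<in> {1..d}" "?v b \<in> {1..d}" "?v a \<noteq> ?v b"
      using permutes_inj[OF v] by (simp_all only: vin inj_eq not_False_eq_True)
    then show "I (?v a) \<inter> I (?v b) = {}"
      using I unfolding ordered_partitions_def disjoint_family_on_def by blast
  qed
  moreover have "(\<lambda>a. I (?v a)) \<in> {1..d} \<rightarrow>\<^sub>E Pow {1..n}"
    using I vin unfolding ordered_partitions_def PiE_iff extensional_def by blast
  ultimately show P: "perm_part w I \<in> ordered_partitions d n"
    by (simp add: ordered_partitions_def perm_part_def)
  assume j: "j \<in> {1..n}"
  have "w (part_pos d I j) \<in> {1..d}"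
    using part_pos(1)[OF I j] by (simp only: permutes_in_image[OF w])
  moreover have "j \<in> perm_part w I (w (part_pos d I j))"
    using part_pos(2)[OF I j] by (simp add: perm_part_def permutes_inverses[OF w])
  ultimately show "part_pos d (perm_part w I) j = w (part_pos d I j)"
    by (rule part_pos(3)[OF P j])
qed

lemma ordered_partition_of_colouring:
  assumes "J ` {1..n} \<subseteq> {1..d}"
  obtains I where "I \<in> ordered_partitions d n" "\<And>j. j \<in> {1..n} \<Longrightarrow> part_pos d I j = J j"
proof -
  define I where "I = (\<lambda>a\<in>{1..d}. {j \<in> {1..n}. J j = a})"
  have I: "I \<in> ordered_partitions d n"
    using assms by (auto simp: ordered_partitions_def I_def disjoint_family_on_def)
  show ?thesis
  proof (rule that[OF I])
    fix j assume j: "j \<in> {1..n}"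
    then have "J j \<in> {1..d}" using assms by blast
    with j show "part_pos d I j = J j" by (intro part_pos(3)[OF I]) (auto simp: I_def)
  qed
qed

context framed_braid
begin

text \<open>The expansion of \<open>g\<close> in the basis \<open>E\<^sub>J \<sigma>\<close>, with the coefficient at \<open>J\<close> replaced by the one at \<open>v \<circ> J\<close>.\<close>

definition permuted :: "(nat \<Rightarrow> nat) \<Rightarrow> fb_gen gword set \<Rightarrow> fb_gen gword set \<Rightarrow> 'k" where
  "permuted v g = (\<lambda>z. \<Sum>J\<in>colourings.
    character (v \<circ> J) (\<lambda>_. 1) g * (idem J \<star> basis_elt (unframed g)) z)"

lemma permuted_closed: "g \<in> carrier G \<Longrightarrow> permuted v g \<in> carrier A"
  unfolding permuted_def
  by (intro A_sum A_smult idem_basis_closed finite_colourings B_closed[OF unframed_B])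

lemma character_permuted:
  assumes g: "g \<in> carrier G" and J: "J ` {1..n} \<subseteq> {1..d}"
  shows "pairing (permuted v g) (character J H) = character (v \<circ> J) H g"
proof -
  let ?J = "restrict J {1..n}"
  let ?c = "\<lambda>I. character (v \<circ> I) (\<lambda>_. 1) g"
  have b: "unframed g \<in> B" "unframed g \<in> carrier G"
    using unframed_B[OF g] B_closed by blast+
  have "pairing (permuted v g) (character J H) =
      (\<Sum>I\<in>colourings. ?c I * pairing (idem I \<star> basis_elt (unframed g)) (character J H))"
    unfolding permuted_def using b
    by (subst pairing_sum_left[OF finite_colourings]) (auto intro!: A_finite A_smult simp: pairing_smult_left)
  also have "\<dots> = (\<Sum>I\<in>colourings. if I = ?J then ?c I * H (unframed g) else 0)"
  proof (rule sum.cong[OF HOL.refl])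
    fix I assume I: "I \<in> colourings"
    have "(\<forall>i\<in>{1..n}. I i = J i) \<longleftrightarrow> I = ?J"
      using I by (auto simp: fun_eq_iff PiE_iff extensional_def)
    then show "?c I * pairing (idem I \<star> basis_elt (unframed g)) (character J H) =
        (if I = ?J then ?c I * H (unframed g) else 0)"
      using dual_basis[OF colourings_image[OF I] J b(1), of H] by simp
  qed
  also have "\<dots> = ?c ?J * H (unframed g)"
    using J by (subst sum.delta[OF finite_colourings]) auto
  also have "?c ?J = character (v \<circ> J) (\<lambda>_. 1) g"
    using g by (rule character_colour_cong) simp
  finally show ?thesis by (simp only: character_split[of "v \<circ> J" H g])
qed

lemma character_lin_permuted:
  assumes x: "x \<in> carrier A" and J: "J ` {1..n} \<subseteq> {1..d}"
  shows "pairing (lin_ext (permuted v) x) (character J H) = pairing x (character (v \<circ> J) H)"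
proof -
  have supp: "g \<in> carrier G" if "x g \<noteq> 0" for g
    using x that unfolding fb_algebra_def by (rule monoid_algebra_supp)
  have "pairing (lin_ext (permuted v) x) (character J H) = pairing x (\<lambda>g. pairing (permuted v g) (character J H))"
    by (rule pairing_lin_ext) (use x in \<open>auto intro: A_finite permuted_closed supp\<close>)
  also have "\<dots> = pairing x (character (v \<circ> J) H)"
    by (rule A_cong[OF x]) (rule character_permuted[OF _ J])
  finally show ?thesis .
qed

lemma lin_permuted_linear: "lin_ext (permuted v) \<in> linear_maps A A"
  unfolding fb_algebra_def by (rule lin_ext_linear) (use permuted_closed in \<open>simp add: fb_algebra_def\<close>)

lemma lin_permuted_closed: "x \<in> carrier A \<Longrightarrow> lin_ext (permuted v) x \<in> carrier A"
  using lin_permuted_linear[of v] by (simp add: linear_maps_def Pi_iff)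

text \<open>The operator on the right has the prescribed values on the \<open>E\<^sub>I \<sigma>\<close> by duality, and no other linear map
has them, because these elements span.\<close>

lemma perm_action_eq:
  assumes w: "w permutes {1..d}"
  shows "perm_action d n \<zeta> w = restrict (lin_ext (permuted (inv_into UNIV w))) (carrier A)"
proof -
  let ?v = "inv_into UNIV w"
  let ?F = "restrict (lin_ext (permuted ?v)) (carrier A)"
  have v: "?v permutes {1..d}" using w by (rule permutes_inv)
  have eb: "idem J \<star> basis_elt b \<in> carrier A" if "b \<in> B" for J b
    using B_closed[OF that] by simp
  have lin: "?F \<in> linear_maps A A"
    using lin_permuted_linear[of ?v] by (auto simp: linear_maps_def A_smult)
      (simp_all add: A.a_closed[simplified])
  have val: "?F (part_idem d n \<zeta> I \<star> basis_elt b) = part_idem d n \<zeta> (perm_part w I) \<star> basis_elt b"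
    if I: "I \<in> ordered_partitions d n" and b: "b \<in> B" for I b
  proof -
    let ?P = "part_pos d I" and ?Q = "part_pos d (perm_part w I)"
    have P: "?P ` {1..n} \<subseteq> {1..d}" using part_pos(1)[OF I] by blast
    have Q: "?Q ` {1..n} \<subseteq> {1..d}" using part_pos(1)[OF perm_part_ordered(1)[OF I w]] by blast
    have "lin_ext (permuted ?v) (idem ?P \<star> basis_elt b) = idem ?Q \<star> basis_elt b"
    proof (rule character_ext)
      fix J H assume J: "J ` {1..n} \<subseteq> {1..d}"
      have vJ: "(?v \<circ> J) ` {1..n} \<subseteq> {1..d}"
        using J permutes_in_image[OF v] by (auto simp del: atLeastAtMost_iff)
      have "?P i = (?v \<circ> J) i \<longleftrightarrow> ?Q i = J i" if "i \<in> {1..n}" for i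
        using permutes_inv_eq[OF w, of "J i" "?P i"] by (auto simp: perm_part_ordered(2)[OF I w that])
      then show "pairing (lin_ext (permuted ?v) (idem ?P \<star> basis_elt b)) (character J H) =
          pairing (idem ?Q \<star> basis_elt b) (character J H)"
        by (simp only: character_lin_permuted[OF eb[OF b] J] dual_basis[OF P vJ b] dual_basis[OF Q J b]
            cong: ball_cong)
    qed (use eb[OF b] in \<open>auto intro: lin_permuted_closed\<close>)
    then show ?thesis using eb[OF b] by (simp add: part_idem_eq)
  qed
  show ?thesis
    unfolding perm_action_def
  proof (rule the_equality)
    fix f assume f: "f \<in> linear_maps A A \<and> f \<in> extensional (carrier A) \<and>
      (\<forall>I\<in>ordered_partitions d n. \<forall>b\<in>B. f (part_idem d n \<zeta> I \<star> basis_elt b) =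
        part_idem d n \<zeta> (perm_part w I) \<star> basis_elt b)"
    have agree: "f (idem J \<star> basis_elt b) = ?F (idem J \<star> basis_elt b)"
      if J: "J \<in> colourings" and b: "b \<in> B" for J b
    proof -
      obtain I where I: "I \<in> ordered_partitions d n" "\<And>j. j \<in> {1..n} \<Longrightarrow> part_pos d I j = J j"
        using ordered_partition_of_colouring[OF colourings_image[OF J]] by blast
      have "part_idem d n \<zeta> I = idem J" unfolding part_idem_eq by (rule idem_cong) (rule I(2))
      then show ?thesis using val[OF I(1) b] f I(1) b by metis
    qed
    have "f (basis_elt g) = ?F (basis_elt g)" if g: "g \<in> carrier G" for g
    proof -
      let ?X = "\<lambda>J. idem J \<star> basis_elt (unframed g)"
      let ?c = "\<lambda>J. character J (\<lambda>_. 1) g"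
      have X: "?X J \<in> carrier A" for J by (rule eb[OF unframed_B[OF g]])
      have eq: "basis_elt g = (\<lambda>z. \<Sum>J\<in>colourings. ?c J * ?X J z)"
      proof (rule A_ext)
        show "basis_elt g \<in> carrier A" using g by simp
        show "(\<lambda>z. \<Sum>J\<in>colourings. ?c J * ?X J z) \<in> carrier A"
          using X by (intro A_sum A_smult finite_colourings)
        show "pairing (basis_elt g) h = pairing (\<lambda>z. \<Sum>J\<in>colourings. ?c J * ?X J z) h" for h
          using basis_expansion[OF g, of h] X
          by (subst pairing_sum_left[OF finite_colourings]) (auto intro!: A_finite A_smult simp: pairing_smult_left)
      qed
      have sum: "f' (\<lambda>z. \<Sum>J\<in>colourings. ?c J * ?X J z) = (\<lambda>z. \<Sum>J\<in>colourings. ?c J * f' (?X J) z)"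
        if "f' \<in> linear_maps A A" for f'
        by (rule linear_maps_sum[OF that[unfolded fb_algebra_def] finite_colourings])
          (use X in \<open>simp add: fb_algebra_def\<close>)
      show ?thesis
        unfolding eq sum[OF lin] sum[OF conjunct1[OF f]]
        using agree[OF _ unframed_B[OF g]] by (intro ext sum.cong HOL.refl) (simp only:)
    qed
    then have "f x = ?F x" if "x \<in> carrier A" for x
      using linear_maps_agree[OF G.is_monoid conjunct1[OF f, unfolded fb_algebra_def] lin[unfolded fb_algebra_def]]
        that by (simp add: fb_algebra_def)
    moreover have "f x = ?F x" if "x \<notin> carrier A" for x
      using f that by (simp add: extensional_def)
    ultimately show "f = ?F" by blast
  qed (use lin val in auto)
qed

lemma fixed_iff:
  "x \<in> carrier (fixed_algebra d n \<zeta>) \<longleftrightarrow> x \<in> carrier A \<and>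
    (\<forall>v. v permutes {1..d} \<longrightarrow> (\<forall>J H. J ` {1..n} \<subseteq> {1..d} \<longrightarrow>
      pairing x (character (v \<circ> J) H) = pairing x (character J H)))"
proof (cases "x \<in> carrier A")
  case True
  have "perm_action d n \<zeta> w x = x \<longleftrightarrow> (\<forall>J H. J ` {1..n} \<subseteq> {1..d} \<longrightarrow>
      pairing x (character (inv_into UNIV w \<circ> J) H) = pairing x (character J H))"
    if w: "w permutes {1..d}" for w
    using True character_ext[OF lin_permuted_closed[OF True] True, of "inv_into UNIV w"]
      character_lin_permuted[OF True, of _ "inv_into UNIV w"]
    by (simp add: perm_action_eq[OF w]) metis
  moreover have "(\<forall>w. w permutes {1..d} \<longrightarrow> P (inv_into UNIV w)) \<longleftrightarrow> (\<forall>v. v permutes {1..d} \<longrightarrow> P v)" for P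
    using permutes_inv permutes_inv_inv by metis
  ultimately show ?thesis using True by (simp add: fixed_algebra_def)
qed (simp add: fixed_algebra_def)

end

section \<open>Evaluation of tied braid words\<close>

lemma tb_rels_words: "tb_rels n \<subseteq> lists (tb_gens n) \<times> lists (tb_gens n)"
proof (rule subrelI)
  fix u v assume "(u, v) \<in> tb_rels n"
  then show "(u, v) \<in> lists (tb_gens n) \<times> lists (tb_gens n)"
    by cases (auto simp: tb_gens_def)
qed

lemma tb_gens_iff [simp]:
  "TS i \<in> tb_gens n \<longleftrightarrow> i \<in> {1..<n}" "TSinv i \<in> tb_gens n \<longleftrightarrow> i \<in> {1..<n}"
  "TE i \<in> tb_gens n \<longleftrightarrow> i \<in> {1..<n}"
  by (auto simp: tb_gens_def)

lemma tb_words_induct [consumes 1, case_names Nil TS TSinv TE]: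
  assumes "w \<in> lists (tb_gens n)" and "P []"
    and "\<And>i w. i \<in> {1..<n} \<Longrightarrow> w \<in> lists (tb_gens n) \<Longrightarrow> P w \<Longrightarrow> P (TS i # w)"
    and "\<And>i w. i \<in> {1..<n} \<Longrightarrow> w \<in> lists (tb_gens n) \<Longrightarrow> P w \<Longrightarrow> P (TSinv i # w)"
    and "\<And>i w. i \<in> {1..<n} \<Longrightarrow> w \<in> lists (tb_gens n) \<Longrightarrow> P w \<Longrightarrow> P (TE i # w)"
  shows "P w"
  using assms(1)
proof (induction w)
  case (Cons g w)
  then have w: "w \<in> lists (tb_gens n)" "P w" and g: "g \<in> tb_gens n" by auto
  show ?case using g w assms(3-5) by (cases g) auto
qed (rule assms(2))

fun braid_word :: "tb_gen list \<Rightarrow> fb_gen gword" where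
  "braid_word [] = []"
| "braid_word (TE i # w) = braid_word w"
| "braid_word (TS i # w) = (Sigma_gen i, True) # braid_word w"
| "braid_word (TSinv i # w) = (Sigma_gen i, False) # braid_word w"

lemma braid_word_words: "w \<in> lists (tb_gens n) \<Longrightarrow> braid_word w \<in> lists (fb_gens n \<times> UNIV)"
  by (induction rule: tb_words_induct) auto

lemma unframe_braid_word [simp]: "unframe (braid_word w) = braid_word w"
  by (induction w rule: braid_word.induct) auto

lemma braid_word_append [simp]: "braid_word (u @ v) = braid_word u @ braid_word v"
  by (induction u rule: braid_word.induct) auto

text \<open>The defining relations of the tied braid algebra hold for the action on colourings, whatever word
\<open>q\<close> follows.\<close>

lemma compatible_relation:
  assumes "(u, v) \<in> tb_rels n"
  shows "compatible (u @ q) J \<longleftrightarrow> compatible (v @ q) J"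
proof -
  have near: "j = i + 1 \<or> i = j + 1" if "\<bar>int i - int j\<bar> = 1" for i j :: nat using that by auto
  have adj2: "K \<circ> adj i \<circ> adj i = K" for K :: "nat \<Rightarrow> nat" and i by (auto simp: fun_eq_iff)
  from assms show ?thesis
  proof cases
    case (inv_right i)
    then show ?thesis by (simp only: append.simps compatible.simps adj2)
  next
    case (inv_left i)
    then show ?thesis by (simp only: append.simps compatible.simps adj2)
  next
    case (ss i j)
    show ?thesis unfolding ss(1,2)
      by (simp only: append.simps compatible.simps adj_far[OF ss(5)])
  next
    case (sss i j)
    show ?thesis unfolding sss(1,2)
      by (simp only: append.simps compatible.simps adj_braid[OF sss(5)])
  next
    case (sE_far i j)
    then show ?thesis by (auto simp: Transposition.transpose_def)
  next
    case (Ess i j)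
    with near[of i j] show ?thesis by (auto simp: Transposition.transpose_def)
  next
    case (Ess_inv i j)
    with near[of i j] show ?thesis by (auto simp: Transposition.transpose_def)
  next
    case (EEs i j)
    with near[of i j] show ?thesis by (auto simp: Transposition.transpose_def)
  next
    case (EsE i j)
    with near[of i j] show ?thesis by (auto simp: Transposition.transpose_def)
  qed auto
qed

lemma compatible_context:
  assumes "(u, v) \<in> tb_rels n"
  shows "compatible (p @ u @ q) J \<longleftrightarrow> compatible (p @ v @ q) J"
  by (induction p arbitrary: J rule: braid_word.induct) (simp_all add: compatible_relation[OF assms])

lemma braid_word_relation:
  assumes "(u, v) \<in> tb_rels n"
  shows "(braid_word u, braid_word v) \<in> word_cong (fb_gens n) (fb_rels d n)"
  using assms
proof cases
  case (ss i j)
  then show ?thesis using word_cong.relation[OF fb_rels.ss[of i n j d]] by simp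
next
  case (sss i j)
  then show ?thesis using word_cong.relation[OF fb_rels.sss[of i n j d]] by simp
next
  case (inv_right i)
  then show ?thesis using word_cong.cancel[of "Sigma_gen i" "fb_gens n" True "fb_rels d n"] by simp
next
  case (inv_left i)
  then show ?thesis using word_cong.cancel[of "Sigma_gen i" "fb_gens n" False "fb_rels d n"] by simp
qed (auto intro!: word_cong.refl)

lemma compatible_inj:
  assumes "inj v" shows "compatible w (v \<circ> J) \<longleftrightarrow> compatible w J"
  using inj_eq[OF assms] by (induction w arbitrary: J rule: braid_word.induct) (simp_all add: comp_assoc)

text \<open>Moebius inversion, by adjoining one point \<open>x\<close> at a time: on the sets that contain \<open>x\<close>, the function \<open>c\<close>
inverts the change of \<open>F\<close> caused by \<open>x\<close>.\<close>

lemma moebius_on_subsets: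
  fixes F :: "'a set \<Rightarrow> 'k::ab_group_add"
  assumes "finite U"
  shows "\<exists>c. \<forall>K\<subseteq>U. (\<Sum>K'\<in>Pow K. c K') = F K"
  using assms
proof (induction U arbitrary: F rule: finite_induct)
  case empty
  show ?case by (intro exI[of _ F]) auto
next
  case (insert x U)
  obtain c0 where c0: "\<And>K. K \<subseteq> U \<Longrightarrow> (\<Sum>K'\<in>Pow K. c0 K') = F K"
    using insert.IH[of F] by blast
  obtain c1 where c1: "\<And>K. K \<subseteq> U \<Longrightarrow> (\<Sum>K'\<in>Pow K. c1 K') = F (insert x K) - F K"
    using insert.IH[of "\<lambda>K. F (insert x K) - F K"] by blast
  define c where "c K = (if x \<in> K then c1 (K - {x}) else c0 K)" for K
  have old: "(\<Sum>K'\<in>Pow K. c K') = F K" if "K \<subseteq> U" for K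
  proof -
    have "(\<Sum>K'\<in>Pow K. c K') = (\<Sum>K'\<in>Pow K. c0 K')"
      using that insert.hyps by (intro sum.cong) (auto simp: c_def)
    then show ?thesis using c0[OF that] by simp
  qed
  have new: "(\<Sum>K'\<in>Pow (insert x K). c K') = F (insert x K)" if K: "K \<subseteq> U" for K
  proof -
    have x: "x \<notin> K" using K insert.hyps by blast
    have fin: "finite K" using K insert.hyps finite_subset by blast
    have inj: "inj_on (insert x) (Pow K)" using x by (auto simp: inj_on_def)
    have "(\<Sum>K'\<in>Pow (insert x K). c K') = (\<Sum>K'\<in>Pow K. c K') + (\<Sum>K'\<in>insert x ` Pow K. c K')"
      unfolding Pow_insert using fin x by (intro sum.union_disjoint) auto
    also have "(\<Sum>K'\<in>insert x ` Pow K. c K') = (\<Sum>K'\<in>Pow K. c1 K')"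
      unfolding sum.reindex[OF inj] using x by (intro sum.cong) (auto simp: c_def intro!: arg_cong[of _ _ c1])
    finally show ?thesis using old[OF K] c1[OF K] by simp
  qed
  have "(\<Sum>K'\<in>Pow K. c K') = F K" if K: "K \<subseteq> insert x U" for K
  proof (cases "x \<in> K")
    case True
    then have "K = insert x (K - {x})" "K - {x} \<subseteq> U" using K by auto
    then show ?thesis using new[of "K - {x}"] by simp
  next
    case False
    then show ?thesis using old[of K] K by blast
  qed
  then show ?case by blast
qed

text \<open>The partition of the strands by colour, as an equivalence relation.\<close>

definition colour_kernel :: "nat \<Rightarrow> (nat \<Rightarrow> nat) \<Rightarrow> (nat \<times> nat) set" where
  "colour_kernel n J = {(a, b) \<in> {1..n} \<times> {1..n}. J a = J b}"

lemma colour_kernel_subset: "colour_kernel n J \<subseteq> {1..n} \<times> {1..n}"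
  by (auto simp: colour_kernel_def)

text \<open>The strands \<open>i\<close> and \<open>i + m + 1\<close> are tied by a word whose braid part is trivial.\<close>

fun tie_word :: "nat \<Rightarrow> nat \<Rightarrow> tb_gen list" where
  "tie_word i 0 = [TE i]"
| "tie_word i (Suc m) = TS (i + Suc m) # tie_word i m @ [TSinv (i + Suc m)]"

lemma tie_word_words: "1 \<le> i \<Longrightarrow> i + m < n \<Longrightarrow> tie_word i m \<in> lists (tb_gens n)"
  by (induction m) auto

lemma compatible_tie_word:
  "1 \<le> i \<Longrightarrow> compatible (tie_word i m @ q) J \<longleftrightarrow> J i = J (i + m + 1) \<and> compatible q J"
proof (induction m arbitrary: q J)
  case (Suc m)
  let ?k = "i + Suc m"
  have adj2: "J \<circ> adj ?k \<circ> adj ?k = J" by (auto simp: fun_eq_iff)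
  have ends: "(J \<circ> adj ?k) i = J i" "(J \<circ> adj ?k) (i + m + 1) = J (i + Suc m + 1)"
    by (auto simp: Transposition.transpose_def)
  then show ?case
    by (simp only: tie_word.simps append.simps append_assoc compatible.simps adj2 ends
        Suc.IH[OF Suc.prems, of "TSinv ?k # q" "J \<circ> adj ?k"])
qed simp

lemma braid_word_tie_word:
  "1 \<le> i \<Longrightarrow> i + m < n \<Longrightarrow> (braid_word (tie_word i m), []) \<in> word_cong (fb_gens n) (fb_rels d n)"
proof (induction m)
  case 0
  then show ?case by (auto intro: word_cong.refl)
next
  case (Suc m)
  let ?k = "Sigma_gen (i + Suc m)"
  have k: "?k \<in> fb_gens n" using Suc.prems by auto
  have l: "([(?k, b)], [(?k, b)]) \<in> word_cong (fb_gens n) (fb_rels d n)" for b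
    using k by (intro word_cong.refl) auto
  have "(braid_word (tie_word i m), []) \<in> word_cong (fb_gens n) (fb_rels d n)"
    using Suc by auto
  from word_cong.append[OF l[of True] word_cong.append[OF this l[of False]]]
  have "(braid_word (tie_word i (Suc m)), [(?k, True), (?k, \<not> True)]) \<in> word_cong (fb_gens n) (fb_rels d n)"
    by simp
  then show ?case using word_cong.cancel[OF k] by (rule word_cong.trans)
qed

context framed_braid
begin

definition braid :: "tb_gen list \<Rightarrow> fb_gen gword set" where
  "braid w = cl (braid_word w)"

lemma braid_simps:
  assumes "w \<in> lists (tb_gens n)"
  shows "i \<in> {1..<n} \<Longrightarrow> braid (TS i # w) = s i \<cdot> braid w"
    and "i \<in> {1..<n} \<Longrightarrow> braid (TSinv i # w) = inv\<^bsub>G\<^esub> (s i) \<cdot> braid w"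
    and "braid (TE i # w) = braid w"
proof -
  note bw = braid_word_words[OF assms]
  have l: "i \<in> {1..<n} \<Longrightarrow> [(Sigma_gen i, b)] \<in> words" for b by simp
  show "i \<in> {1..<n} \<Longrightarrow> braid (TS i # w) = s i \<cdot> braid w"
    using fb_mult_cl[OF l[of True] bw, of d] by (simp add: braid_def s_cl)
  show "i \<in> {1..<n} \<Longrightarrow> braid (TSinv i # w) = inv\<^bsub>G\<^esub> (s i) \<cdot> braid w"
    using fb_mult_cl[OF l[of False] bw, of d] by (simp only: braid_def inv_s_cl braid_word.simps append.simps)
qed (simp add: braid_def)

lemma braid_Nil: "braid [] = \<one>\<^bsub>G\<^esub>"
  by (simp add: braid_def fb_one)

lemma braid_append:
  "u \<in> lists (tb_gens n) \<Longrightarrow> v \<in> lists (tb_gens n) \<Longrightarrow> braid (u @ v) = braid u \<cdot> braid v"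
  by (simp only: braid_def braid_word_append fb_mult_cl braid_word_words)

lemma braid_context:
  assumes "(u, v) \<in> tb_rels n" "p \<in> lists (tb_gens n)" "q \<in> lists (tb_gens n)"
  shows "braid (p @ u @ q) = braid (p @ v @ q)"
  unfolding braid_def braid_word_append
  by (intro FB.cl_eqI word_cong.append braid_word_relation[OF assms(1)] word_cong.refl
      braid_word_words assms(2,3))

lemma fb_E_apply:
  assumes "i \<in> {1..<n}"
  shows "(fb_E d n i :: _ \<Rightarrow> 'k) = (\<lambda>z. 1 / of_nat d * (\<Sum>a\<in>{1..d}.
    basis_elt (t i [^]\<^bsub>G\<^esub> a \<cdot> inv\<^bsub>G\<^esub> (t (i + 1) [^]\<^bsub>G\<^esub> a)) z))"
proof -
  have c: "t i \<in> carrier G" "t (i + 1) \<in> carrier G" using assms by auto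
  show ?thesis
    unfolding fb_E_def by (subst A_finsum) (use c in \<open>auto simp: int_pow_int G.int_pow_neg\<close>)
qed

lemma fb_E_closed [simp]: "i \<in> {1..<n} \<Longrightarrow> fb_E d n i \<in> carrier A"
proof -
  assume i: "i \<in> {1..<n}"
  then have c: "t i \<in> carrier G" "t (i + 1) \<in> carrier G" by auto
  show ?thesis unfolding fb_E_apply[OF i] using c by (intro A_smult A_sum) auto
qed

lemma character_fb_E:
  assumes i: "i \<in> {1..<n}" and J: "J ` {1..n} \<subseteq> {1..d}" and x: "x \<in> carrier A"
  shows "pairing (fb_E d n i \<star> x) (character J H) = (if J i = J (i + 1) then pairing x (character J H) else 0)"
proof -
  have i': "i \<in> {1..n}" "i + 1 \<in> {1..n}" using i by auto
  note c = t_closed[OF i'(1)] t_closed[OF i'(2)]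
  let ?g = "\<lambda>a. t i [^]\<^bsub>G\<^esub> a \<cdot> inv\<^bsub>G\<^esub> (t (i + 1) [^]\<^bsub>G\<^esub> (a :: nat))"
  have g: "?g a \<in> carrier G" for a using c by simp
  have chi: "character J H (?g a \<cdot> y) = weight (J i) ^ a * inverse (weight (J (i + 1)) ^ a) * character J H y"
    if y: "y \<in> carrier G" for a y
  proof -
    have "?g a \<cdot> y = t i [^]\<^bsub>G\<^esub> a \<cdot> (inv\<^bsub>G\<^esub> (t (i + 1) [^]\<^bsub>G\<^esub> a) \<cdot> y)"
      using c y by (intro G.m_assoc) auto
    moreover have "inv\<^bsub>G\<^esub> (t (i + 1) [^]\<^bsub>G\<^esub> a) \<cdot> y \<in> carrier G" using c y by auto
    ultimately show ?thesis
      by (simp only: character_t_pow[OF i'(1)] character_inv_t_pow[OF i'(2) y] mult.assoc)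
  qed
  have "pairing (fb_E d n i \<star> x) (character J H) =
      1 / of_nat d * (\<Sum>a\<in>{1..d}. pairing x (\<lambda>y. character J H (?g a \<cdot> y)))"
    unfolding A_mult[OF fb_E_closed[OF i] x] unfolding fb_E_apply[OF i] pairing_smult_left
    using g by (subst pairing_sum_left) (auto intro: A_finite)
  also have "\<dots> = 1 / of_nat d * (\<Sum>a\<in>{1..d}. weight (J i) ^ a * inverse (weight (J (i + 1)) ^ a)) *
      pairing x (character J H)"
    using A_cong[OF x chi] by (simp only: pairing_smult_right sum_distrib_right mult.assoc)
  also have "\<dots> = (if J i = J (i + 1) then pairing x (character J H) else 0)"
  proof -
    have "J i \<in> {1..d}" "J (i + 1) \<in> {1..d}" using J i' by blast+
    from sum_weights[OF this] show ?thesis using d_invertible by simp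
  qed
  finally show ?thesis .
qed

fun ev_gen :: "tb_gen \<Rightarrow> fb_gen gword set \<Rightarrow> 'k" where
  "ev_gen (TS i) = basis_elt (s i)"
| "ev_gen (TSinv i) = basis_elt (inv\<^bsub>G\<^esub> (s i))"
| "ev_gen (TE i) = fb_E d n i"

definition ev :: "tb_gen list \<Rightarrow> fb_gen gword set \<Rightarrow> 'k" where
  "ev w = foldr (\<lambda>g x. ev_gen g \<star> x) w \<one>\<^bsub>A\<^esub>"

lemma ev_simps: "ev [] = \<one>\<^bsub>A\<^esub>" "ev (g # w) = ev_gen g \<star> ev w"
  by (simp_all add: ev_def)

lemma ev_gen_closed: "g \<in> tb_gens n \<Longrightarrow> ev_gen g \<in> carrier A"
  by (cases g) (simp_all del: One_nat_def)

lemma ev_closed: "w \<in> lists (tb_gens n) \<Longrightarrow> ev w \<in> carrier A"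
  by (induction w) (auto simp: ev_simps ev_gen_closed simp del: A_simps)

lemma ev_append:
  "u \<in> lists (tb_gens n) \<Longrightarrow> v \<in> lists (tb_gens n) \<Longrightarrow> ev (u @ v) = ev u \<star> ev v"
proof (induction u)
  case Nil
  then show ?case using A.l_one[OF ev_closed] by (simp add: ev_simps)
next
  case (Cons g u)
  then have g: "g \<in> tb_gens n" "u \<in> lists (tb_gens n)" by auto
  have "ev ((g # u) @ v) = ev_gen g \<star> (ev u \<star> ev v)"
    using Cons.IH[OF g(2) Cons.prems(2)] by (simp add: ev_simps)
  also have "\<dots> = ev (g # u) \<star> ev v"
    using A.m_assoc[OF ev_gen_closed[OF g(1)] ev_closed[OF g(2)] ev_closed[OF Cons.prems(2)]]
    by (simp add: ev_simps)
  finally show ?case .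
qed

lemma adj_range: "i \<in> {1..<n} \<Longrightarrow> J ` {1..n} \<subseteq> {1..d} \<Longrightarrow> (J \<circ> adj i) ` {1..n} \<subseteq> {1..d}"
  using adj_mem[of i n] by (auto simp del: atLeastAtMost_iff)

text \<open>In coordinates each generator is a partial permutation, and so is each word. For \<open>TE i\<close> this says that
\<open>E\<^sub>i\<close> is the sum of the \<open>E\<^sub>I\<close> in which the strands \<open>i\<close> and \<open>i + 1\<close> have the same colour.\<close>

lemma character_ev:
  assumes "w \<in> lists (tb_gens n)" "J ` {1..n} \<subseteq> {1..d}"
  shows "pairing (ev w) (character J H) = (if compatible w J then H (braid w) else 0)"
  using assms
proof (induction arbitrary: J H rule: tb_words_induct)
  case Nil
  then show ?case by (simp add: ev_simps character_B[OF one_B] braid_Nil)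
next
  case (TS i w)
  have "pairing (ev (TS i # w)) (character J H) = pairing (ev w) (character (J \<circ> adj i) (\<lambda>b. H (s i \<cdot> b)))"
    using A_mult[OF A_basis[OF s_closed[OF TS(1)]] ev_closed[OF TS(2)]]
      A_cong[OF ev_closed[OF TS(2)] character_s(1)[OF TS(1)]]
    by (simp only: ev_simps ev_gen.simps pairing_basis)
  then show ?case
    by (simp only: TS.IH[OF adj_range[OF TS(1) TS.prems]] braid_simps(1)[OF TS(2,1)] compatible.simps)
next
  case (TSinv i w)
  have "pairing (ev (TSinv i # w)) (character J H) =
      pairing (ev w) (character (J \<circ> adj i) (\<lambda>b. H (inv\<^bsub>G\<^esub> (s i) \<cdot> b)))"
    using A_mult[OF A_basis[OF G.inv_closed[OF s_closed[OF TSinv(1)]]] ev_closed[OF TSinv(2)]]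
      A_cong[OF ev_closed[OF TSinv(2)] character_s(2)[OF TSinv(1)]]
    by (simp only: ev_simps ev_gen.simps pairing_basis)
  then show ?case
    by (simp only: TSinv.IH[OF adj_range[OF TSinv(1) TSinv.prems]] braid_simps(2)[OF TSinv(2,1)] compatible.simps)
next
  case (TE i w)
  then show ?case
    by (simp add: ev_simps character_fb_E[OF TE(1) TE.prems ev_closed[OF TE(2)]] braid_simps(3)[OF TE(2)])
qed

sublocale TB: algebra_presentation "tb_gens n" "tb_rels n" "TYPE('k)"
  by unfold_locales (rule tb_rels_words)

lemma invariant_from_data:
  assumes "\<And>u v. u \<in> lists (tb_gens n) \<Longrightarrow> v \<in> lists (tb_gens n) \<Longrightarrow>
    compatible u = compatible v \<Longrightarrow> braid u = braid v \<Longrightarrow> h u = (h v :: 'k)"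
  shows "TB.invariant h"
  unfolding TB.invariant_def
proof
  fix r assume r: "r \<in> tb_rels n"
  obtain u v where r_eq: "r = (u, v)" by force
  with r have uv: "(u, v) \<in> tb_rels n" by simp
  then have w: "u \<in> lists (tb_gens n)" "v \<in> lists (tb_gens n)" using tb_rels_words by auto
  have "h (p @ u @ q) = h (p @ v @ q)" if "p \<in> lists (tb_gens n)" "q \<in> lists (tb_gens n)" for p q
  proof (rule assms)
    show "compatible (p @ u @ q) = compatible (p @ v @ q)"
      by (rule ext) (rule compatible_context[OF uv])
  qed (use that w braid_context[OF uv that] in simp_all)
  then show "case r of (u, v) \<Rightarrow> \<forall>p\<in>lists (tb_gens n). \<forall>q\<in>lists (tb_gens n). h (p @ u @ q) = h (p @ v @ q)"
    by (simp add: r_eq del: in_lists_conv_set)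
qed

text \<open>The homomorphism of the theorem, on the free algebra.\<close>

definition evaluation :: "(tb_gen list \<Rightarrow> 'k) \<Rightarrow> fb_gen gword set \<Rightarrow> 'k" where
  "evaluation = lin_ext ev"

lemma evaluation_alg_hom: "evaluation \<in> alg_hom TB.FA A"
  unfolding evaluation_def fb_algebra_def
  by (rule lin_ext_alg_hom[OF monoid_free_monoid G.is_monoid])
    (use ev_closed ev_append in \<open>simp_all add: ev_simps fb_algebra_def\<close>)

lemma evaluation_closed: "f \<in> carrier TB.FA \<Longrightarrow> evaluation f \<in> carrier A"
  using evaluation_alg_hom by (simp add: alg_hom_def linear_maps_def Pi_iff)

text \<open>The coordinate functional \<open>character J H\<close>, pulled back to words. Unlike \<open>character\<close>, it is also used
for colourings \<open>J\<close> with values outside \<open>{1..d}\<close>.\<close>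

definition probe :: "(nat \<Rightarrow> nat) \<Rightarrow> (fb_gen gword set \<Rightarrow> 'k) \<Rightarrow> tb_gen list \<Rightarrow> 'k" where
  "probe J H w = (if compatible w J then H (braid w) else 0)"

lemma probe_invariant: "TB.invariant (probe J H)"
  by (rule invariant_from_data) (simp add: probe_def)

lemma FA_supp: "f \<in> carrier TB.FA \<Longrightarrow> f w \<noteq> 0 \<Longrightarrow> w \<in> lists (tb_gens n)"
  using monoid_algebra_supp[of f "free_monoid (tb_gens n)" w] by simp

lemma FA_cong: "f \<in> carrier TB.FA \<Longrightarrow> (\<And>w. w \<in> lists (tb_gens n) \<Longrightarrow> h w = h' w) \<Longrightarrow> pairing f h = pairing f h'"
  by (erule pairing_cong_carrier) (simp only: free_monoid_simps)

lemma FA_finite: "f \<in> carrier TB.FA \<Longrightarrow> finite_support f"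
  by (rule monoid_algebra_finite)

lemma character_evaluation:
  assumes f: "f \<in> carrier TB.FA" and J: "J ` {1..n} \<subseteq> {1..d}"
  shows "pairing (evaluation f) (character J H) = pairing f (probe J H)"
proof -
  have "pairing (evaluation f) (character J H) = pairing f (\<lambda>w. pairing (ev w) (character J H))"
    unfolding evaluation_def by (rule pairing_lin_ext) (use f in \<open>auto intro!: A_finite ev_closed FA_finite dest: FA_supp[OF f]\<close>)
  also have "\<dots> = pairing f (probe J H)"
    by (rule FA_cong[OF f]) (simp add: character_ev[OF _ J] probe_def)
  finally show ?thesis .
qed

lemma evaluation_respects:
  assumes "f \<in> carrier TB.FA" "g \<in> carrier TB.FA" "(\<lambda>z. f z - g z) \<in> TB.RI"
  shows "evaluation f = evaluation g"
proof (rule character_ext)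
  fix J H assume J: "J ` {1..n} \<subseteq> {1..d}"
  have "pairing (\<lambda>z. f z - g z) (probe J H) = 0"
    by (rule TB.relation_ideal_annihilated[OF assms(3) probe_invariant])
  then have "pairing f (probe J H) = pairing g (probe J H)"
    by (simp only: pairing_diff_left[OF assms(1,2)[THEN FA_finite]] right_minus_eq)
  then show "pairing (evaluation f) (character J H) = pairing (evaluation g) (character J H)"
    by (simp only: character_evaluation[OF assms(1) J] character_evaluation[OF assms(2) J])
qed (use assms evaluation_closed in auto)

text \<open>Whether a colouring is compatible with a word depends only on which strands have equal colours.\<close>

lemma evaluation_fixed:
  assumes f: "f \<in> carrier TB.FA" shows "evaluation f \<in> carrier (fixed_algebra d n \<zeta>)"
  unfolding fixed_iff
proof (intro conjI allI impI evaluation_closed f)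
  fix v J H assume v: "v permutes {1..d}" and J: "J ` {1..n} \<subseteq> {1..d}"
  have vJ: "(v \<circ> J) ` {1..n} \<subseteq> {1..d}"
    using J permutes_in_image[OF v] by (auto simp del: atLeastAtMost_iff)
  have "probe (v \<circ> J) H = probe J H"
    by (simp add: probe_def fun_eq_iff compatible_inj[OF permutes_inj[OF v]])
  then show "pairing (evaluation f) (character (v \<circ> J) H) = pairing (evaluation f) (character J H)"
    by (simp only: character_evaluation[OF f J] character_evaluation[OF f vJ])
qed

lemma evaluation_fixed_alg_hom: "evaluation \<in> alg_hom TB.FA (fixed_algebra d n \<zeta>)"
  using evaluation_alg_hom evaluation_fixed unfolding alg_hom_def ring_hom_def linear_maps_def
  by (simp add: fixed_algebra_def Pi_iff)

text \<open>A word that ties the pairs in \<open>K\<close> one after the other and continues with the braid \<open>b\<close>.\<close>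

lemma word_with_data:
  assumes "K \<subseteq> {1..n} \<times> {1..n}" "b \<in> B"
  shows "\<exists>w\<in>lists (tb_gens n). braid w = b \<and> (\<forall>J. compatible w J \<longleftrightarrow> K \<subseteq> colour_kernel n J)"
proof -
  have base: "\<exists>w\<in>lists (tb_gens n). braid w = b \<and> (\<forall>J. compatible w J)"
  proof -
    obtain u where u: "u \<in> words" "unframe u = u" "b = cl u" using braid_words[OF assms(2)] by blast
    have "\<exists>w\<in>lists (tb_gens n). braid_word w = unframe u \<and> (\<forall>J. compatible w J)"
      using u(1)
    proof (induction u rule: unframe.induct)
      case 1
      show ?case by (intro bexI[of _ "[]"]) auto
    next
      case (2 i b u)
      then obtain w where w: "w \<in> lists (tb_gens n)" "braid_word w = unframe u" "\<forall>J. compatible w J"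
        by auto
      have "i \<in> {1..<n}" using 2(2) by auto
      then show ?case using w
        by (intro bexI[of _ "(if b then TS i else TSinv i) # w"]) auto
    qed auto
    with u show ?thesis unfolding braid_def by metis
  qed
  have "finite K" using assms(1) by (rule finite_subset) simp
  then show ?thesis using assms(1)
  proof (induction K rule: finite_induct)
    case empty
    then show ?case using base by simp
  next
    case (insert p K)
    then obtain w where w: "w \<in> lists (tb_gens n)" "braid w = b" "\<And>J. compatible w J \<longleftrightarrow> K \<subseteq> colour_kernel n J"
      by auto
    obtain x y where p: "p = (x, y)" "x \<in> {1..n}" "y \<in> {1..n}" using insert.prems by auto
    have tied: ?case if xy: "x < y" "x \<in> {1..n}" "y \<in> {1..n}" and p: "p = (x, y) \<or> p = (y, x)" for x y
    proof -
      let ?u = "tie_word x (y - x - 1)"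
      have r: "1 \<le> x" "x + (y - x - 1) < n" "x + (y - x - 1) + 1 = y" using xy by auto
      have u: "?u \<in> lists (tb_gens n)" using r(1,2) by (rule tie_word_words)
      have "braid ?u = \<one>\<^bsub>G\<^esub>"
        using FB.cl_eqI[OF braid_word_tie_word[OF r(1,2)]] by (simp add: braid_def fb_one)
      then have "braid (?u @ w) = b"
        by (simp only: braid_append[OF u w(1)] w(2) G.l_one[OF B_closed[OF assms(2)]])
      moreover have "compatible (?u @ w) J \<longleftrightarrow> insert p K \<subseteq> colour_kernel n J" for J
        using compatible_tie_word[OF r(1), of "y - x - 1" w J] w(3) xy p
        unfolding r(3) by (auto simp: colour_kernel_def)
      ultimately show ?thesis using u w(1) by (intro bexI[of _ "?u @ w"]) auto
    qed
    show ?case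
    proof (cases x y rule: linorder_cases)
      case equal
      then show ?thesis using w p by (intro bexI[of _ w]) (auto simp: colour_kernel_def)
    qed (use tied[of x y] tied[of y x] p in auto)
  qed
qed

text \<open>The probe at \<open>J\<close> of a word that ties exactly the pairs in \<open>K\<close> is nonzero if and only if \<open>K\<close> is contained in
the kernel of \<open>J\<close>. Moebius inversion over \<open>K\<close> turns these sums over subsets into arbitrary values.\<close>

lemma element_with_probes:
  fixes F :: "fb_gen gword set \<Rightarrow> (nat \<times> nat) set \<Rightarrow> 'k"
  assumes S: "finite S" "S \<subseteq> B"
  obtains f where "f \<in> carrier TB.FA" "\<And>J H. pairing f (probe J H) = (\<Sum>b\<in>S. F b (colour_kernel n J) * H b)"
proof -
  let ?U = "{1..n} \<times> {1..n} :: (nat \<times> nat) set"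
  have finU: "finite ?U" by simp
  have "\<forall>b. \<exists>c. \<forall>K\<subseteq>?U. (\<Sum>K'\<in>Pow K. c K') = F b K"
    using moebius_on_subsets[OF finU] by blast
  then obtain c where c: "\<And>b K. K \<subseteq> ?U \<Longrightarrow> (\<Sum>K'\<in>Pow K. c b K') = F b K" by metis
  define W where "W b K = (SOME w. w \<in> lists (tb_gens n) \<and> braid w = b \<and>
    (\<forall>J. compatible w J \<longleftrightarrow> K \<subseteq> colour_kernel n J))" for b K
  have W: "W b K \<in> lists (tb_gens n)" "braid (W b K) = b" "compatible (W b K) J \<longleftrightarrow> K \<subseteq> colour_kernel n J"
    if "b \<in> S" "K \<subseteq> ?U" for b K J
  proof -
    have "\<exists>w. w \<in> lists (tb_gens n) \<and> braid w = b \<and> (\<forall>J. compatible w J \<longleftrightarrow> K \<subseteq> colour_kernel n J)"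
      using word_with_data[OF that(2)] that(1) S(2) by blast
    then have "W b K \<in> lists (tb_gens n) \<and> braid (W b K) = b \<and>
        (\<forall>J. compatible (W b K) J \<longleftrightarrow> K \<subseteq> colour_kernel n J)"
      unfolding W_def by (rule someI_ex)
    then show "W b K \<in> lists (tb_gens n)" "braid (W b K) = b" "compatible (W b K) J \<longleftrightarrow> K \<subseteq> colour_kernel n J"
      by blast+
  qed
  define f where "f = (\<lambda>z. \<Sum>b\<in>S. \<Sum>K\<in>Pow ?U. c b K * basis_elt (W b K) z)"
  have term_closed: "(\<lambda>z. c b K * basis_elt (W b K) z) \<in> carrier TB.FA" if "b \<in> S" "K \<in> Pow ?U" for b K
    using W(1)[OF that(1)] that(2) by (intro monoid_algebra_smult_closed basis_elt_closed) simp
  have inner_closed: "(\<lambda>z. \<Sum>K\<in>Pow ?U. c b K * basis_elt (W b K) z) \<in> carrier TB.FA" if "b \<in> S" for b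
    by (rule monoid_algebra_sum_closed) (use term_closed[OF that] finU in auto)
  show ?thesis
  proof (rule that)
    show "f \<in> carrier TB.FA"
      unfolding f_def using inner_closed S(1) by (rule monoid_algebra_sum_closed[rotated])
    fix J H
    have "pairing f (probe J H) = (\<Sum>b\<in>S. \<Sum>K\<in>Pow ?U. c b K * probe J H (W b K))"
    proof -
      have "pairing f (probe J H) = (\<Sum>b\<in>S. pairing (\<lambda>z. \<Sum>K\<in>Pow ?U. c b K * basis_elt (W b K) z) (probe J H))"
        unfolding f_def using S(1) FA_finite[OF inner_closed] by (rule pairing_sum_left)
      also have "\<dots> = (\<Sum>b\<in>S. \<Sum>K\<in>Pow ?U. pairing (\<lambda>z. c b K * basis_elt (W b K) z) (probe J H))"
        using finU by (intro sum.cong HOL.refl pairing_sum_left FA_finite term_closed) auto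
      finally show ?thesis by (simp only: pairing_smult_left pairing_basis)
    qed
    also have "\<dots> = (\<Sum>b\<in>S. F b (colour_kernel n J) * H b)"
    proof (rule sum.cong[OF HOL.refl])
      fix b assume b: "b \<in> S"
      have "(\<Sum>K\<in>Pow ?U. c b K * probe J H (W b K)) = (\<Sum>K\<in>Pow ?U. if K \<subseteq> colour_kernel n J then c b K * H b else 0)"
        using W(2,3)[OF b] by (intro sum.cong) (auto simp: probe_def)
      also have "\<dots> = (\<Sum>K\<in>Pow (colour_kernel n J). c b K * H b)"
        using colour_kernel_subset[of n J] finU by (intro sum.mono_neutral_cong_right) auto
      also have "\<dots> = F b (colour_kernel n J) * H b"
        using c[OF colour_kernel_subset, of b J] by (simp flip: sum_distrib_right)
      finally show "(\<Sum>K\<in>Pow ?U. c b K * probe J H (W b K)) = F b (colour_kernel n J) * H b" .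
    qed
    finally show "pairing f (probe J H) = (\<Sum>b\<in>S. F b (colour_kernel n J) * H b)" .
  qed
qed

text \<open>Two colourings with the same kernel differ by an injection between the sets of their colours, and
this injection extends to a permutation of all colours.\<close>

lemma fixed_kernel:
  assumes x: "x \<in> carrier (fixed_algebra d n \<zeta>)"
    and J: "J ` {1..n} \<subseteq> {1..d}" "J' ` {1..n} \<subseteq> {1..d}" and ker: "colour_kernel n J = colour_kernel n J'"
  shows "pairing x (character J H) = pairing x (character J' H)"
proof -
  have iff: "J a = J b \<longleftrightarrow> J' a = J' b" if "a \<in> {1..n}" "b \<in> {1..n}" for a b
    using ker that unfolding colour_kernel_def by blast
  define f where "f c = J (SOME i. i \<in> {1..n} \<and> J' i = c)" for c
  have f: "f (J' i) = J i" if i: "i \<in> {1..n}" for i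
  proof -
    let ?j = "SOME j. j \<in> {1..n} \<and> J' j = J' i"
    have "?j \<in> {1..n} \<and> J' ?j = J' i" by (rule someI[of _ i]) (use i in simp)
    then show ?thesis using iff[of ?j i] i by (simp add: f_def)
  qed
  have inj: "inj_on f (J' ` {1..n})" using f iff by (auto simp: inj_on_def simp del: atLeastAtMost_iff)
  have img: "f ` J' ` {1..n} \<subseteq> {1..d}" using f J(1) by (auto simp del: atLeastAtMost_iff)
  obtain v where v: "v permutes {1..d}" "\<And>c. c \<in> J' ` {1..n} \<Longrightarrow> v c = f c"
    using extend_to_permutation[OF finite_atLeastAtMost J(2) inj img] by blast
  have xA: "x \<in> carrier A" using x by (simp add: fixed_iff)
  have "pairing x (character J H) = pairing x (character (v \<circ> J') H)"
    using v(2) f by (intro A_cong[OF xA] character_colour_cong) (auto simp del: atLeastAtMost_iff)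
  also have "\<dots> = pairing x (character J' H)" using x v(1) J(2) by (simp add: fixed_iff)
  finally show ?thesis .
qed

text \<open>The coordinates of a fixed element are functions of kernel and braid, hence attained by a combination
of words. Kernels that do not come from a colouring with \<open>d\<close> colours are given the value \<open>0\<close>.\<close>

lemma evaluation_surjective:
  assumes x: "x \<in> carrier (fixed_algebra d n \<zeta>)"
  obtains f where "f \<in> carrier TB.FA" "evaluation f = x"
proof -
  have xA: "x \<in> carrier A" using x by (simp add: fixed_iff)
  have supp: "g \<in> carrier G" if "x g \<noteq> 0" for g
    using xA that unfolding fb_algebra_def by (rule monoid_algebra_supp)
  define S where "S = unframed ` {g. x g \<noteq> 0}"
  have S: "finite S" "S \<subseteq> B" using A_finite[OF xA] unframed_B supp by (auto simp: S_def)
  define F where "F b K = (if \<exists>J. J ` {1..n} \<subseteq> {1..d} \<and> colour_kernel n J = K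
    then pairing x (character (SOME J. J ` {1..n} \<subseteq> {1..d} \<and> colour_kernel n J = K) (basis_elt b)) else 0)" for b K
  have F: "F b (colour_kernel n J) = pairing x (character J (basis_elt b))" if J: "J ` {1..n} \<subseteq> {1..d}" for b J
  proof -
    let ?J = "SOME J'. J' ` {1..n} \<subseteq> {1..d} \<and> colour_kernel n J' = colour_kernel n J"
    have "?J ` {1..n} \<subseteq> {1..d} \<and> colour_kernel n ?J = colour_kernel n J" by (rule someI[of _ J]) (use J in simp)
    then have "pairing x (character ?J (basis_elt b)) = pairing x (character J (basis_elt b))"
      using fixed_kernel[OF x _ J] by blast
    moreover have "\<exists>J'. J' ` {1..n} \<subseteq> {1..d} \<and> colour_kernel n J' = colour_kernel n J" using J by blast
    ultimately show ?thesis by (simp only: F_def if_True)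
  qed
  obtain f where f: "f \<in> carrier TB.FA" "\<And>J H. pairing f (probe J H) = (\<Sum>b\<in>S. F b (colour_kernel n J) * H b)"
    using element_with_probes[OF S] by metis
  have "evaluation f = x"
  proof (rule character_ext[OF evaluation_closed[OF f(1)] xA])
    fix J H assume J: "J ` {1..n} \<subseteq> {1..d}"
    have "pairing x (character J H) = pairing x (\<lambda>g. \<Sum>b\<in>S. H b * character J (basis_elt b) g)"
    proof (rule pairing_cong)
      fix g assume "x g \<noteq> 0"
      then have "unframed g \<in> S" by (simp add: S_def)
      then have "(\<Sum>b\<in>S. if b = unframed g then H b * character J (\<lambda>_. 1) g else 0) =
          H (unframed g) * character J (\<lambda>_. 1) g"
        using S(1) by simp
      moreover have "H b * character J (basis_elt b) g = (if b = unframed g then H b * character J (\<lambda>_. 1) g else 0)" for b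
        unfolding character_split[of J "basis_elt b"] by (simp add: basis_elt_def)
      ultimately show "character J H g = (\<Sum>b\<in>S. H b * character J (basis_elt b) g)"
        by (simp only: character_split[of J H] mult.commute)
    qed
    then show "pairing (evaluation f) (character J H) = pairing x (character J H)"
      unfolding character_evaluation[OF f(1) J] f(2) F[OF J]
      by (simp only: pairing_sum_right pairing_smult_right mult.commute)
  qed
  with f(1) show ?thesis by (rule that)
qed

text \<open>Choose \<open>f\<close> so that its probes single out the kernel of the identity, which is the kernel of the
injective colourings. With fewer colours than strands there are none, so the image of \<open>f\<close> vanishes;
the probe at the identity colouring is invariant and shows that \<open>f\<close> is not in the relation ideal.\<close>

lemma evaluation_not_injective:
  assumes "d < n"
  obtains f where "f \<in> carrier TB.FA" "evaluation f = (\<lambda>z. 0)" "f \<notin> TB.RI"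
proof -
  obtain f where f: "f \<in> carrier TB.FA" "\<And>J H. pairing f (probe J H) =
      (\<Sum>b\<in>{\<one>\<^bsub>G\<^esub>}. (if colour_kernel n J = colour_kernel n id then 1 else 0) * H b)"
    using element_with_probes[of "{\<one>\<^bsub>G\<^esub>}" "\<lambda>b K. if K = colour_kernel n id then 1 else 0"] one_B by auto
  have "evaluation f = (\<lambda>z. 0)"
  proof (rule character_ext[OF evaluation_closed[OF f(1)]])
    show "(\<lambda>z. 0) \<in> carrier A" using A.zero_closed by simp
    fix J :: "nat \<Rightarrow> nat" and H assume J: "J ` {1..n} \<subseteq> {1..d}"
    have "\<not> inj_on J {1..n}"
    proof
      assume "inj_on J {1..n}"
      then have "card {1..n} \<le> card {1..d}" using J by (rule card_inj_on_le) simp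
      with assms show False by simp
    qed
    then obtain a b where "a \<in> {1..n}" "b \<in> {1..n}" "J a = J b" "a \<noteq> b" by (auto simp: inj_on_def)
    then have "(a, b) \<in> colour_kernel n J" "(a, b) \<notin> colour_kernel n id" by (auto simp: colour_kernel_def)
    then have "colour_kernel n J \<noteq> colour_kernel n id" by blast
    then show "pairing (evaluation f) (character J H) = pairing (\<lambda>z. 0) (character J H)"
      by (simp add: character_evaluation[OF f(1) J] f(2))
  qed
  moreover have "f \<notin> TB.RI"
  proof
    assume "f \<in> TB.RI"
    then have "pairing f (probe id (\<lambda>_. 1)) = 0"
      using probe_invariant by (rule TB.relation_ideal_annihilated)
    then show False by (simp add: f(2))
  qed
  ultimately show ?thesis using f(1) by (intro that)
qed

end

section \<open>Injectivity with sufficiently many colours\<close>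

context tied_operators
begin

fun braid_act :: "fb_gen gword \<Rightarrow> 'b \<Rightarrow> 'b" where
  "braid_act [] x = x"
| "braid_act ((Sigma_gen i, b) # w) x = (if b then s i else s' i) (braid_act w x)"
| "braid_act ((T_gen i, b) # w) x = braid_act w x"

lemma braid_act_append: "braid_act (u @ v) x = braid_act u (braid_act v x)"
  by (induction u x rule: braid_act.induct) auto

lemma braid_act_replicate [simp]: "braid_act (replicate k (T_gen i, b)) x = x"
  by (induction k) auto

lemma braid_act_cong:
  "(u, v) \<in> word_cong (fb_gens n) (fb_rels d n) \<Longrightarrow> braid_act u x = braid_act v x"
proof (induction arbitrary: x rule: word_cong.induct)
  case (append u v u' v')
  then show ?case by (simp add: braid_act_append)
next
  case (cancel g b)
  then show ?case by (cases g; cases b) (auto simp: inv)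
next
  case (relation u v)
  then show ?case by cases (auto simp: ss sss)
qed auto

lemma act_untie: "act (untie w) x = braid_act (braid_word w) x"
  by (induction w rule: braid_word.induct) auto

end

text \<open>The partition of the strands that is generated by the ties of a word, as an equivalence relation.\<close>

definition forced :: "nat \<Rightarrow> tb_gen list \<Rightarrow> (nat \<times> nat) set" where
  "forced n w = {(a, b) \<in> {1..n} \<times> {1..n}. \<forall>J. compatible w J \<longrightarrow> J a = J b}"

lemma ties_forced: "w \<in> lists (tb_gens n) \<Longrightarrow> set (ties w) \<subseteq> forced n w"
  using ties_range[of w n] by (auto simp: forced_def compatible_iff_satisfies satisfies_def)

lemma compatible_iff_forced:
  assumes "w \<in> lists (tb_gens n)"
  shows "compatible w J \<longleftrightarrow> forced n w \<subseteq> colour_kernel n J"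
proof
  show "forced n w \<subseteq> colour_kernel n J" if "compatible w J"
    using that by (auto simp: forced_def colour_kernel_def)
  show "compatible w J" if "forced n w \<subseteq> colour_kernel n J"
    using that ties_forced[OF assms]
    unfolding compatible_iff_satisfies satisfies_def colour_kernel_def by blast
qed

text \<open>Colour each strand by the least strand of its block. This uses at most \<open>n\<close> colours, so that for
\<open>n \<le> d\<close> each partition is the kernel of one of the colourings in the basis.\<close>

lemma forced_is_kernel:
  obtains J where "J ` {1..n} \<subseteq> {1..n}" "colour_kernel n J = forced n w"
proof -
  define J where "J a = (LEAST b. (a, b) \<in> forced n w)" for a
  have refl: "(a, a) \<in> forced n w" if "a \<in> {1..n}" for a using that by (auto simp: forced_def)
  have J: "(a, J a) \<in> forced n w" if "a \<in> {1..n}" for a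
    unfolding J_def by (rule LeastI) (rule refl[OF that])
  have class_eq: "J a = J b" if "(a, b) \<in> forced n w" for a b
  proof -
    have "(\<lambda>c. (a, c) \<in> forced n w) = (\<lambda>c. (b, c) \<in> forced n w)"
      using that unfolding forced_def by (intro ext) (auto, metis+)
    then show ?thesis by (simp only: J_def)
  qed
  show ?thesis
  proof (rule that)
    show "J ` {1..n} \<subseteq> {1..n}" using J by (auto simp: forced_def)
    have "(a, b) \<in> forced n w" if "a \<in> {1..n}" "b \<in> {1..n}" "J a = J b" for a b
      using J[OF that(1)] J[OF that(2)] that by (auto simp: forced_def)
    then show "colour_kernel n J = forced n w"
      using class_eq by (auto simp: colour_kernel_def) (auto simp: forced_def)
  qed
qed

context framed_braid
begin

text \<open>Left multiplication by a generator, extended by the identity outside the carrier so that the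
relations hold for every argument.\<close>

definition gen_op :: "tb_gen \<Rightarrow> (tb_gen list \<Rightarrow> 'k) set \<Rightarrow> (tb_gen list \<Rightarrow> 'k) set" where
  "gen_op g X = (if X \<in> carrier TB.PA then TB.mono [g] \<otimes>\<^bsub>TB.PA\<^esub> X else X)"

lemma gen_op_word:
  assumes "w \<in> lists (tb_gens n)"
  shows "foldr gen_op w X = (if X \<in> carrier TB.PA then TB.mono w \<otimes>\<^bsub>TB.PA\<^esub> X else X)"
  using assms
proof (induction w)
  case Nil
  then show ?case using TB.PA_l_one by (simp add: TB.one_PA)
next
  case (Cons g w)
  then have g: "[g] \<in> lists (tb_gens n)" "w \<in> lists (tb_gens n)" by auto
  show ?case
  proof (cases "X \<in> carrier TB.PA")
    case True
    have "foldr gen_op w X = TB.mono w \<otimes>\<^bsub>TB.PA\<^esub> X" using Cons.IH True by simp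
    then have "foldr gen_op (g # w) X = TB.mono [g] \<otimes>\<^bsub>TB.PA\<^esub> (TB.mono w \<otimes>\<^bsub>TB.PA\<^esub> X)"
      using TB.PA_mult_closed[OF TB.mono_closed[OF g(2)] True] by (simp add: gen_op_def[of g])
    then show ?thesis
      using TB.PA_assoc[OF TB.mono_closed[OF g(1)] TB.mono_closed[OF g(2)] True] TB.mono_mult[OF g] True
      by simp
  qed (use Cons.IH in \<open>simp add: gen_op_def\<close>)
qed

lemma gen_op_relation: "(u, v) \<in> tb_rels n \<Longrightarrow> foldr gen_op u X = foldr gen_op v X"
proof -
  assume uv: "(u, v) \<in> tb_rels n"
  then have w: "u \<in> lists (tb_gens n)" "v \<in> lists (tb_gens n)" using tb_rels_words by auto
  show ?thesis by (simp only: gen_op_word[OF w(1)] gen_op_word[OF w(2)] TB.mono_relation[OF uv])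
qed

sublocale OP: tied_operators n "\<lambda>i. gen_op (TS i)" "\<lambda>i. gen_op (TSinv i)" "\<lambda>i. gen_op (TE i)"
proof
  fix i j X
  note r = gen_op_relation[where X = X]
  show "gen_op (TS i) (gen_op (TSinv i) X) = X" if "i \<in> {1..<n}" using r[OF tb_rels.inv_right[OF that]] by simp
  show "gen_op (TSinv i) (gen_op (TS i) X) = X" if "i \<in> {1..<n}" using r[OF tb_rels.inv_left[OF that]] by simp
  show "gen_op (TS i) (gen_op (TS j) X) = gen_op (TS j) (gen_op (TS i) X)"
    if "i \<in> {1..<n}" "j \<in> {1..<n}" "\<bar>int i - int j\<bar> > 1" using r[OF tb_rels.ss[OF that]] by simp
  show "gen_op (TS i) (gen_op (TS j) (gen_op (TS i) X)) = gen_op (TS j) (gen_op (TS i) (gen_op (TS j) X))"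
    if "i \<in> {1..<n}" "j \<in> {1..<n}" "\<bar>int i - int j\<bar> = 1" using r[OF tb_rels.sss[OF that]] by simp
  show "gen_op (TE i) (gen_op (TE j) X) = gen_op (TE j) (gen_op (TE i) X)"
    if "i \<in> {1..<n}" "j \<in> {1..<n}" using r[OF tb_rels.EE[OF that]] by simp
  show "gen_op (TE i) (gen_op (TE i) X) = gen_op (TE i) X" if "i \<in> {1..<n}" using r[OF tb_rels.E_idem[OF that]] by simp
  show "gen_op (TS i) (gen_op (TE i) X) = gen_op (TE i) (gen_op (TS i) X)"
    if "i \<in> {1..<n}" using r[OF tb_rels.sE[OF that]] by simp
  show "gen_op (TS i) (gen_op (TE j) X) = gen_op (TE j) (gen_op (TS i) X)"
    if "i \<in> {1..<n}" "j \<in> {1..<n}" "\<bar>int i - int j\<bar> > 1" using r[OF tb_rels.sE_far[OF that]] by simp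
  show "gen_op (TE i) (gen_op (TS j) (gen_op (TS i) X)) = gen_op (TS j) (gen_op (TS i) (gen_op (TE j) X))"
    if "i \<in> {1..<n}" "j \<in> {1..<n}" "\<bar>int i - int j\<bar> = 1" using r[OF tb_rels.Ess[OF that]] by simp
  show "gen_op (TE i) (gen_op (TS j) (gen_op (TSinv i) X)) = gen_op (TS j) (gen_op (TSinv i) (gen_op (TE j) X))"
    if "i \<in> {1..<n}" "j \<in> {1..<n}" "\<bar>int i - int j\<bar> = 1" using r[OF tb_rels.Ess_inv[OF that]] by simp
  show "gen_op (TE i) (gen_op (TE j) (gen_op (TS i) X)) = gen_op (TE j) (gen_op (TS i) (gen_op (TE j) X))"
    if "i \<in> {1..<n}" "j \<in> {1..<n}" "\<bar>int i - int j\<bar> = 1" using r[OF tb_rels.EEs[OF that]] by simp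
qed

lemma OP_act: "OP.act w X = foldr gen_op w X"
  by (induction w rule: braid_word.induct) auto

text \<open>The normal form for operators is applied to left multiplication on the tied braid algebra itself;
evaluating at the unit recovers the words. Equality of the braids, which is an equality in the framed
braid group, descends because the framing letters may be mapped to the identity operator.\<close>

lemma mono_determined:
  assumes w: "u \<in> lists (tb_gens n)" "v \<in> lists (tb_gens n)"
    and "forced n u = forced n v" "braid u = braid v"
  shows "TB.mono u = TB.mono v"
proof -
  have "(braid_word u, braid_word v) \<in> word_cong (fb_gens n) (fb_rels d n)"
    using assms(4) FB.cl_eq_iff[OF braid_word_words[OF w(1)] braid_word_words[OF w(2)], of d]
    by (simp add: braid_def)
  then have "OP.act (untie u) X = OP.act (untie v) X" for X
    unfolding OP.act_untie by (rule OP.braid_act_cong)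
  then have "foldr gen_op u \<one>\<^bsub>TB.PA\<^esub> = foldr gen_op v \<one>\<^bsub>TB.PA\<^esub>"
    using OP.act_determined[OF w] assms(3)
    unfolding OP_act by (simp add: compatible_iff_forced[OF w(1)] compatible_iff_forced[OF w(2)])
  moreover have "\<one>\<^bsub>TB.PA\<^esub> \<in> carrier TB.PA" unfolding TB.one_PA by (rule TB.mono_closed) simp
  ultimately show ?thesis
    using w by (simp add: gen_op_word TB.PA_r_one del: in_lists_conv_set)
qed

text \<open>At a colouring with kernel \<open>K\<close>, the vanishing coordinate of \<open>evaluation f\<close> is the total weight of \<open>f\<close> on
the words whose partition is contained in \<open>K\<close>. By induction on \<open>K\<close> the proper subsets contribute
nothing, so the weight on the words with partition \<open>K\<close> vanishes too.\<close>

lemma evaluation_kernel_pairing: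
  assumes nd: "n \<le> d" and f: "f \<in> carrier TB.FA" and Tf: "evaluation f = (\<lambda>z. 0)"
  shows "pairing f (\<lambda>w. H (forced n w) (braid w)) = 0"
proof -
  let ?U = "{1..n} \<times> {1..n} :: (nat \<times> nat) set"
  have part: "pairing f (\<lambda>w. if forced n w = K then H (braid w) else 0) = 0" if "finite K" for K H
    using that
  proof (induction K rule: finite_psubset_induct)
    case (psubset K)
    show ?case
    proof (cases "\<exists>J. J ` {1..n} \<subseteq> {1..n} \<and> colour_kernel n J = K")
      case True
      then obtain J where J: "J ` {1..n} \<subseteq> {1..n}" "colour_kernel n J = K" by blast
      have Jd: "J ` {1..n} \<subseteq> {1..d}" using J(1) nd by fastforce
      have "pairing f (probe J H) = 0"
        using character_evaluation[OF f Jd, of H] by (simp add: Tf)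
      also have "pairing f (probe J H) =
          pairing f (\<lambda>w. \<Sum>K'\<in>Pow K. if forced n w = K' then H (braid w) else 0)"
      proof (rule FA_cong[OF f])
        fix w assume w: "w \<in> lists (tb_gens n)"
        show "probe J H w = (\<Sum>K'\<in>Pow K. if forced n w = K' then H (braid w) else 0)"
          using psubset.hyps by (simp add: probe_def compatible_iff_forced[OF w] J(2) sum.delta')
      qed
      also have "\<dots> = (\<Sum>K'\<in>Pow K. pairing f (\<lambda>w. if forced n w = K' then H (braid w) else 0))"
        by (rule pairing_sum_right)
      also have "\<dots> = (\<Sum>K'\<in>{K}. pairing f (\<lambda>w. if forced n w = K' then H (braid w) else 0))"
        using psubset by (intro sum.mono_neutral_right) auto
      finally show ?thesis by simp
    next
      case False
      then have "forced n w \<noteq> K" for w using forced_is_kernel[of n w] by metis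
      then show ?thesis by simp
    qed
  qed
  have "pairing f (\<lambda>w. H (forced n w) (braid w)) =
      (\<Sum>K\<in>Pow ?U. pairing f (\<lambda>w. if forced n w = K then H (forced n w) (braid w) else 0))"
    by (rule sum_pairing_fibres) (use f in \<open>auto simp: FA_finite forced_def\<close>)
  also have "\<dots> = (\<Sum>K\<in>Pow ?U. pairing f (\<lambda>w. if forced n w = K then H K (braid w) else 0))"
    by (intro sum.cong HOL.refl arg_cong2[of _ _ _ _ pairing]) auto
  also have "\<dots> = 0"
    by (intro sum.neutral ballI part) (auto intro: finite_subset)
  finally show ?thesis .
qed

text \<open>Modulo the relations, each word may be replaced by a representative of its partition and braid. The
coefficient of each representative is then a total weight of \<open>f\<close> as in the preceding lemma, hence
zero.\<close>

lemma evaluation_injective: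
  assumes nd: "n \<le> d" and f: "f \<in> carrier TB.FA" and Tf: "evaluation f = (\<lambda>z. 0)"
  shows "f \<in> TB.RI"
proof -
  define N where "N K b = (SOME w. w \<in> lists (tb_gens n) \<and> forced n w = K \<and> braid w = b)" for K b
  define nf where "nf w = N (forced n w) (braid w)" for w
  have nf: "nf w \<in> lists (tb_gens n) \<and> forced n (nf w) = forced n w \<and> braid (nf w) = braid w"
    if "w \<in> lists (tb_gens n)" for w
    unfolding nf_def N_def by (rule someI[of _ w]) (use that in simp)
  let ?S = "{w. f w \<noteq> 0}"
  have diff: "(\<lambda>z. f w * (basis_elt w z - basis_elt (nf w) z)) \<in> TB.RI" if "w \<in> ?S" for w
  proof -
    have w: "w \<in> lists (tb_gens n)" using that FA_supp[OF f] by simp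
    have "TB.mono w = TB.mono (nf w)" using mono_determined[OF w, of "nf w"] nf[OF w] by simp
    then show ?thesis
      using nf[OF w] w by (intro TB.RI_smult) (simp add: TB.proj_eq_iff del: in_lists_conv_set)
  qed
  have "(\<lambda>z. \<Sum>w\<in>S. f w * (basis_elt w z - basis_elt (nf w) z)) \<in> TB.RI" if "finite S" "S \<subseteq> ?S" for S
    using that
  proof (induction S rule: finite_induct)
    case empty
    then show ?case using TB.RI.additive_subgroup_axioms additive_subgroup.zero_closed by fastforce
  next
    case (insert w S)
    then show ?case using TB.RI.a_closed[OF diff[of w]] by simp
  qed
  then have "(\<lambda>z. \<Sum>w\<in>?S. f w * (basis_elt w z - basis_elt (nf w) z)) \<in> TB.RI"
    using FA_finite[OF f] by blast
  moreover have "(\<Sum>w\<in>?S. f w * (basis_elt w z - basis_elt (nf w) z)) = f z" for z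
  proof -
    have "(\<Sum>w\<in>?S. f w * (basis_elt w z - basis_elt (nf w) z)) =
        pairing f (\<lambda>w. basis_elt w z) - pairing f (\<lambda>w. basis_elt (nf w) z)"
      by (simp add: pairing_def algebra_simps sum_subtractf)
    also have "pairing f (\<lambda>w. basis_elt w z) = pairing f (basis_elt z)"
      by (rule pairing_cong) (auto simp: basis_elt_def)
    also have "\<dots> = f z" using FA_finite[OF f] by (rule pairing_indicator)
    also have "pairing f (\<lambda>w. basis_elt (nf w) z) = 0"
      unfolding nf_def by (rule evaluation_kernel_pairing[OF nd f Tf, of "\<lambda>K b. basis_elt (N K b) z"])
    finally show ?thesis by simp
  qed
  ultimately show ?thesis by simp
qed

text \<open>The images of the inverse generators are determined because inverses in a ring are unique.\<close>

lemma hom_determined: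
  assumes \<phi>: "\<phi> \<in> alg_hom TB.PA (fixed_algebra d n \<zeta>)" and \<psi>: "\<psi> \<in> alg_hom TB.PA (fixed_algebra d n \<zeta>)"
    and s: "\<And>i. i \<in> {1..<n} \<Longrightarrow> \<psi> (TB.mono [TS i]) = \<phi> (TB.mono [TS i])"
    and E: "\<And>i. i \<in> {1..<n} \<Longrightarrow> \<psi> (TB.mono [TE i]) = \<phi> (TB.mono [TE i])"
    and X: "X \<in> carrier TB.PA"
  shows "\<psi> X = \<phi> X"
proof -
  let ?F = "fixed_algebra d n \<zeta> :: ('k, fb_gen gword set \<Rightarrow> 'k) module"
  have ops: "monoid.mult ?F = monoid.mult A" "one ?F = one A" by (simp_all add: fixed_algebra_def)
  have inA: "\<theta> X \<in> carrier A" if "\<theta> \<in> alg_hom TB.PA ?F" "X \<in> carrier TB.PA" for \<theta> X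
    using that by (auto simp: alg_hom_def linear_maps_def Pi_iff fixed_iff)
  have mult: "\<theta> (X \<otimes>\<^bsub>TB.PA\<^esub> Y) = \<theta> X \<star> \<theta> Y"
    if "\<theta> \<in> alg_hom TB.PA ?F" "X \<in> carrier TB.PA" "Y \<in> carrier TB.PA" for \<theta> X Y
    using that by (simp add: alg_hom_def ring_hom_def ops)
  have one: "\<theta> (TB.mono []) = \<one>\<^bsub>A\<^esub>" if "\<theta> \<in> alg_hom TB.PA ?F" for \<theta>
    using that by (simp add: alg_hom_def ring_hom_def ops TB.one_PA)
  have sinv: "\<psi> (TB.mono [TSinv i]) = \<phi> (TB.mono [TSinv i])" if i: "i \<in> {1..<n}" for i
  proof -
    have w: "[TS i] \<in> lists (tb_gens n)" "[TSinv i] \<in> lists (tb_gens n)" using i by auto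
    note c = TB.mono_closed[OF w(1)] TB.mono_closed[OF w(2)]
    have "\<theta> (TB.mono [TS i]) \<star> \<theta> (TB.mono [TSinv i]) = \<one>\<^bsub>A\<^esub>"
        "\<theta> (TB.mono [TSinv i]) \<star> \<theta> (TB.mono [TS i]) = \<one>\<^bsub>A\<^esub>"
      if \<theta>: "\<theta> \<in> alg_hom TB.PA ?F" for \<theta>
      using TB.mono_relation[OF tb_rels.inv_right[OF i]] TB.mono_relation[OF tb_rels.inv_left[OF i]]
        TB.mono_mult[OF w(1,2)] TB.mono_mult[OF w(2,1)]
      by (simp_all only: mult[OF \<theta> c(1,2), symmetric] mult[OF \<theta> c(2,1), symmetric] one[OF \<theta>] append.simps)
    from this(2)[OF \<psi>] this(1)[OF \<phi>] show ?thesis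
      unfolding s[OF i] by (rule A.inv_unique) (use inA \<phi> \<psi> c in auto)
  qed
  have letter: "\<psi> (TB.mono [g]) = \<phi> (TB.mono [g])" if "g \<in> tb_gens n" for g
    using that s E sinv by (cases g) (simp_all add: tb_gens_def image_iff)
  from X show ?thesis
  proof (induction rule: TB.proj_induct)
    case (mono w)
    then show ?case
    proof (induction w)
      case Nil
      then show ?case by (simp only: one[OF \<phi>] one[OF \<psi>])
    next
      case (Cons g w)
      then have g: "g \<in> tb_gens n" "[g] \<in> lists (tb_gens n)" "w \<in> lists (tb_gens n)" by auto
      note c = TB.mono_closed[OF g(2)] TB.mono_closed[OF g(3)]
      have "\<theta> (TB.mono (g # w)) = \<theta> (TB.mono [g]) \<star> \<theta> (TB.mono w)" if "\<theta> \<in> alg_hom TB.PA ?F" for \<theta>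
        using mult[OF that c] TB.mono_mult[OF g(2,3)] by simp
      then show ?case by (simp only: \<phi> \<psi> letter[OF g(1)] Cons.IH)
    qed
  next
    case (add X Y)
    then show ?case using \<phi> \<psi> by (simp add: alg_hom_def linear_maps_def)
  next
    case (smult c X)
    then show ?case using \<phi> \<psi> by (simp add: alg_hom_def linear_maps_def)
  qed
qed

end

theorem theorem6p5:
  fixes d n :: nat and \<zeta> :: "'k::field"
  assumes "d \<ge> 1" and "n \<ge> 1"
    and "of_nat d \<noteq> (0 :: 'k)"
    and "primitive_root_of_unity d \<zeta>"
  shows "\<exists>\<phi> \<in> alg_hom (tied_braid_algebra n) (fixed_algebra d n \<zeta>).
    (\<forall>i\<in>{1..<n}. \<phi> (tb_s n i) = basis_elt (fb_s d n i) \<and> \<phi> (tb_E n i) = fb_E d n i) \<and>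
    (\<forall>\<psi> \<in> alg_hom (tied_braid_algebra n) (fixed_algebra d n \<zeta>).
       (\<forall>i\<in>{1..<n}. \<psi> (tb_s n i) = basis_elt (fb_s d n i) \<and> \<psi> (tb_E n i) = fb_E d n i) \<longrightarrow>
       (\<forall>x\<in>carrier (tied_braid_algebra n). \<psi> x = \<phi> x)) \<and>
    \<phi> ` carrier (tied_braid_algebra n) = carrier (fixed_algebra d n \<zeta>) \<and>
    (\<phi> \<in> alg_iso (tied_braid_algebra n) (fixed_algebra d n \<zeta>) \<longleftrightarrow> d \<ge> n)"
proof -
  interpret framed_braid d n \<zeta> by unfold_locales (rule assms(3), rule assms(4))
  let ?F = "fixed_algebra d n \<zeta> :: ('k, fb_gen gword set \<Rightarrow> 'k) module"
  have TB_eq: "tied_braid_algebra n = TB.PA" by (simp add: tied_braid_algebra_def)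
  have gens: "tb_s n i = TB.mono [TS i]" "tb_E n i = TB.mono [TE i]" for i
    by (simp_all add: tb_s_def tb_E_def algebra_gen_def)
  obtain \<phi> where \<phi>: "\<phi> \<in> alg_hom TB.PA ?F" "\<And>f. f \<in> carrier TB.FA \<Longrightarrow> \<phi> (TB.proj f) = evaluation f"
    using TB.presented_algebra_lift[OF evaluation_fixed_alg_hom evaluation_respects] by blast
  have images: "\<phi> (TB.mono [TS i]) = basis_elt (fb_s d n i)" "\<phi> (TB.mono [TE i]) = fb_E d n i"
    if i: "i \<in> {1..<n}" for i
  proof -
    have w: "[TS i] \<in> lists (tb_gens n)" "[TE i] \<in> lists (tb_gens n)" using i by auto
    have "ev [g] = ev_gen g" if "g \<in> tb_gens n" for g
      using A.r_one[OF ev_gen_closed[OF that]] by (simp add: ev_simps)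
    then show "\<phi> (TB.mono [TS i]) = basis_elt (fb_s d n i)" "\<phi> (TB.mono [TE i]) = fb_E d n i"
      using w i \<phi>(2)[of "basis_elt [TS i]"] \<phi>(2)[of "basis_elt [TE i]"] by (simp_all add: evaluation_def)
  qed
  have "\<phi> ` carrier TB.PA = evaluation ` carrier TB.FA"
    using \<phi>(2) by (force simp: TB.carrier_PA image_image)
  also have "\<dots> = carrier ?F"
  proof
    show "evaluation ` carrier TB.FA \<subseteq> carrier ?F" using evaluation_fixed by blast
    show "carrier ?F \<subseteq> evaluation ` carrier TB.FA" by (rule subsetI, erule evaluation_surjective) blast
  qed
  finally have surj: "\<phi> ` carrier TB.PA = carrier ?F" .
  have "inj_on \<phi> (carrier TB.PA) \<longleftrightarrow> n \<le> d"
  proof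
    assume nd: "n \<le> d"
    show "inj_on \<phi> (carrier TB.PA)"
    proof (rule inj_onI)
      fix X Y assume "X \<in> carrier TB.PA" "Y \<in> carrier TB.PA" and eq: "\<phi> X = \<phi> Y"
      then obtain f g where fg: "f \<in> carrier TB.FA" "g \<in> carrier TB.FA" "X = TB.proj f" "Y = TB.proj g"
        by (auto simp: TB.carrier_PA)
      have "evaluation f = evaluation g" using eq fg \<phi>(2) by simp
      let ?h = "\<lambda>z. f z - g z"
      have h: "?h \<in> carrier TB.FA"
        using TB.FA.minus_closed[OF fg(1,2)] fg by (simp add: monoid_algebra_minus[OF monoid_free_monoid])
      have "evaluation ?h = (\<lambda>z. 0)"
        using \<open>evaluation f = evaluation g\<close> fg(1,2)
        by (simp add: evaluation_def lin_ext_def pairing_diff_left FA_finite fun_eq_iff)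
      with h nd have "?h \<in> TB.RI" by (intro evaluation_injective)
      then show "X = Y" using fg by (simp add: TB.proj_eq_iff)
    qed
  next
    assume inj: "inj_on \<phi> (carrier TB.PA)"
    show "n \<le> d"
    proof (rule ccontr)
      assume "\<not> n \<le> d"
      then obtain f where f: "f \<in> carrier TB.FA" "evaluation f = (\<lambda>z. 0)" "f \<notin> TB.RI"
        using evaluation_not_injective by (metis not_le)
      have z: "(\<lambda>z. 0) \<in> carrier TB.FA" by (rule monoid_algebra_zero_closed)
      have "\<phi> (TB.proj f) = \<phi> (TB.proj (\<lambda>z. 0))"
        using f(2) by (simp add: \<phi>(2)[OF f(1)] \<phi>(2)[OF z]) (simp add: evaluation_def lin_ext_def)
      then have "TB.proj f = TB.proj (\<lambda>z. 0)"
        using inj f(1) z by (auto simp: TB.carrier_PA dest: inj_onD)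
      then show False using f(3) by (simp add: TB.proj_eq_iff[OF f(1) z])
    qed
  qed
  then have iso: "\<phi> \<in> alg_iso TB.PA ?F \<longleftrightarrow> d \<ge> n"
    using \<phi>(1) surj by (simp add: alg_iso_def bij_betw_def)
  have unique: "\<psi> X = \<phi> X"
    if "\<psi> \<in> alg_hom TB.PA ?F" "X \<in> carrier TB.PA"
      "\<forall>i\<in>{1..<n}. \<psi> (TB.mono [TS i]) = basis_elt (fb_s d n i) \<and> \<psi> (TB.mono [TE i]) = fb_E d n i" for \<psi> X
    by (rule hom_determined[OF \<phi>(1) that(1)]) (use that images in simp_all)
  show ?thesis
    unfolding TB_eq gens using \<phi>(1) images unique surj iso by (intro bexI[of _ \<phi>]) blast+
qed

end
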